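(* Suppose that $3\le m\le 26$. Let $Q_n$ be the number of one-protected nodes in a random $m$-ary search tree with $n$ keys. Then, as $n\to\infty$, $$\frac{Q_n-\mu_{Q,m}\,n}{\sqrt{n}}\stackrel{d}{\longrightarrow}\mathcal{N}\bigl(0,\sigma^2_{Q,m}\bigr),$$ where $$\mu_{Q,m}=\frac{1}{H_m-1}\cdot\frac{1}{m+1},$$ with $H_m$ the $m$th harmonic number, and $\sigma^2_{Q,m}$ can be evaluated as $$\sigma^2_{Q,m}=\sigma_{m+1,m+1},$$ where $\Sigma=(\sigma_{ij})_{i,j=1}^{m+1}$ is the $(m+1)\times(m+1)$ matrix $$\Sigma=\sum_{j,k=2}^{m+1}\frac{u_j'Bu_k}{\lambda_1-\lambda_j-\lambda_k}\,v_jv_k',$$ with $B$, $\lambda_j$, $u_j$, $v_j$ defined from the urn with $m+1$ types described in the context.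
   Context: Here $\stackrel{d}{\longrightarrow}$ denotes convergence in distribution and $\mathcal{N}(\mu,\sigma^2)$ is the normal distribution with mean $\mu$ and variance $\sigma^2$. Vectors are column vectors and $'$ denotes transpose (without complex conjugation). Random $m$-ary search tree ($m\ge2$). It is constructed recursively from a sequence of $n$ keys which are i.i.d. uniform random numbers in $[0,1]$ (equivalently, a uniformly random permutation of $\{1,\dots,n\}$). Each node may contain up to $m-1$ keys. One starts with an empty root. The first $m-1$ keys are put in the root, in increasing order from left to right; they divide the set of real numbers into $m$ intervals $J_1,\dots,J_m$. When the root is full (contains $m-1$ keys) it gets $m$ children that are initially empty, and each further key is passed to one of the children: a key in $J_i$ is passed to the $i$-th child. The procedure repeats recursively in the subtrees until all keys are added. Nodes containing at least one key are internal; empty nodes are external. The tree is regarded as consisting only of its internal nodes. A leaf is an internal node that has no internal children (it may have external children). A one-protected node is an internal node that is not a leaf. Urn. The tree, together with its external nodes, is cut into pieces (balls of a generalised P\'olya urn) of types $1,\dots,m+1$. Type 1: an external node that is not a child of a leaf. Type $i$, $2\le i\le m-1$: a leaf with $i-1$ keys. Type $m$: a leaf with $m-1$ keys together with its $m$ external children. Type $m+1$: an internal node that is not a leaf (i.e. a one-protected node). The activities are $a=(a_1,\dots,a_{m+1})'=(1,2,\dots,m,0)'$. At each step a ball is drawn with probability proportional to its activity; if the drawn ball has type $i$, the vector of numbers of balls of the different types changes by $\xi_i$, where, with $e_1,\dots,e_{m+1}$ the standard basis of $\mathbb{R}^{m+1}$, $$\xi_i=-e_i+e_{i+1}\quad(1\le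 i\le m-1),\qquad \xi_m=-e_m+(m-1)\,e_1+e_2+e_{m+1},$$ and balls of type $m+1$ are never drawn (put $\xi_{m+1}=0$). Let $A$ be the $(m+1)\times(m+1)$ matrix whose $i$-th column is $a_i\xi_i$. It is diagonalisable; let $\lambda_1,\dots,\lambda_{m+1}$ be its eigenvalues, where $\lambda_1=1$ is the largest, and let $\{u_i\}_{i=1}^{m+1}$ and $\{v_i\}_{i=1}^{m+1}$ be dual bases of left and right eigenvectors: $u_i'A=\lambda_iu_i'$, $Av_i=\lambda_iv_i$, $u_i'v_j=\delta_{ij}$, normalised so that $a'v_1=1$. Write $v_1=(v_{11},\dots,v_{1,m+1})'$. Finally $$B=\sum_{i=1}^{m+1}v_{1i}\,a_i\,\xi_i\xi_i'.$$ *)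

theory Defs
  imports
    "HOL-Probability.Probability"
    "Jordan_Normal_Form.Char_Poly"
begin

no_notation inner (infixl "\<bullet>" 70)
no_notation vec_nth (infixl "$" 90)

text \<open>
  An external node is an empty node. An internal node carries its sorted list of keys and the
  list of its children: no children as long as it has fewer than \<open>m - 1\<close> keys, and
  \<open>m\<close> (possibly external) children once it is full.
\<close>

datatype 'k mtree = External | Internal "'k list" "'k mtree list"

definition make_node :: "nat \<Rightarrow> 'k list \<Rightarrow> 'k mtree" where
  "make_node m ks = Internal ks (if length ks = m - 1 then replicate m External else [])"

lemma size_nth_less_Suc_size_list [termination_simp]:
  assumes "j < length ts"
  shows "size (ts ! j) < Suc (n + size_list size ts)"
  using size_list_estimation'[of "ts ! j" ts "size (ts ! j)" size] assms by force

text \<open>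
  The keys of a full node cut the line into the intervals \<open>J\<^sub>1, \<dots>, J\<^sub>m\<close>; a new key
  \<open>x\<close> lies in the interval whose zero-based index is the number of keys below \<open>x\<close>.
  The test \<open>j < length ts\<close> always succeeds for trees grown from \<open>External\<close>; it makes the
  recursion well-founded on arbitrary values of the datatype.
\<close>

fun insert_key :: "nat \<Rightarrow> 'k::linorder \<Rightarrow> 'k mtree \<Rightarrow> 'k mtree" where
  "insert_key m x External = make_node m [x]"
| "insert_key m x (Internal ks ts) =
     (if length ks < m - 1 then make_node m (insort x ks)
      else (let j = length (filter (\<lambda>k. k < x) ks) in
        if j < length ts then Internal ks (ts[j := insert_key m x (ts ! j)])
        else Internal ks ts))"

definition search_tree :: "nat \<Rightarrow> 'k::linorder list \<Rightarrow> 'k mtree" where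
  "search_tree m xs = fold (insert_key m) xs External"

fun is_leaf :: "'k mtree \<Rightarrow> bool" where
  "is_leaf External \<longleftrightarrow> False"
| "is_leaf (Internal ks ts) \<longleftrightarrow> (\<forall>t \<in> set ts. t = External)"

fun one_protected :: "'k mtree \<Rightarrow> nat" where
  "one_protected External = 0"
| "one_protected (Internal ks ts) =
     (if is_leaf (Internal ks ts) then 0 else 1) + sum_list (map one_protected ts)"

text \<open>
  The urn. Vectors and matrices are indexed from 0, so a ball of type \<open>i\<close> has index
  \<open>i - 1\<close>, and the indices are \<open>0, \<dots>, m\<close>.
\<close>

definition activity :: "nat \<Rightarrow> complex Matrix.vec" where
  "activity m = Matrix.vec (m + 1) (\<lambda>i. if i < m then of_nat (i + 1) else 0)"

definition increment :: "nat \<Rightarrow> nat \<Rightarrow> complex Matrix.vec" where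
  "increment m i =
     (let e = unit_vec (m + 1) in
      if i + 1 < m then - e i + e (i + 1)
      else if i + 1 = m then - e (m - 1) + of_nat (m - 1) \<cdot>\<^sub>v e 0 + e 1 + e m
      else 0\<^sub>v (m + 1))"

definition urn_A :: "nat \<Rightarrow> complex Matrix.mat" where
  "urn_A m = Matrix.mat (m + 1) (m + 1) (\<lambda>(r, i). activity m $ i * increment m i $ r)"

definition urn_B :: "nat \<Rightarrow> complex Matrix.vec \<Rightarrow> complex Matrix.mat" where
  "urn_B m v1 = Matrix.mat (m + 1) (m + 1) (\<lambda>(r, s).
     \<Sum>i\<le>m. v1 $ i * activity m $ i * (increment m i $ r * increment m i $ s))"

text \<open>
  Dual bases of left and right eigenvectors. The scalar product of
  \<^theory>\<open>Jordan_Normal_Form.Matrix\<close> is bilinear, not sesquilinear. Biorthogonality makes both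
  families bases of \<open>\<complex>\<^sup>m\<^sup>+\<^sup>1\<close>, so that \<open>lam\<close> lists all eigenvalues of the matrix
  with multiplicity.
\<close>

definition dual_eigenbases ::
  "nat \<Rightarrow> (nat \<Rightarrow> complex) \<Rightarrow> (nat \<Rightarrow> complex Matrix.vec) \<Rightarrow> (nat \<Rightarrow> complex Matrix.vec) \<Rightarrow> bool" where
  "dual_eigenbases m lam u v \<longleftrightarrow>
     (\<forall>i\<le>m. eigenvector (transpose_mat (urn_A m)) (u i) (lam i)) \<and>
     (\<forall>i\<le>m. eigenvector (urn_A m) (v i) (lam i)) \<and>
     (\<forall>i\<le>m. \<forall>j\<le>m. u i \<bullet> v j = (if i = j then 1 else 0)) \<and>
     lam 0 = 1 \<and> activity m \<bullet> v 0 = 1"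

definition urn_Sigma ::
  "nat \<Rightarrow> (nat \<Rightarrow> complex) \<Rightarrow> (nat \<Rightarrow> complex Matrix.vec) \<Rightarrow> (nat \<Rightarrow> complex Matrix.vec) \<Rightarrow> complex Matrix.mat" where
  "urn_Sigma m lam u v = Matrix.mat (m + 1) (m + 1) (\<lambda>(r, s).
     \<Sum>j = 1..m. \<Sum>k = 1..m.
       (u j \<bullet> (urn_B m (v 0) *\<^sub>v u k)) / (lam 0 - lam j - lam k) * (v j $ r * v k $ s))"

text \<open>
  The second parameter is the variance; for variance 0 this is the point mass at \<open>\<mu>\<close>.
\<close>

definition normal_law :: "real \<Rightarrow> real \<Rightarrow> real measure" where
  "normal_law \<mu> var = distr std_normal_distribution borel (\<lambda>z. \<mu> + sqrt var * z)"

end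

theory Submission
  imports Defs
begin

text \<open>
  Inserting a key into an \<open>m\<close>-ary search tree means choosing one of its gaps, and the type of the
  ball of the urn that owns the gap determines how the composition of the tree changes: a ball of
  activity \<open>a\<close> owns exactly \<open>a\<close> gaps (\<open>sum_over_gaps\<close>). The relative order of i.i.d. uniform keys is
  a uniformly random permutation (\<open>expectation_rank_list\<close>), so a new key falls into each of the \<open>n + 1\<close>
  gaps with the same probability, and the averages of functions of the composition over all
  insertion orders evolve by the transition operator of the urn (\<open>perm_avg_Suc\<close>). The proof works
  with these averages alone; the number of one-protected nodes is the last coordinate of the
  composition.

  Let \<open>x\<^sub>k\<close> be the composition with \<open>k\<close> keys, \<open>v\<close> the right eigenvector \<open>v\<^sub>1\<close> (\<open>steady m\<close>)
  and \<open>w\<close> a functional. The conditional mean of \<open>x\<^sub>k\<^sub>+\<^sub>1\<close> is \<open>(I + A / (k + 1)) x\<^sub>k\<close>. Hence, if \<open>w\<close> is pulled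
  back from time \<open>n\<close> to time \<open>k\<close> through the transposes of these matrices, the resulting weights
  \<open>w\<^sub>n\<^sub>,\<^sub>k\<close> make \<open>w\<^sub>n\<^sub>,\<^sub>k \<cdot> x\<^sub>k\<close> a martingale in \<open>k\<close> which ends at \<open>w \<cdot> x\<^sub>n\<close>. For
  \<open>w = e\<^sub>m - \<mu> a\<close>, which is orthogonal to \<open>v\<close>, the end value is \<open>Q\<^sub>n - \<mu> (n + 1)\<close>, and
  \<open>|w\<^sub>n\<^sub>,\<^sub>k|\<close> is at most of order \<open>(n / k) powr \<rho>\<close>, where \<open>\<rho>\<close> bounds the real parts of the eigenvalues other
  than 1. When \<open>\<rho> < 1 / 2\<close>, the sum of \<open>|w\<^sub>n\<^sub>,\<^sub>k|\<^sup>2\<close> over \<open>k\<close> is at most of order \<open>n\<close>. First, this makes the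
  second moments at most linear in \<open>n\<close>, so \<open>x\<^sub>k / (k + 1)\<close> approaches \<open>v\<close> in mean (\<open>mean_deviation\<close>). Second,
  it allows the conditional characteristic function of each increment to be replaced by the
  Gaussian factor of a deterministic variance, the one that the increment would have if the
  composition were proportional to \<open>v\<close>; at arguments of size \<open>1 / sqrt n\<close> the total error vanishes. The
  characteristic function of the end value is therefore asymptotically a product of Gaussian
  factors (\<open>urn_central_limit\<close>), and Levy's continuity theorem finishes the argument.

  The hypothesis \<open>m \<le> 26\<close> provides \<open>\<rho> < 1 / 2\<close>. The eigenvalues are 0, \<open>-m\<close> and the solutions of
  \<open>(z + 1) \<dots> (z + m - 1) = m!\<close>. A solution with \<open>Re z \<ge> 1 / 2\<close> and \<open>Im z > 0\<close> has, by comparison of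
  moduli, a small imaginary part, so the arguments of the factors add up to a number strictly
  between 0 and \<open>2 pi\<close>; but the product is positive, a contradiction (\<open>indicial_root_real_part\<close>).

  The limit variance is the limit of the averaged deterministic variances. Expanding the weights in
  a basis of left eigenvectors turns it into a double sum over eigenvalues \<open>\<lambda>\<^sub>j\<close>, \<open>\<lambda>\<^sub>l\<close>, in which the
  averages of products of \<open>(1 + \<lambda>\<^sub>j / i) (1 + \<lambda>\<^sub>l / i)\<close> converge to \<open>1 / (1 - \<lambda>\<^sub>j - \<lambda>\<^sub>l)\<close>
  (\<open>gain_product_average\<close>). This is the entry of \<open>\<Sigma>\<close> (\<open>urn_Sigma_eq\<close>). The sequence itself does not
  mention the eigenvectors, so every dual eigenbasis gives the same value. That the limit exists
  at all requires one such basis, which is obtained from the distinctness of the eigenvalues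
  (\<open>eigensystem_exists\<close>).
\<close>

section \<open>Search trees as urn compositions\<close>

definition unit_fun :: "nat \<Rightarrow> nat \<Rightarrow> real" where
  "unit_fun i = (\<lambda>r. if r = i then 1 else 0)"

text \<open>
  The numbers of balls of the urn cut from a tree, with types indexed from 0. A leaf with \<open>j\<close> keys is
  one ball of index \<open>j\<close>, and this covers the full leaf, whose external children belong to its ball;
  an external node, seen from outside, is the case \<open>j = 0\<close>. The balls below a node that is not a leaf
  are those of its subtrees, besides one ball of index \<open>m\<close> for the node itself.
\<close>

fun counts :: "nat \<Rightarrow> 'k mtree \<Rightarrow> nat \<Rightarrow> real" where
  "counts m External = unit_fun 0"
| "counts m (Internal ks ts) =
     (if is_leaf (Internal ks ts) then unit_fun (length ks)
      else (\<lambda>r. unit_fun m r + (\<Sum>t\<leftarrow>ts. counts m t r)))"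

text \<open>
  The real-valued form of \<open>increment\<close>.
\<close>

definition jump :: "nat \<Rightarrow> nat \<Rightarrow> nat \<Rightarrow> real" where
  "jump m i = (\<lambda>r.
     if i + 1 < m then unit_fun (i + 1) r - unit_fun i r
     else if i + 1 = m
       then unit_fun 1 r + unit_fun m r + real (m - 1) * unit_fun 0 r - unit_fun (m - 1) r
     else 0)"

lemma map_mtree_External_iff [simp]: "map_mtree h t = External \<longleftrightarrow> t = External"
  by (cases t) auto

lemma is_leaf_map_mtree [simp]: "is_leaf (map_mtree h t) = is_leaf t"
  by (cases t) auto

lemma counts_map_mtree [simp]: "counts m (map_mtree h t) = counts m t"
proof (induction t)
  case (Internal ks ts)
  have "(\<Sum>t\<leftarrow>map (map_mtree h) ts. counts m t r) = (\<Sum>t\<leftarrow>ts. counts m t r)" for r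
    using Internal by (simp add: comp_def cong: map_cong)
  moreover have "is_leaf (Internal (map h ks) (map (map_mtree h) ts)) = is_leaf (Internal ks ts)"
    by auto
  ultimately show ?case by (simp del: is_leaf.simps map_map)
qed auto

lemma insort_map_strict_mono:
  assumes "strict_mono_on (insert x (set ks)) h"
  shows "insort (h x) (map h ks) = map h (insort x ks)"
  using assms
proof (induction ks)
  case (Cons k ks)
  have "h x \<le> h k \<longleftrightarrow> x \<le> k"
    using Cons.prems by (simp add: strict_mono_on_less_eq)
  moreover have "strict_mono_on (insert x (set ks)) h"
    using Cons.prems by (rule monotone_on_subset) auto
  ultimately show ?case using Cons.IH by simp
qed auto

lemma insert_key_map_mtree:
  assumes "strict_mono_on (insert x (set_mtree t)) h"
  shows "insert_key m (h x) (map_mtree h t) = map_mtree h (insert_key m x t)"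
  using assms
proof (induction m x t rule: insert_key.induct)
  case (2 m x ks ts)
  have ks: "insort (h x) (map h ks) = map h (insort x ks)"
    using 2(2) by (intro insort_map_strict_mono) (auto elim!: monotone_on_subset)
  have "h k < h x \<longleftrightarrow> k < x" if "k \<in> set ks" for k
    using 2(2) that by (simp add: strict_mono_on_less)
  then have f: "filter (\<lambda>k. k < h x) (map h ks) = map h (filter (\<lambda>k. k < x) ks)"
    by (simp add: filter_map comp_def cong: filter_cong)
  let ?j = "length (filter (\<lambda>k. k < x) ks)"
  show ?case
  proof (cases "length ks < m - 1 \<or> \<not> ?j < length ts")
    case True
    then show ?thesis using f ks by (auto simp: make_node_def)
  next
    case False
    then have "strict_mono_on (insert x (set_mtree (ts ! ?j))) h"
      by (intro monotone_on_subset[OF 2(2)]) (auto intro!: bexI[of _ "ts ! ?j"])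
    with False 2(1) show ?thesis using f by (auto simp: map_update Let_def)
  qed
qed (auto simp: make_node_def)

lemma set_mtree_insert_key: "set_mtree (insert_key m x t) \<subseteq> insert x (set_mtree t)"
proof (induction m x t rule: insert_key.induct)
  case (2 m x ks ts)
  let ?j = "length (filter (\<lambda>k. k < x) ks)"
  show ?case
  proof (cases "length ks < m - 1 \<or> \<not> ?j < length ts")
    case True
    then show ?thesis by (auto simp: make_node_def set_insort_key)
  next
    case False
    then have "set_mtree (insert_key m x (ts ! ?j)) \<subseteq> insert x (set_mtree (ts ! ?j))"
      using 2 by auto
    moreover have "set_mtree (ts ! ?j) \<subseteq> set_mtree (Internal ks ts)"
      using False by (auto intro!: bexI[of _ "ts ! ?j"])
    moreover have "set_mtree (insert_key m x (Internal ks ts))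
        \<subseteq> set_mtree (Internal ks ts) \<union> set_mtree (insert_key m x (ts ! ?j))"
      using False set_update_subset_insert[of ts ?j] by (auto simp: Let_def)
    ultimately show ?thesis by blast
  qed
qed (auto simp: make_node_def)

lemma search_tree_snoc: "search_tree m (xs @ [x]) = insert_key m x (search_tree m xs)"
  by (simp add: search_tree_def)

lemma set_mtree_search_tree: "set_mtree (search_tree m xs) \<subseteq> set xs"
proof (induction xs rule: rev_induct)
  case Nil
  show ?case by (simp add: search_tree_def)
next
  case (snoc x xs)
  then show ?case
    using set_mtree_insert_key[of m x "search_tree m xs"] by (auto simp: search_tree_snoc)
qed

text \<open>
  The shape of a search tree depends only on the relative order of the keys. This allows the keys to
  be replaced by their ranks, and ranks by even integers, which leave room for a new key in each gap.
\<close>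

lemma search_tree_map:
  "strict_mono_on (set xs) h \<Longrightarrow> search_tree m (map h xs) = map_mtree h (search_tree m xs)"
proof (induction xs rule: rev_induct)
  case Nil
  show ?case by (simp add: search_tree_def)
next
  case (snoc x xs)
  have "strict_mono_on (set xs) h"
    by (rule monotone_on_subset[OF snoc.prems]) auto
  moreover have "strict_mono_on (insert x (set_mtree (search_tree m xs))) h"
    by (rule monotone_on_subset[OF snoc.prems]) (use set_mtree_search_tree[of m xs] in auto)
  ultimately show ?case
    using snoc.IH by (simp add: search_tree_snoc insert_key_map_mtree)
qed

text \<open>
  A tree grown from the key set \<open>K\<close>, all keys lying strictly between \<open>p\<close> and \<open>q\<close>. The two bounds are
  carried along because the gaps of a subtree are counted in the interval that its ancestors leave.
\<close>

inductive bst :: "nat \<Rightarrow> int \<Rightarrow> int \<Rightarrow> int set \<Rightarrow> int mtree \<Rightarrow> bool" for m :: nat where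
  external: "bst m p q {} External"
| partial: "\<lbrakk>sorted_wrt (<) (p # ks @ [q]); ks \<noteq> []; length ks < m - 1\<rbrakk>
    \<Longrightarrow> bst m p q (set ks) (Internal ks [])"
| full: "\<lbrakk>sorted_wrt (<) (p # ks @ [q]); length ks = m - 1; length ts = m;
     \<And>j. j < m \<Longrightarrow> bst m ((p # ks @ [q]) ! j) ((p # ks @ [q]) ! Suc j) (K j) (ts ! j)\<rbrakk>
    \<Longrightarrow> bst m p q (set ks \<union> (\<Union>j<m. K j)) (Internal ks ts)"

lemma sorted_wrt_less_nth_mono:
  fixes bs :: "'k::linorder list"
  assumes "sorted_wrt (<) bs" "i < length bs" "j < length bs"
  shows "bs ! i < bs ! j \<longleftrightarrow> i < j"
  using assms sorted_wrt_nth_less[of "(<)" bs] by (metis less_asym linorder_neqE_nat less_irrefl)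

lemma child_index_bounds:
  fixes ks :: "'k::linorder list"
  assumes s: "sorted_wrt (<) (p # ks @ [q])" and x: "p < x" "x < q" "x \<notin> set ks"
  defines "j \<equiv> length (filter (\<lambda>k. k < x) ks)"
  shows "j \<le> length ks" "(p # ks @ [q]) ! j < x" "x < (p # ks @ [q]) ! Suc j"
proof -
  have "j \<le> length ks \<and> (p # ks @ [q]) ! j < x \<and> x < (p # ks @ [q]) ! Suc j"
    using s x unfolding j_def
  proof (induction ks arbitrary: p)
    case (Cons k ks)
    show ?case
    proof (cases "k < x")
      case True
      with Cons.IH[of k] Cons.prems show ?thesis by auto
    next
      case False
      then have "x < k" using Cons.prems by auto
      then have "filter (\<lambda>k. k < x) ks = []"
        using Cons.prems by (auto simp: filter_empty_conv)
      then show ?thesis using \<open>x < k\<close> Cons.prems by auto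
    qed
  qed auto
  then show "j \<le> length ks" "(p # ks @ [q]) ! j < x" "x < (p # ks @ [q]) ! Suc j" by auto
qed

lemma interval_index_unique:
  fixes bs :: "'k::linorder list"
  assumes "sorted_wrt (<) bs" "Suc i < length bs" "Suc j < length bs"
    and "bs ! i < x" "x < bs ! Suc i" "bs ! j < x" "x < bs ! Suc j"
  shows "i = j"
proof -
  have "bs ! i < bs ! Suc j" "bs ! j < bs ! Suc i" using assms by (auto intro: less_trans)
  then show ?thesis using assms sorted_wrt_less_nth_mono[of bs] by (simp add: less_Suc_eq_le)
qed

lemma bst_keys_between: "bst m p q K t \<Longrightarrow> K \<subseteq> {p<..<q}"
proof (induction rule: bst.induct)
  case (full p ks q ts K)
  have b: "p \<le> (p # ks @ [q]) ! j \<and> (p # ks @ [q]) ! Suc j \<le> q" if "j < m" for j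
  proof -
    have len: "length (p # ks @ [q]) = m + 1" using that full(2) by simp
    have "(p # ks @ [q]) ! m = q" using that full(2) by (cases m) (auto simp: nth_append)
    then have "\<not> (p # ks @ [q]) ! j < p" "\<not> q < (p # ks @ [q]) ! Suc j"
      using that len sorted_wrt_less_nth_mono[OF full(1), of j 0]
         sorted_wrt_less_nth_mono[OF full(1), of m "Suc j"] by auto
    then show ?thesis by linarith
  qed
  have "K j \<subseteq> {p<..<q}" if "j < m" for j
    using b[OF that] full(5)[OF that] by fastforce
  moreover have "set ks \<subseteq> {p<..<q}"
    using full(1) by (auto simp: sorted_wrt_append)
  ultimately show ?case by blast
qed (auto simp: sorted_wrt_append)

lemma set_insort_strict_sorted:
  fixes x :: "'k::linorder"
  assumes "sorted_wrt (<) (p # ks @ [q])" "p < x" "x < q" "x \<notin> set ks"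
  shows "sorted_wrt (<) (p # insort x ks @ [q])"
  using assms by (auto simp: sorted_wrt_append strict_sorted_iff sorted_insort distinct_insort set_insort_key)

lemma bst_insert_key:
  assumes m: "3 \<le> m"
  shows "bst m p q K t \<Longrightarrow> p < x \<Longrightarrow> x < q \<Longrightarrow> x \<notin> K \<Longrightarrow> bst m p q (insert x K) (insert_key m x t)"
proof (induction rule: bst.induct)
  case (external p q)
  then show ?case using m partial[where ks = "[x]" and p = p and q = q and m = m] by (auto simp: make_node_def)
next
  case (partial p ks q)
  note s = set_insort_strict_sorted[OF partial(1,4,5,6)]
  show ?case
  proof (cases "length (insort x ks) = m - 1")
    case True
    have "bst m p q (set (insort x ks) \<union> (\<Union>j<m. {})) (Internal (insort x ks) (replicate m External))"
      by (rule bst.full) (use True s in \<open>auto intro: bst.external\<close>)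
    then show ?thesis using partial True by (simp add: make_node_def set_insort_key)
  next
    case False
    have "bst m p q (set (insort x ks)) (Internal (insort x ks) [])"
      by (rule bst.partial) (use False s partial in auto)
    then show ?thesis using partial False by (simp add: make_node_def set_insort_key)
  qed
next
  case (full p ks q ts K)
  let ?j = "length (filter (\<lambda>k. k < x) ks)" and ?b = "p # ks @ [q]"
  have j: "?j \<le> length ks" "?b ! ?j < x" "x < ?b ! Suc ?j"
    using full by (intro child_index_bounds; simp)+
  then have jm: "?j < m" using full m by simp
  have "bst m p q (set ks \<union> (\<Union>i<m. (K(?j := insert x (K ?j))) i))
      (Internal ks (ts[?j := insert_key m x (ts ! ?j)]))"
  proof (rule bst.full)
    fix i assume i: "i < m"
    show "bst m (?b ! i) (?b ! Suc i) ((K(?j := insert x (K ?j))) i)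
       (ts[?j := insert_key m x (ts ! ?j)] ! i)"
      using full i j jm by (cases "i = ?j") auto
  qed (use full in auto)
  moreover have "(\<Union>i<m. (K(?j := insert x (K ?j))) i) = insert x (\<Union>i<m. K i)"
    using jm by (auto split: if_splits)
  moreover have "insert_key m x (Internal ks ts) = Internal ks (ts[?j := insert_key m x (ts ! ?j)])"
    using full jm by (simp add: Let_def)
  ultimately show ?case by (simp only: Un_insert_right)
qed


text \<open>
  In a tree on the even keys between \<open>p\<close> and \<open>q\<close>, both even, each gap contains exactly one odd number.
\<close>

definition odds :: "int \<Rightarrow> int \<Rightarrow> int set" where
  "odds p q = {g. odd g \<and> p < g \<and> g < q}"

definition evens :: "int \<Rightarrow> int \<Rightarrow> int set" where
  "evens p q = {g. even g \<and> p < g \<and> g < q}"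

lemma finite_odds [simp]: "finite (odds p q)"
  by (rule finite_subset[of _ "{p<..<q}"]) (auto simp: odds_def)

lemma card_odds:
  assumes "even p" "even q" "p < q"
  shows "card (odds p q) = card (evens p q) + 1"
proof -
  have "odds p q = (\<lambda>g. g - 1) ` evens p (q + 2)"
  proof (rule Set.set_eqI)
    fix x
    have "odd x \<and> p < x \<and> x < q \<longleftrightarrow> even (x + 1) \<and> p < x + 1 \<and> x + 1 < q + 2"
      using assms by presburger
    also have "\<dots> \<longleftrightarrow> x \<in> (\<lambda>g. g - 1) ` evens p (q + 2)"
      by (auto simp: evens_def image_iff intro!: exI[of _ "x + 1"])
    finally show "x \<in> odds p q \<longleftrightarrow> x \<in> (\<lambda>g. g - 1) ` evens p (q + 2)"
      by (simp add: odds_def)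
  qed
  moreover have "evens p (q + 2) = insert q (evens p q)"
  proof (rule Set.set_eqI)
    fix x
    have "even x \<and> p < x \<and> x < q + 2 \<longleftrightarrow> x = q \<or> even x \<and> p < x \<and> x < q"
      using assms by presburger
    then show "x \<in> evens p (q + 2) \<longleftrightarrow> x \<in> insert q (evens p q)"
      by (simp add: evens_def)
  qed
  moreover have "finite (evens p q)" "q \<notin> evens p q"
    by (rule finite_subset[of _ "{p<..<q}"]) (auto simp: evens_def)
  moreover have "card ((\<lambda>g. g - 1) ` evens p (q + 2)) = card (evens p (q + 2))"
    by (rule card_image) (simp add: inj_on_def)
  moreover have "card (insert q (evens p q)) = card (evens p q) + 1"
    using \<open>finite (evens p q)\<close> \<open>q \<notin> evens p q\<close> by simp
  ultimately show ?thesis by simp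
qed

lemma insert_key_not_External: "insert_key m x t \<noteq> External"
  by (cases t) (auto simp: make_node_def Let_def)

lemma sum_list_map_list_update:
  fixes f :: "'t \<Rightarrow> real"
  assumes "j < length ts"
  shows "(\<Sum>t\<leftarrow>ts[j := t']. f t) = (\<Sum>t\<leftarrow>ts. f t) - f (ts ! j) + f t'"
  using assms
proof (induction ts arbitrary: j)
  case (Cons a ts)
  then show ?case by (cases j) auto
qed auto

lemma sum_unit_fun:
  fixes f :: "nat \<Rightarrow> 'b::real_vector"
  assumes "j < m"
  shows "(\<Sum>i<m. (real (i + 1) * unit_fun j i) *\<^sub>R f i) = real (j + 1) *\<^sub>R f j"
proof -
  have "(\<Sum>i<m. (real (i + 1) * unit_fun j i) *\<^sub>R f i)
      = (\<Sum>i<m. if i = j then real (j + 1) *\<^sub>R f j else 0)"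
    by (intro sum.cong) (auto simp: unit_fun_def)
  with assms show ?thesis by simp
qed

text \<open>
  The reason why activities and increments of the urn are the right ones: all gaps of a leaf with \<open>i\<close>
  keys, or of an external node, have the same effect on the composition. The function \<open>F\<close> is arbitrary in the induction because the composition of the rest of
  the tree has to be added to that of the subtree which receives the key.
\<close>

lemma sum_over_gaps:
  fixes F :: "(nat \<Rightarrow> real) \<Rightarrow> 'b::real_vector"
  assumes m: "3 \<le> m"
  shows "bst m p q K t \<Longrightarrow> even p \<Longrightarrow> even q \<Longrightarrow> p < q \<Longrightarrow> K = evens p q \<Longrightarrow>
    (\<Sum>g\<in>odds p q. F (counts m (insert_key m g t)))
    = (\<Sum>i<m. (real (i + 1) * counts m t i) *\<^sub>R F (\<lambda>r. counts m t r + jump m i r))"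
proof (induction arbitrary: F rule: bst.induct)
  case (external p q)
  have card: "card (odds p q) = 1"
    using card_odds[of p q] external by simp
  have "counts m (insert_key m g External) = unit_fun 1" for g :: int
    using m by (simp add: make_node_def)
  moreover have "(\<lambda>r. counts m (External :: int mtree) r + jump m 0 r) = unit_fun 1"
    using m by (auto simp: jump_def)
  ultimately show ?case
    using card m sum_unit_fun[of 0 m "\<lambda>i. F (\<lambda>r. counts m (External :: int mtree) r + jump m i r)"]
    by (simp add: sum_constant_scaleR)
next
  case (partial p ks q)
  have "distinct ks"
    using partial(1) by (auto simp: sorted_wrt_append strict_sorted_iff)
  then have card: "card (odds p q) = length ks + 1"
    using card_odds[of p q] partial by (simp add: distinct_card[symmetric])
  have l: "length ks < m" using partial by simp
  have "counts m (insert_key m g (Internal ks [])) = unit_fun (length ks + 1)" for g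
    using partial by (auto simp: make_node_def)
  moreover have "length ks + 1 < m" using partial(3) by arith
  then have "jump m (length ks) = (\<lambda>r. unit_fun (length ks + 1) r - unit_fun (length ks) r)"
    by (simp add: jump_def)
  then have "(\<lambda>r. counts m (Internal ks []) r + jump m (length ks) r) = unit_fun (length ks + 1)"
    by simp
  ultimately show ?case
    using card sum_unit_fun[OF l, of "\<lambda>i. F (\<lambda>r. counts m (Internal ks []) r + jump m i r)"]
    by (simp add: sum_constant_scaleR)
next
  case (full p ks q ts K)
  let ?b = "p # ks @ [q]"
  let ?S = "\<lambda>r. \<Sum>t\<leftarrow>ts. counts m t r"
  have len: "length ?b = m + 1" using full(2) m by simp
  have inj: "i = j" if "i < m" "j < m" "?b ! i < x" "x < ?b ! Suc i" "?b ! j < x" "x < ?b ! Suc j" for i j x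
    by (rule interval_index_unique[OF full(1)]) (use that len in auto)
  have b0: "?b ! 0 = p" and bm: "?b ! m = q"
    using full(2) m by (auto simp: nth_append nth_Cons')
  have bmono: "?b ! i < ?b ! j \<longleftrightarrow> i < j" if "i \<le> m" "j \<le> m" for i j
    by (rule sorted_wrt_less_nth_mono[OF full(1)]) (use that len in auto)
  have bmono': "?b ! i \<le> ?b ! j" if "i \<le> j" "j \<le> m" for i j
    using bmono[of j i] that by (meson le_trans not_less)
  have range: "p \<le> ?b ! j" "?b ! Suc j \<le> q" if "j < m" for j
    using bmono'[of 0 j] bmono'[of "Suc j" m] b0 bm that by auto
  have Kb: "K j \<subseteq> {?b ! j<..<?b ! Suc j}" if "j < m" for j
    by (rule bst_keys_between[OF full(4)[OF that]])
  have ks_even: "set ks \<subseteq> evens p q" using full.prems(4) by blast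
  have beven: "even (?b ! j)" if "j \<le> m" for j
  proof -
    have "?b ! j \<in> set ?b" by (rule nth_mem) (use len that in auto)
    moreover have "\<forall>x\<in>set ?b. even x" using ks_even full.prems(1,2) by (auto simp: evens_def)
    ultimately show ?thesis by blast
  qed
  have ksb: "\<exists>i. 0 < i \<and> i < m \<and> k = ?b ! i" if "k \<in> set ks" for k
  proof -
    obtain i where "i < length ks" "ks ! i = k" using \<open>k \<in> set ks\<close> by (metis in_set_conv_nth)
    then show ?thesis using full(2) by (intro exI[of _ "Suc i"]) (auto simp: nth_append)
  qed
  have K: "K j = evens (?b ! j) (?b ! Suc j)" if j: "j < m" for j
  proof (rule equalityI)
    have "K j \<subseteq> evens p q" unfolding full.prems(4)[symmetric] using j by blast
    then show "K j \<subseteq> evens (?b ! j) (?b ! Suc j)"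
      using Kb[OF j] by (auto simp: evens_def simp del: nth_Cons_Suc)
    show "evens (?b ! j) (?b ! Suc j) \<subseteq> K j"
    proof
      fix e assume e: "e \<in> evens (?b ! j) (?b ! Suc j)"
      then have "e \<in> evens p q" using range[OF j] unfolding evens_def by fastforce
      then have "e \<in> set ks \<union> (\<Union>j<m. K j)" using full.prems(4) by simp
      moreover have "e \<notin> set ks"
      proof
        assume "e \<in> set ks"
        then obtain i where i: "i < m" "e = ?b ! i" using ksb by blast
        then have "?b ! j < ?b ! i" "?b ! i < ?b ! Suc j" using e by (auto simp: evens_def)
        then show False using bmono[of j i] bmono[of i "Suc j"] j i(1) by simp
      qed
      ultimately obtain i where i: "i < m" "e \<in> K i" by auto
      then have "?b ! i < e" "e < ?b ! Suc i" using Kb[of i] by auto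
      then have "i = j" using inj[of i j e] i(1) e j unfolding evens_def by blast
      with i show "e \<in> K j" by simp
    qed
  qed
  have idx: "length (filter (\<lambda>k. k < g) ks) = j"
    if j: "j < m" and g: "g \<in> odds (?b ! j) (?b ! Suc j)" for g j
  proof -
    have g': "p < g" "g < q" "g \<notin> set ks"
      using g range[OF j] ks_even unfolding odds_def evens_def by fastforce+
    note c = child_index_bounds[OF full(1) g']
    have "length (filter (\<lambda>k. k < g) ks) < m" using c(1) full(2) m by linarith
    then show ?thesis by (rule inj[OF _ j c(2,3)]) (use g in \<open>simp_all add: odds_def\<close>)
  qed
  have odds: "odds p q = (\<Union>j<m. odds (?b ! j) (?b ! Suc j))"
  proof (rule equalityI)
    show "odds p q \<subseteq> (\<Union>j<m. odds (?b ! j) (?b ! Suc j))"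
    proof
      fix g assume g: "g \<in> odds p q"
      then have g': "p < g" "g < q" "g \<notin> set ks"
        using ks_even by (auto simp: odds_def evens_def)
      note c = child_index_bounds[OF full(1) g']
      then show "g \<in> (\<Union>j<m. odds (?b ! j) (?b ! Suc j))"
        using g full(2) m by (intro UN_I[of "length (filter (\<lambda>k. k < g) ks)"]) (auto simp: odds_def)
    qed
    show "(\<Union>j<m. odds (?b ! j) (?b ! Suc j)) \<subseteq> odds p q"
      using range by (fastforce simp: odds_def)
  qed
  define G where "G x = F (\<lambda>r. unit_fun m r + ?S r + x r)" for x
  have step: "F (counts m (insert_key m g (Internal ks ts)))
      = G (\<lambda>r. counts m (insert_key m g (ts ! j)) r - counts m (ts ! j) r)"
    if j: "j < m" and g: "g \<in> odds (?b ! j) (?b ! Suc j)" for g j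
  proof -
    have "insert_key m g (Internal ks ts) = Internal ks (ts[j := insert_key m g (ts ! j)])"
      using idx[OF j g] j full(2,3) by (simp add: Let_def)
    moreover have "\<not> is_leaf (Internal ks (ts[j := insert_key m g (ts ! j)]))"
      using j full(3) insert_key_not_External[of m g "ts ! j"]
      by (auto intro!: bexI[of _ "insert_key m g (ts ! j)"] set_update_memI)
    ultimately show ?thesis
      using j full(3) by (simp add: G_def sum_list_map_list_update algebra_simps del: is_leaf.simps)
  qed
  have S: "?S r = (\<Sum>j<m. counts m (ts ! j) r)" for r
    using full(3) by (simp add: sum_list_sum_nth atLeast0LessThan)
  have "(\<Sum>g\<in>odds p q. F (counts m (insert_key m g (Internal ks ts))))
      = (\<Sum>j<m. \<Sum>g\<in>odds (?b ! j) (?b ! Suc j). F (counts m (insert_key m g (Internal ks ts))))"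
    unfolding odds
  proof (intro sum.UNION_disjoint ballI impI)
    fix i j assume "i \<in> {..<m}" "j \<in> {..<m}" "i \<noteq> j"
    then show "odds (?b ! i) (?b ! Suc i) \<inter> odds (?b ! j) (?b ! Suc j) = {}"
      using inj[of i j] unfolding odds_def by blast
  qed auto
  also have "\<dots> = (\<Sum>j<m. \<Sum>g\<in>odds (?b ! j) (?b ! Suc j).
      G (\<lambda>r. counts m (insert_key m g (ts ! j)) r - counts m (ts ! j) r))"
    using step by simp
  also have "\<dots> = (\<Sum>j<m. \<Sum>i<m. (real (i + 1) * counts m (ts ! j) i) *\<^sub>R G (jump m i))"
  proof (intro sum.cong refl)
    fix j assume "j \<in> {..<m}"
    then have j: "j < m" by simp
    have e: "even (?b ! j)" "even (?b ! Suc j)" "?b ! j < ?b ! Suc j"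
      using beven[of j] beven[of "Suc j"] j bmono[of j "Suc j"] by auto
    show "(\<Sum>g\<in>odds (?b ! j) (?b ! Suc j).
        G (\<lambda>r. counts m (insert_key m g (ts ! j)) r - counts m (ts ! j) r))
      = (\<Sum>i<m. (real (i + 1) * counts m (ts ! j) i) *\<^sub>R G (jump m i))"
      using full(5)[OF j, of "\<lambda>x. G (\<lambda>r. x r - counts m (ts ! j) r)", OF e K[OF j]]
      by simp
  qed
  also have "\<dots> = (\<Sum>i<m. (real (i + 1) * ?S i) *\<^sub>R G (jump m i))"
    unfolding S by (subst sum.swap) (simp add: sum_distrib_left scaleR_sum_left)
  \<comment> \<open>At a full leaf, \<open>?S\<close> plus a ball for the node is not the composition: its \<open>m\<close> external
    children and the node form one ball. Opening them up first gives the same result.\<close>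
  also have "\<dots> = (\<Sum>i<m. (real (i + 1) * counts m (Internal ks ts) i)
      *\<^sub>R F (\<lambda>r. counts m (Internal ks ts) r + jump m i r))"
  proof (cases "is_leaf (Internal ks ts)")
    case False
    then show ?thesis by (auto intro!: sum.cong simp: G_def unit_fun_def simp del: is_leaf.simps)
  next
    case True
    then have "ts ! j = External" if "j < m" for j using that full(3) by auto
    then have S0: "?S r = real m * unit_fun 0 r" for r by (simp add: S)
    have "(\<Sum>i<m. (real (i + 1) * ?S i) *\<^sub>R G (jump m i))
        = (\<Sum>i<m. (real (i + 1) * unit_fun 0 i) *\<^sub>R (real m *\<^sub>R G (jump m i)))"
      by (simp add: S0 mult_ac)
    also have "\<dots> = real m *\<^sub>R G (jump m 0)"
      using sum_unit_fun[of 0 m "\<lambda>i. real m *\<^sub>R G (jump m i)"] m by simp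
    also have "G (jump m 0) = F (\<lambda>r. unit_fun (m - 1) r + jump m (m - 1) r)"
      using m by (auto simp: G_def S0 jump_def unit_fun_def of_nat_diff algebra_simps intro!: arg_cong[of _ _ F])
    also have "real m *\<^sub>R \<dots> = (\<Sum>i<m. (real (i + 1) * unit_fun (m - 1) i)
        *\<^sub>R F (\<lambda>r. unit_fun (m - 1) r + jump m i r))"
      using sum_unit_fun[of "m - 1" m "\<lambda>i. F (\<lambda>r. unit_fun (m - 1) r + jump m i r)"] m by simp
    finally show ?thesis using True full(2) by (simp del: is_leaf.simps)
  qed
  finally show ?case .
qed


lemma counts_nonneg: "0 \<le> counts m t r"
proof (induction t)
  case (Internal ks ts)
  then have "0 \<le> (\<Sum>t\<leftarrow>ts. counts m t r)"
    by (intro sum_list_nonneg) auto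
  then show ?case by (simp add: unit_fun_def del: is_leaf.simps)
qed (auto simp: unit_fun_def)

lemma one_protected_map_mtree [simp]: "one_protected (map_mtree h t) = one_protected t"
proof (induction t)
  case (Internal ks ts)
  then have "(\<Sum>t\<leftarrow>map (map_mtree h) ts. one_protected t) = (\<Sum>t\<leftarrow>ts. one_protected t)"
    by (simp add: comp_def cong: map_cong)
  moreover have "is_leaf (Internal (map h ks) (map (map_mtree h) ts)) = is_leaf (Internal ks ts)"
    by auto
  ultimately show ?case by (simp del: is_leaf.simps map_map)
qed auto

lemma one_protected_eq_counts:
  assumes "3 \<le> m"
  shows "bst m p q K t \<Longrightarrow> real (one_protected t) = counts m t m"
proof (induction rule: bst.induct)
  case (full p ks q ts K)
  have eq: "real (\<Sum>t\<leftarrow>ts. one_protected t) = (\<Sum>t\<leftarrow>ts. counts m t m)"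
    using full(3,5) by (simp add: sum_list_sum_nth)
  show ?case
  proof (cases "is_leaf (Internal ks ts)")
    case True
    then have "map one_protected ts = map (\<lambda>t. 0) ts" by auto
    then have "(\<Sum>t\<leftarrow>ts. one_protected t) = 0" by simp
    moreover have "m \<noteq> length ks" using full(2) assms by simp
    ultimately show ?thesis
      using True by (simp add: unit_fun_def del: is_leaf.simps)
  next
    case False
    then show ?thesis using eq by (simp add: unit_fun_def del: is_leaf.simps)
  qed
qed (use assms in \<open>auto simp: unit_fun_def\<close>)

lemma bst_search_tree:
  assumes "3 \<le> m" "distinct xs" "set xs \<subseteq> {p<..<q}"
  shows "bst m p q (set xs) (search_tree m xs)"
  using assms
proof (induction xs rule: rev_induct)
  case Nil
  show ?case by (simp add: search_tree_def bst.external)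
next
  case (snoc x xs)
  then show ?case
    using bst_insert_key[of m p q "set xs" "search_tree m xs" x] by (simp add: search_tree_snoc)
qed

section \<open>Averages over insertion orders\<close>

abbreviation perms :: "nat \<Rightarrow> nat list set" where
  "perms n \<equiv> permutations_of_set {..<n}"

text \<open>
  Makes room for a new key of rank \<open>r\<close> among keys numbered consecutively.
\<close>

definition skip :: "nat \<Rightarrow> nat \<Rightarrow> nat" where
  "skip r i = (if i < r then i else i + 1)"

lemma inj_skip: "inj (skip r)"
  by (auto simp: inj_def skip_def split: if_splits)

lemma skip_neq: "skip r i \<noteq> r"
  by (simp add: skip_def)

text \<open>
  An order of \<open>k + 1\<close> keys consists of the order of the first \<open>k\<close> and the rank of the last one, and
  all pairs occur once.
\<close>

lemma sum_permutations_Suc: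
  "(\<Sum>\<tau>\<in>perms (Suc k). G \<tau>)
   = (\<Sum>\<sigma>\<in>perms k. \<Sum>r\<le>k. G (map (skip r) \<sigma> @ [r]))"
proof -
  let ?P = "perms k" and ?P' = "perms (Suc k)"
  let ?f = "\<lambda>(\<sigma>, r). map (skip r) \<sigma> @ [r]"
  have inj: "inj_on ?f (?P \<times> {..k})"
    by (rule inj_onI) (auto simp: inj_map_eq_map[OF inj_skip])
  have mem: "map (skip r) \<sigma> @ [r] \<in> ?P'" if \<sigma>: "\<sigma> \<in> ?P" and r: "r \<le> k" for \<sigma> r
  proof -
    note d = permutations_of_setD[OF \<sigma>]
    have "r \<notin> skip r ` set \<sigma>" using skip_neq by (metis imageE)
    then have "distinct (map (skip r) \<sigma> @ [r])"
      using d by (auto simp: distinct_map intro: inj_on_subset[OF inj_skip])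
    have lt: "skip r i < Suc k" if "i < k" for i
      using that r by (cases "i < r") (simp_all add: skip_def)
    have sub: "set (map (skip r) \<sigma> @ [r]) \<subseteq> {..<Suc k}"
    proof
      fix x assume "x \<in> set (map (skip r) \<sigma> @ [r])"
      then consider "x = r" | i where "i \<in> set \<sigma>" "x = skip r i" by auto
      then show "x \<in> {..<Suc k}"
      proof cases
        case 2
        then show ?thesis using lt[of i] d(1) by simp
      qed (use r in simp)
    qed
    have "length \<sigma> = k" using distinct_card[OF d(2)] d(1) by simp
    then have "card (set (map (skip r) \<sigma> @ [r])) = card {..<Suc k}"
      using distinct_card[OF \<open>distinct (map (skip r) \<sigma> @ [r])\<close>] by simp
    then have "set (map (skip r) \<sigma> @ [r]) = {..<Suc k}"
      by (rule card_subset_eq[OF _ sub, rotated]) simp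
    then show ?thesis
      using \<open>distinct (map (skip r) \<sigma> @ [r])\<close> by (intro permutations_of_setI)
  qed
  then have sub: "?f ` (?P \<times> {..k}) \<subseteq> ?P'" by auto
  have "card (?f ` (?P \<times> {..k})) = card ?P'"
    by (simp add: card_image[OF inj] card_cartesian_product card_permutations_of_set algebra_simps)
  then have "?f ` (?P \<times> {..k}) = ?P'" by (rule card_subset_eq[OF _ sub, rotated]) simp
  then have "(\<Sum>\<tau>\<in>?P'. G \<tau>) = (\<Sum>x\<in>?P \<times> {..k}. G (?f x))"
    using sum.reindex[OF inj, of G] by (simp add: comp_def)
  also have "\<dots> = (\<Sum>\<sigma>\<in>?P. \<Sum>r\<le>k. G (map (skip r) \<sigma> @ [r]))"
    by (simp add: sum.cartesian_product split_def)
  finally show ?thesis .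
qed

lemma search_tree_doubled:
  assumes m: "3 \<le> m" and \<sigma>: "\<sigma> \<in> perms k"
  shows "bst m (- 2) (2 * int k) (evens (- 2) (2 * int k)) (search_tree m (map (\<lambda>i. 2 * int i) \<sigma>))"
proof -
  note d = permutations_of_setD[OF \<sigma>]
  have "set (map (\<lambda>i. 2 * int i) \<sigma>) = evens (- 2) (2 * int k)"
  proof -
    have "x \<in> (\<lambda>i. 2 * int i) ` {..<k}" if "even x" "- 2 < x" "x < 2 * int k" for x
      using that by (intro image_eqI[of _ _ "nat (x div 2)"]) auto
    then have "evens (- 2) (2 * int k) \<subseteq> (\<lambda>i. 2 * int i) ` {..<k}"
      unfolding evens_def by blast
    moreover have "(\<lambda>i. 2 * int i) ` {..<k} \<subseteq> evens (- 2) (2 * int k)"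
      unfolding evens_def by (rule image_subsetI) simp
    ultimately show ?thesis using d(1) by (simp only: set_map)
  qed
  moreover have "bst m (- 2) (2 * int k) (set (map (\<lambda>i. 2 * int i) \<sigma>)) (search_tree m (map (\<lambda>i. 2 * int i) \<sigma>))"
  proof (rule bst_search_tree[OF m])
    show "distinct (map (\<lambda>i. 2 * int i) \<sigma>)"
      using d(2) by (simp add: distinct_map inj_on_def)
    show "set (map (\<lambda>i. 2 * int i) \<sigma>) \<subseteq> {- 2<..<2 * int k}"
      unfolding set_map d(1) by (rule image_subsetI) simp
  qed
  ultimately show ?thesis by simp
qed

lemma search_tree_eq_doubled:
  "search_tree m (map (\<lambda>i. 2 * int i) \<sigma>) = map_mtree (\<lambda>i. 2 * int i) (search_tree m \<sigma>)"
  by (rule search_tree_map) (auto simp: strict_mono_on_def)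

text \<open>
  The expectation of \<open>F\<close> at the composition of a random tree with \<open>k\<close> keys.
\<close>

definition perm_avg :: "nat \<Rightarrow> nat \<Rightarrow> ((nat \<Rightarrow> real) \<Rightarrow> 'b::real_vector) \<Rightarrow> 'b" where
  "perm_avg m k F =
     (1 / fact k) *\<^sub>R (\<Sum>\<sigma>\<in>perms k. F (counts m (search_tree m \<sigma>)))"

lemma bij_betw_gaps: "bij_betw (\<lambda>r. 2 * int r - 1) {..k} (odds (- 2) (2 * int k))"
proof (rule bij_betwI')
  fix g assume "g \<in> odds (- 2) (2 * int k)"
  then have "\<exists>r\<le>k. g = 2 * int r - 1"
    by (intro exI[of _ "nat ((g + 1) div 2)"]) (auto simp: odds_def elim!: oddE)
  then show "\<exists>r\<in>{..k}. g = 2 * int r - 1" by auto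
qed (auto simp: odds_def)

text \<open>
  The composition evolves as the urn: with \<open>k\<close> keys the total activity is \<open>k + 1\<close>, and a ball of
  index \<open>i\<close> is drawn with probability \<open>(i + 1) x i / (k + 1)\<close>. The last key of rank \<open>r\<close> is moved to
  the odd number \<open>2 r - 1\<close> between the doubled ranks of the others.
\<close>

lemma perm_avg_Suc:
  fixes F :: "(nat \<Rightarrow> real) \<Rightarrow> 'b::real_vector"
  assumes m: "3 \<le> m"
  shows "perm_avg m (Suc k) F
    = perm_avg m k (\<lambda>x. \<Sum>i<m. (real (i + 1) * x i / real (k + 1)) *\<^sub>R F (\<lambda>r. x r + jump m i r))"
proof -
  have inner: "(\<Sum>r\<le>k. F (counts m (search_tree m (map (skip r) \<sigma> @ [r]))))
      = (\<Sum>i<m. (real (i + 1) * counts m (search_tree m \<sigma>) i)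
          *\<^sub>R F (\<lambda>r. counts m (search_tree m \<sigma>) r + jump m i r))"
    if \<sigma>: "\<sigma> \<in> perms k" for \<sigma>
  proof -
    let ?t = "search_tree m (map (\<lambda>i. 2 * int i) \<sigma>)"
    have "counts m (search_tree m (map (skip r) \<sigma> @ [r])) = counts m (insert_key m (2 * int r - 1) ?t)"
      for r
    proof -
      define h where "h i = (if i < r then 2 * int i else if i = r then 2 * int r - 1 else 2 * int i - 2)" for i
      have "strict_mono_on A h" for A by (auto simp: strict_mono_on_def h_def)
      then have "counts m (search_tree m (map h (map (skip r) \<sigma> @ [r])))
          = counts m (search_tree m (map (skip r) \<sigma> @ [r]))"
        by (subst search_tree_map) auto
      moreover have "map h (map (skip r) \<sigma> @ [r]) = map (\<lambda>i. 2 * int i) \<sigma> @ [2 * int r - 1]"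
        by (auto simp: h_def skip_def)
      ultimately have "counts m (search_tree m (map (\<lambda>i. 2 * int i) \<sigma> @ [2 * int r - 1]))
          = counts m (search_tree m (map (skip r) \<sigma> @ [r]))" by (simp only:)
      then show ?thesis by (simp only: search_tree_snoc)
    qed
    then have "(\<Sum>r\<le>k. F (counts m (search_tree m (map (skip r) \<sigma> @ [r]))))
        = (\<Sum>r\<le>k. F (counts m (insert_key m (2 * int r - 1) ?t)))" by simp
    also have "\<dots> = (\<Sum>g\<in>odds (- 2) (2 * int k). F (counts m (insert_key m g ?t)))"
      by (rule sum.reindex_bij_betw[OF bij_betw_gaps])
    also have "\<dots> = (\<Sum>i<m. (real (i + 1) * counts m ?t i) *\<^sub>R F (\<lambda>r. counts m ?t r + jump m i r))"
      by (rule sum_over_gaps[OF m search_tree_doubled[OF m \<sigma>]]) auto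
    finally show ?thesis by (simp add: search_tree_eq_doubled)
  qed
  have "perm_avg m (Suc k) F = (1 / fact (Suc k)) *\<^sub>R (\<Sum>\<sigma>\<in>perms k.
      \<Sum>i<m. (real (i + 1) * counts m (search_tree m \<sigma>) i)
          *\<^sub>R F (\<lambda>r. counts m (search_tree m \<sigma>) r + jump m i r))"
    unfolding perm_avg_def sum_permutations_Suc using inner by simp
  also have "\<dots> = (1 / fact k) *\<^sub>R (\<Sum>\<sigma>\<in>perms k.
      \<Sum>i<m. (real (i + 1) * counts m (search_tree m \<sigma>) i / real (k + 1))
          *\<^sub>R F (\<lambda>r. counts m (search_tree m \<sigma>) r + jump m i r))"
  proof -
    have "(1 / fact (Suc k)) * c = (1 / fact k) * (c / real (k + 1))" for c :: real
      by (simp add: field_simps)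
    then show ?thesis unfolding scaleR_sum_right scaleR_scaleR by (simp only: )
  qed
  finally show ?thesis by (simp add: perm_avg_def)
qed

lemma perm_avg_0: "perm_avg m 0 F = F (unit_fun 0)"
  by (simp add: perm_avg_def search_tree_def)

text \<open>
  The invariants of the compositions of trees with \<open>k\<close> keys; the sum is the total activity.
\<close>

definition urn_state :: "nat \<Rightarrow> nat \<Rightarrow> (nat \<Rightarrow> real) \<Rightarrow> bool" where
  "urn_state m k x \<longleftrightarrow> (\<forall>i. 0 \<le> x i) \<and> (\<Sum>i<m. real (i + 1) * x i) = real (k + 1)"

lemma urn_state_counts:
  assumes m: "3 \<le> m" and \<sigma>: "\<sigma> \<in> perms k"
  shows "urn_state m k (counts m (search_tree m \<sigma>))"
proof -
  let ?t = "search_tree m (map (\<lambda>i. 2 * int i) \<sigma>)"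
  have "(\<Sum>g\<in>odds (- 2) (2 * int k). 1 :: real) = (\<Sum>i<m. (real (i + 1) * counts m ?t i) *\<^sub>R 1)"
    by (rule sum_over_gaps[OF m search_tree_doubled[OF m \<sigma>]]) auto
  moreover have "card (odds (- 2) (2 * int k)) = k + 1"
    using bij_betw_same_card[OF bij_betw_gaps[of k]] by simp
  ultimately show ?thesis
    by (simp add: urn_state_def counts_nonneg search_tree_eq_doubled)
qed

lemma one_protected_perm:
  fixes \<sigma> :: "nat list"
  assumes m: "3 \<le> m" and \<sigma>: "\<sigma> \<in> perms k"
  shows "real (one_protected (search_tree m \<sigma>)) = counts m (search_tree m \<sigma>) m"
  using one_protected_eq_counts[OF m search_tree_doubled[OF m \<sigma>]] by (simp add: search_tree_eq_doubled)

section \<open>Relative order of the keys\<close>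

definition rank_list :: "nat \<Rightarrow> (nat \<Rightarrow> real) \<Rightarrow> nat list" where
  "rank_list n x = map (\<lambda>i. card {j \<in> {..<n}. x j < x i}) [0..<n]"

text \<open>
  Without ties, the rank map is injective into \<open>{..<n}\<close>, hence onto.
\<close>

lemma rank_list_mem_permutations:
  assumes "inj_on x {..<n}"
  shows "rank_list n x \<in> perms n"
proof -
  let ?r = "\<lambda>i. card {j \<in> {..<n}. x j < x i}"
  have less: "?r a < ?r b" if "a < n" "b < n" "x a < x b" for a b
    using that by (intro psubset_card_mono) auto
  have inj: "inj_on ?r {..<n}"
  proof (rule inj_onI)
    fix a b assume ab: "a \<in> {..<n}" "b \<in> {..<n}" "?r a = ?r b"
    then have "\<not> x a < x b" "\<not> x b < x a" using less[of a b] less[of b a] by auto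
    then show "a = b" using assms ab by (auto simp: inj_on_def)
  qed
  have "?r i < n" if "i < n" for i
  proof -
    have "?r i < card {..<n}" using that by (intro psubset_card_mono) auto
    then show ?thesis by simp
  qed
  then have "?r ` {..<n} \<subseteq> {..<n}" by auto
  then have "?r ` {..<n} = {..<n}" using inj by (intro card_subset_eq) (auto simp: card_image)
  then show ?thesis
    using inj by (intro permutations_of_setI) (auto simp: rank_list_def distinct_map atLeast0LessThan)
qed

lemma rank_list_event:
  assumes Y: "\<And>i. i < n \<Longrightarrow> Y i \<in> borel_measurable N"
  shows "{\<omega> \<in> space N. rank_list n (\<lambda>i. Y i \<omega>) = \<rho>} \<in> sets N"
proof -
  have r: "(\<lambda>\<omega>. card {j \<in> {..<n}. Y j \<omega> < Y i \<omega>}) \<in> measurable N (count_space UNIV)" if i: "i < n" for i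
  proof -
    have "(\<lambda>\<omega>. if Y j \<omega> < Y i \<omega> then 1 else 0 :: nat) \<in> measurable N (count_space UNIV)" if "j < n" for j
      using Y[OF i] Y[OF that] by measurable
    then have "(\<lambda>\<omega>. \<Sum>j<n. if Y j \<omega> < Y i \<omega> then 1 else 0 :: nat) \<in> measurable N (count_space UNIV)"
      by (intro measurable_sum_nat) simp
    moreover have "(\<Sum>j<n. if Y j \<omega> < Y i \<omega> then 1 else 0 :: nat) = card {j \<in> {..<n}. Y j \<omega> < Y i \<omega>}" for \<omega>
      by (simp add: sum.If_cases Int_def)
    ultimately show ?thesis by (simp only:)
  qed
  show ?thesis
  proof (cases "length \<rho> = n")
    case True
    define R where "R i \<omega> = card {j \<in> {..<n}. Y j \<omega> < Y i \<omega>}" for i \<omega>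
    have "{\<omega> \<in> space N. R i \<omega> = \<rho> ! i} \<in> sets N" if "i < n" for i
    proof -
      have "R i -` {\<rho> ! i} \<inter> space N \<in> sets N"
        unfolding R_def by (rule measurable_sets[OF r[OF that]]) simp
      moreover have "R i -` {\<rho> ! i} \<inter> space N = {\<omega> \<in> space N. R i \<omega> = \<rho> ! i}" by blast
      ultimately show ?thesis by (simp only:)
    qed
    then have "{\<omega> \<in> space N. \<forall>i\<in>{..<n}. R i \<omega> = \<rho> ! i} \<in> sets N"
      by (intro sets.sets_Collect_finite_All) auto
    moreover have "rank_list n (\<lambda>i. Y i \<omega>) = \<rho> \<longleftrightarrow> (\<forall>i\<in>{..<n}. R i \<omega> = \<rho> ! i)" for \<omega>
      using True by (simp add: rank_list_def list_eq_iff_nth_eq Ball_def R_def)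
    ultimately show ?thesis by (simp only:)
  next
    case False
    then have "{\<omega> \<in> space N. rank_list n (\<lambda>i. Y i \<omega>) = \<rho>} = {}"
      by (auto simp: rank_list_def)
    then show ?thesis by (simp only: sets.empty_sets)
  qed
qed

locale iid_uniform = prob_space M for M :: "'a measure" +
  fixes X :: "nat \<Rightarrow> 'a \<Rightarrow> real"
  assumes indep: "indep_vars (\<lambda>_. borel) X UNIV"
    and unif: "\<And>i. distr M borel (X i) = uniform_measure lborel {0..1}"
begin

lemma X_measurable [measurable]: "X i \<in> borel_measurable M"
  using indep by (auto simp: indep_vars_def2)

abbreviation ranks :: "nat \<Rightarrow> 'a \<Rightarrow> nat list" where
  "ranks n \<omega> \<equiv> rank_list n (\<lambda>i. X i \<omega>)"

abbreviation unif_law :: "real measure" where "unif_law \<equiv> uniform_measure lborel {0..1}"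

lemma prob_space_unif_law: "prob_space unif_law"
  unfolding unif[of 0, symmetric] by (rule prob_space_distr) simp

lemma no_ties:
  assumes "i \<noteq> j"
  shows "AE \<omega> in M. X i \<omega> \<noteq> X j \<omega>"
proof -
  interpret law: prob_space unif_law by (rule prob_space_unif_law)
  have "indep_var borel ((\<lambda>x. x i) \<circ> (\<lambda>\<omega>. restrict (\<lambda>i. X i \<omega>) {i}))
      borel ((\<lambda>x. x j) \<circ> (\<lambda>\<omega>. restrict (\<lambda>i. X i \<omega>) {j}))"
    by (rule indep_var_compose[OF indep_var_restrict[OF indep]]) (use assms in auto)
  then have "indep_var borel (X i) borel (X j)" by (simp add: comp_def)
  then have d: "distr M (borel \<Otimes>\<^sub>M borel) (\<lambda>\<omega>. (X i \<omega>, X j \<omega>)) = unif_law \<Otimes>\<^sub>M unif_law"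
    unfolding indep_var_distribution_eq unif by simp
  let ?D = "{p :: real \<times> real. fst p = snd p}"
  have D: "?D \<in> sets (borel \<Otimes>\<^sub>M borel)"
    unfolding borel_prod by (intro borel_closed closed_Collect_eq continuous_intros)
  have "emeasure M {\<omega> \<in> space M. X i \<omega> = X j \<omega>} = emeasure (distr M (borel \<Otimes>\<^sub>M borel) (\<lambda>\<omega>. (X i \<omega>, X j \<omega>))) ?D"
    using D by (subst emeasure_distr) (auto intro!: arg_cong[of _ _ "emeasure M"])
  also have "\<dots> = (\<integral>\<^sup>+x. emeasure unif_law (Pair x -` ?D) \<partial>unif_law)"
  proof -
    have "sets (unif_law \<Otimes>\<^sub>M unif_law) = sets (borel \<Otimes>\<^sub>M borel)"
      by (intro sets_pair_measure_cong) (simp_all only: sets_uniform_measure sets_lborel)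
    with D show ?thesis unfolding d by (intro law.emeasure_pair_measure_alt) simp
  qed
  also have "\<dots> = (\<integral>\<^sup>+x. 0 \<partial>unif_law)"
  proof (intro nn_integral_cong)
    fix x :: real
    have "Pair x -` ?D = {x}" by auto
    moreover have "emeasure lborel ({0..1} \<inter> {x}) = 0" by (cases "x \<in> {0..1}") auto
    ultimately show "emeasure unif_law (Pair x -` ?D) = 0" by simp
  qed
  finally have "emeasure M {\<omega> \<in> space M. X i \<omega> = X j \<omega>} = 0" by simp
  then show ?thesis by (intro AE_I[of _ _ "{\<omega> \<in> space M. X i \<omega> = X j \<omega>}"]) auto
qed

lemma AE_distinct: "AE \<omega> in M. inj_on (\<lambda>i. X i \<omega>) {..<n}"
proof -
  have "AE \<omega> in M. \<forall>i\<in>{..<n}. \<forall>j\<in>{..<n}. i \<noteq> j \<longrightarrow> X i \<omega> \<noteq> X j \<omega>"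
    using no_ties by (intro AE_finite_allI) (auto intro!: AE_finite_allI)
  then show ?thesis by eventually_elim (auto simp: inj_on_def)
qed

lemma rank_event [measurable]: "{\<omega> \<in> space M. ranks n \<omega> = \<rho>} \<in> events"
  by (rule rank_list_event) simp

lemma rank_list_fun_measurable [measurable]:
  fixes g :: "nat list \<Rightarrow> 'b::topological_space"
  shows "(\<lambda>\<omega>. g (ranks n \<omega>)) \<in> borel_measurable M"
proof -
  have "(\<lambda>\<omega>. ranks n \<omega>) \<in> measurable M (count_space UNIV)"
    by (subst measurable_count_space_eq_countable)
      (auto simp: vimage_def Int_def conj_commute rank_event)
  then show ?thesis by (rule measurable_compose) simp
qed

text \<open>
  Exchangeability: the joint law of the keys is a power of one measure, hence invariant under
  permutations of the coordinates, and a permutation of the coordinates carries any order into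
  the increasing one.
\<close>

lemma prob_rank_list_eq:
  assumes n: "0 < n" and \<rho>: "\<rho> \<in> perms n"
  shows "prob {\<omega> \<in> space M. ranks n \<omega> = \<rho>}
       = prob {\<omega> \<in> space M. ranks n \<omega> = [0..<n]}"
proof -
  note d = permutations_of_setD[OF \<rho>]
  have len: "length \<rho> = n" using distinct_card[OF d(2)] d(1) by simp
  have nth: "bij_betw (\<lambda>i. \<rho> ! i) {..<n} {..<n}"
    by (rule bij_betw_nth[OF d(2)]) (simp_all only: len d(1))
  define \<pi> where "\<pi> = the_inv_into {..<n} (\<lambda>i. \<rho> ! i)"
  have \<pi>: "bij_betw \<pi> {..<n} {..<n}" unfolding \<pi>_def by (rule bij_betw_the_inv_into[OF nth])
  have \<pi>_nth: "\<rho> ! \<pi> i = i" if "i < n" for i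
    using f_the_inv_into_f_bij_betw[OF nth] that by (simp add: \<pi>_def)
  have nth_\<pi>: "\<pi> (\<rho> ! i) = i" if "i < n" for i
    using the_inv_into_f_f[of "\<lambda>i. \<rho> ! i" "{..<n}"] nth that by (auto simp: \<pi>_def bij_betw_def)
  have lt: "\<pi> i < n" "\<rho> ! i < n" if "i < n" for i
    using \<pi> nth that by (auto simp: bij_betw_def)
  let ?N = "PiM {..<n} (\<lambda>_. unif_law)" and ?B = "PiM {..<n} (\<lambda>_. borel :: real measure)"
  let ?V = "\<lambda>\<omega>. \<lambda>i\<in>{..<n}. X i \<omega>"
  have "indep_vars (\<lambda>_. borel) X {..<n}" by (rule indep_vars_subset[OF indep]) auto
  then have dist: "distr M ?B ?V = ?N"
    using n by (subst (asm) indep_vars_iff_distr_eq_PiM) (auto simp: unif lessThan_empty_iff)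
  have setsN: "sets ?N = sets ?B" by (intro sets_PiM_cong) auto
  have V: "?V \<in> measurable M ?B" by measurable
  define E where "E \<rho> = {x \<in> space ?B. rank_list n x = \<rho>}" for \<rho>
  have rank: "rank_list n (?V \<omega>) = ranks n \<omega>" for \<omega>
    by (auto simp: rank_list_def intro!: arg_cong[of _ _ card])
  have E: "E \<rho> \<in> sets ?B" for \<rho>
    unfolding E_def
    by (rule rank_list_event[where Y = "\<lambda>i x. x i"]) (rule measurable_component_singleton, simp)
  have probE: "prob {\<omega> \<in> space M. ranks n \<omega> = \<rho>} = measure ?N (E \<rho>)" for \<rho>
  proof -
    have "measure ?N (E \<rho>) = prob (?V -` E \<rho> \<inter> space M)"
      unfolding dist[symmetric] by (rule measure_distr[OF V E])
    also have "?V -` E \<rho> \<inter> space M = {\<omega> \<in> space M. ranks n \<omega> = \<rho>}"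
      unfolding E_def using measurable_space[OF V] by (auto simp: rank)
    finally show ?thesis by simp
  qed
  let ?T = "\<lambda>x. \<lambda>i\<in>{..<n}. x (\<pi> i) :: real"
  have reindex: "distr ?N ?N ?T = ?N"
    using distr_PiM_reindex[of "{..<n}" "\<lambda>_. unif_law" \<pi> "{..<n}"] prob_space_unif_law \<pi>
    by (auto simp: bij_betw_def)
  have T: "?T \<in> measurable ?N ?N"
    using lt by (intro measurable_restrict measurable_component_singleton) auto
  have "?T -` E [0..<n] \<inter> space ?N = E \<rho>"
  proof -
    have "rank_list n (?T x) = [0..<n] \<longleftrightarrow> rank_list n x = \<rho>" for x
    proof -
      have c: "card {j \<in> {..<n}. ?T x j < ?T x i} = card {j \<in> {..<n}. x j < x (\<pi> i)}" if "i < n" for i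
      proof (rule bij_betw_same_card[of \<pi>], rule bij_betw_subset[OF \<pi>])
        show "\<pi> ` {j \<in> {..<n}. ?T x j < ?T x i} = {j \<in> {..<n}. x j < x (\<pi> i)}"
        proof (intro equalityI subsetI)
          fix k assume "k \<in> \<pi> ` {j \<in> {..<n}. ?T x j < ?T x i}"
          then obtain j where "k = \<pi> j" "j < n" "?T x j < ?T x i" by blast
          then show "k \<in> {j \<in> {..<n}. x j < x (\<pi> i)}" using that lt(1)[of j] by simp
        next
          fix k assume k: "k \<in> {j \<in> {..<n}. x j < x (\<pi> i)}"
          then have "\<rho> ! k \<in> {j \<in> {..<n}. ?T x j < ?T x i}"
            using that lt(2)[of k] nth_\<pi>[of k] by simp
          then have "\<pi> (\<rho> ! k) \<in> \<pi> ` {j \<in> {..<n}. ?T x j < ?T x i}" by (rule imageI)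
          then show "k \<in> \<pi> ` {j \<in> {..<n}. ?T x j < ?T x i}" using k nth_\<pi>[of k] by simp
        qed
      qed auto
      have "rank_list n (?T x) = [0..<n] \<longleftrightarrow> (\<forall>i<n. card {j \<in> {..<n}. ?T x j < ?T x i} = i)"
        by (simp add: rank_list_def list_eq_iff_nth_eq)
      also have "\<dots> \<longleftrightarrow> (\<forall>i<n. card {j \<in> {..<n}. x j < x (\<pi> i)} = i)" using c by auto
      also have "\<dots> \<longleftrightarrow> (\<forall>i<n. card {j \<in> {..<n}. x j < x i} = \<rho> ! i)"
      proof (intro iffI allI impI)
        fix i assume H: "\<forall>i<n. card {j \<in> {..<n}. x j < x (\<pi> i)} = i" and i: "i < n"
        from H lt(2)[OF i] have "card {j \<in> {..<n}. x j < x (\<pi> (\<rho> ! i))} = \<rho> ! i" by blast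
        then show "card {j \<in> {..<n}. x j < x i} = \<rho> ! i" unfolding nth_\<pi>[OF i] .
      next
        fix i assume H: "\<forall>i<n. card {j \<in> {..<n}. x j < x i} = \<rho> ! i" and i: "i < n"
        from H lt(1)[OF i] have "card {j \<in> {..<n}. x j < x (\<pi> i)} = \<rho> ! \<pi> i" by blast
        then show "card {j \<in> {..<n}. x j < x (\<pi> i)} = i" unfolding \<pi>_nth[OF i] .
      qed
      also have "\<dots> \<longleftrightarrow> rank_list n x = \<rho>"
        using len by (simp add: rank_list_def list_eq_iff_nth_eq)
      finally show ?thesis .
    qed
    moreover have "space ?N = space ?B" using setsN by (rule sets_eq_imp_space_eq)
    moreover have "?T -` E [0..<n] \<inter> space ?N = {x \<in> space ?N. rank_list n (?T x) = [0..<n]}"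
      using measurable_space[OF T] \<open>space ?N = space ?B\<close> unfolding E_def by blast
    ultimately show ?thesis unfolding E_def by (simp only:)
  qed
  moreover have "measure ?N (E [0..<n]) = measure ?N (?T -` E [0..<n] \<inter> space ?N)"
    using measure_distr[OF T, of "E [0..<n]"] E setsN reindex by simp
  ultimately show ?thesis by (simp add: probE)
qed

lemma rank_list_AE_mem: "AE \<omega> in M. ranks n \<omega> \<in> perms n"
  using AE_distinct[of n] by eventually_elim (rule rank_list_mem_permutations)

lemma prob_rank_list:
  assumes n: "0 < n" and \<rho>: "\<rho> \<in> perms n"
  shows "prob {\<omega> \<in> space M. ranks n \<omega> = \<rho>} = 1 / fact n"
proof -
  let ?P = "perms n"
  let ?E = "\<lambda>\<rho>. {\<omega> \<in> space M. ranks n \<omega> = \<rho>}"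
  have "(\<Union>\<rho>\<in>?P. ?E \<rho>) \<in> events" by (intro sets.finite_UN) auto
  moreover have "AE \<omega> in M. \<omega> \<in> (\<Union>\<rho>\<in>?P. ?E \<rho>)"
    using rank_list_AE_mem[of n] AE_space by eventually_elim auto
  ultimately have "1 = prob (\<Union>\<rho>\<in>?P. ?E \<rho>)" using prob_eq_1 by metis
  also have "\<dots> = (\<Sum>\<rho>\<in>?P. prob (?E \<rho>))"
    by (rule finite_measure_finite_Union) (auto simp: disjoint_family_on_def)
  also have "\<dots> = (\<Sum>\<rho>\<in>?P. prob (?E [0..<n]))"
    using prob_rank_list_eq[OF n] by simp
  also have "\<dots> = fact n * prob (?E [0..<n])" by (simp add: card_permutations_of_set)
  finally show ?thesis using prob_rank_list_eq[OF n \<rho>] by (simp add: field_simps)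
qed

text \<open>
  The \<open>n!\<close> orders are equally likely, and ties have probability 0.
\<close>

lemma expectation_rank_list:
  fixes g :: "nat list \<Rightarrow> 'b::{banach, second_countable_topology}"
  assumes n: "0 < n"
  shows "integral\<^sup>L M (\<lambda>\<omega>. g (ranks n \<omega>))
       = (1 / fact n) *\<^sub>R (\<Sum>\<rho>\<in>perms n. g \<rho>)"
proof -
  let ?P = "perms n"
  let ?E = "\<lambda>\<rho>. {\<omega> \<in> space M. ranks n \<omega> = \<rho>}"
  have "integral\<^sup>L M (\<lambda>\<omega>. g (ranks n \<omega>))
      = integral\<^sup>L M (\<lambda>\<omega>. \<Sum>\<rho>\<in>?P. indicator (?E \<rho>) \<omega> *\<^sub>R g \<rho>)"
  proof (rule integral_cong_AE)
    show "AE \<omega> in M. g (ranks n \<omega>) = (\<Sum>\<rho>\<in>?P. indicator (?E \<rho>) \<omega> *\<^sub>R g \<rho>)"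
      using rank_list_AE_mem[of n] AE_space
    proof eventually_elim
      case (elim \<omega>)
      have "(\<Sum>\<rho>\<in>?P. indicator (?E \<rho>) \<omega> *\<^sub>R g \<rho>)
          = (\<Sum>\<rho>\<in>?P. if \<rho> = ranks n \<omega> then g \<rho> else 0)"
        using elim by (intro sum.cong) (auto simp: indicator_def)
      then show ?case using elim by simp
    qed
    show "(\<lambda>\<omega>. g (ranks n \<omega>)) \<in> borel_measurable M"
      by (rule rank_list_fun_measurable)
    show "(\<lambda>\<omega>. \<Sum>\<rho>\<in>?P. indicator (?E \<rho>) \<omega> *\<^sub>R g \<rho>) \<in> borel_measurable M"
      by (intro borel_measurable_sum borel_measurable_scaleR borel_measurable_indicator rank_event borel_measurable_const)
  qed
  also have "\<dots> = (\<Sum>\<rho>\<in>?P. prob (?E \<rho>) *\<^sub>R g \<rho>)"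
  proof -
    have i: "integrable M (indicator (?E \<rho>) :: 'a \<Rightarrow> real)" for \<rho>
      by (intro integrable_real_indicator rank_event) (simp add: less_top[symmetric])
    have "integral\<^sup>L M (indicator (?E \<rho>) :: 'a \<Rightarrow> real) = prob (?E \<rho>)" for \<rho>
    proof -
      have "integral\<^sup>L M (indicator (?E \<rho>) :: 'a \<Rightarrow> real) = prob (?E \<rho> \<inter> space M)" by simp
      also have "?E \<rho> \<inter> space M = ?E \<rho>" by blast
      finally show ?thesis .
    qed
    then have "integral\<^sup>L M (\<lambda>\<omega>. indicator (?E \<rho>) \<omega> *\<^sub>R g \<rho>) = prob (?E \<rho>) *\<^sub>R g \<rho>" for \<rho>
      by (subst integral_scaleR_left) (simp_all only: i)
    moreover have "integral\<^sup>L M (\<lambda>\<omega>. \<Sum>\<rho>\<in>?P. indicator (?E \<rho>) \<omega> *\<^sub>R g \<rho>)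
        = (\<Sum>\<rho>\<in>?P. integral\<^sup>L M (\<lambda>\<omega>. indicator (?E \<rho>) \<omega> *\<^sub>R g \<rho>))"
      by (rule Bochner_Integration.integral_sum) (intro integrable_scaleR_left i)
    ultimately show ?thesis by (simp only:)
  qed
  also have "\<dots> = (\<Sum>\<rho>\<in>?P. (1 / fact n) *\<^sub>R g \<rho>)"
    using prob_rank_list[OF n] by simp
  finally show ?thesis by (simp add: scaleR_sum_right)
qed

end

section \<open>Pulling functionals back along the urn\<close>

definition dotp :: "nat \<Rightarrow> (nat \<Rightarrow> real) \<Rightarrow> (nat \<Rightarrow> real) \<Rightarrow> real" where
  "dotp m w x = (\<Sum>r\<le>m. w r * x r)"

text \<open>
  The real-valued form of \<open>activity\<close>.
\<close>

definition act :: "nat \<Rightarrow> nat \<Rightarrow> real" where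
  "act m i = (if i < m then real (i + 1) else 0)"

text \<open>
  The action of the transpose of \<open>I + A / l\<close> on functionals.
\<close>

definition pull :: "nat \<Rightarrow> nat \<Rightarrow> (nat \<Rightarrow> real) \<Rightarrow> nat \<Rightarrow> real" where
  "pull m l w = (\<lambda>i. w i + act m i * dotp m w (jump m i) / real l)"

text \<open>
  The weights \<open>w\<^sub>n\<^sub>,\<^sub>k\<close> that make the functional a martingale ending at \<open>w\<close>. The transition from \<open>k\<close> to
  \<open>k + 1\<close> keys happens at total activity \<open>k + 1\<close>, whence the index \<open>Suc k\<close> of the step.
\<close>

function pullback :: "nat \<Rightarrow> (nat \<Rightarrow> real) \<Rightarrow> nat \<Rightarrow> nat \<Rightarrow> nat \<Rightarrow> real" where
  "pullback m w n k = (if k < n then pull m (Suc k) (pullback m w n (Suc k)) else w)"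
  by pat_completeness auto
termination by (relation "Wellfounded.measure (\<lambda>(m, w, n, k). n - k)") auto

declare pullback.simps [simp del]

lemma pullback_end [simp]: "pullback m w n n = w"
  by (simp add: pullback.simps)

lemma pullback_step: "k < n \<Longrightarrow> pullback m w n k = pull m (Suc k) (pullback m w n (Suc k))"
  by (subst pullback.simps) simp

lemma dotp_add_right: "dotp m w (\<lambda>r. x r + y r) = dotp m w x + dotp m w y"
  by (simp add: dotp_def algebra_simps sum.distrib)

lemma dotp_diff_left: "dotp m (\<lambda>r. w r - c * u r) x = dotp m w x - c * dotp m u x"
  by (simp add: dotp_def algebra_simps sum_subtractf sum_distrib_left)

lemma sum_act: "(\<Sum>i\<le>m. act m i * f i) = (\<Sum>i<m. real (i + 1) * f i)"
proof -
  have "{..m} = insert m {..<m}" by auto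
  then show ?thesis by (simp add: act_def)
qed

text \<open>
  The martingale property: at a composition \<open>x\<close> of total activity \<open>l\<close>, the right-hand side is the
  conditional mean of \<open>w\<close> after one draw.
\<close>

lemma dotp_pull:
  "dotp m (pull m l w) x = dotp m w x + (\<Sum>i<m. real (i + 1) * x i / real l * dotp m w (jump m i))"
proof -
  have "dotp m (pull m l w) x = dotp m w x + (\<Sum>i\<le>m. act m i * (x i / real l * dotp m w (jump m i)))"
    by (simp add: dotp_def pull_def algebra_simps sum.distrib)
  also have "(\<Sum>i\<le>m. act m i * (x i / real l * dotp m w (jump m i)))
      = (\<Sum>i<m. real (i + 1) * (x i / real l * dotp m w (jump m i)))"
    by (rule sum_act)
  finally show ?thesis by (simp only: mult.assoc times_divide_eq_right times_divide_eq_left)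
qed

lemma dotp_unit_fun: "i \<le> m \<Longrightarrow> dotp m (unit_fun i) x = x i" "i \<le> m \<Longrightarrow> dotp m w (unit_fun i) = w i"
  by (simp_all add: dotp_def unit_fun_def if_distrib if_distribR cong: if_cong)

lemma perm_avg_cong:
  assumes "3 \<le> m" "\<And>x. urn_state m k x \<Longrightarrow> F x = G x"
  shows "perm_avg m k F = perm_avg m k G"
  unfolding perm_avg_def using assms urn_state_counts by (metis (no_types, lifting) sum.cong)

lemma perm_avg_mono:
  fixes F G :: "(nat \<Rightarrow> real) \<Rightarrow> real"
  assumes "3 \<le> m" "\<And>x. urn_state m k x \<Longrightarrow> F x \<le> G x"
  shows "perm_avg m k F \<le> perm_avg m k G"
  unfolding perm_avg_def using assms urn_state_counts
  by (auto intro!: mult_left_mono sum_mono divide_right_mono)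

lemma perm_avg_add: "perm_avg m k (\<lambda>x. F x + G x) = perm_avg m k F + perm_avg m k G"
  by (simp add: perm_avg_def sum.distrib scaleR_add_right)

lemma perm_avg_const: "perm_avg m k (\<lambda>x. c) = c"
  by (simp add: perm_avg_def sum_constant_scaleR card_permutations_of_set)

lemma perm_avg_cmult: "perm_avg m k (\<lambda>x. c * F x) = c * perm_avg m k F"
  for F :: "(nat \<Rightarrow> real) \<Rightarrow> real"
  by (simp add: perm_avg_def sum_distrib_left mult_ac sum_divide_distrib)

lemma perm_avg_mult_right: "perm_avg m k (\<lambda>x. F x * c) = perm_avg m k F * c"
  for F :: "(nat \<Rightarrow> real) \<Rightarrow> complex"
  by (simp add: perm_avg_def sum_distrib_right)

lemma perm_avg_diff: "perm_avg m k (\<lambda>x. F x - G x) = perm_avg m k F - perm_avg m k G"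
  by (simp add: perm_avg_def sum_subtractf scaleR_diff_right)

lemma perm_avg_sum: "perm_avg m k (\<lambda>x. \<Sum>i\<in>I. F i x) = (\<Sum>i\<in>I. perm_avg m k (F i))"
  unfolding perm_avg_def by (subst sum.swap) (simp add: scaleR_sum_right)

lemma norm_perm_avg_le: "norm (perm_avg m k F) \<le> perm_avg m k (\<lambda>x. norm (F x))"
  for F :: "(nat \<Rightarrow> real) \<Rightarrow> 'b::real_normed_vector"
  by (auto simp: perm_avg_def divide_right_mono norm_sum)

text \<open>
  The variance of \<open>b\<close> is at most \<open>B\<^sup>2\<close>, and the mean only shifts \<open>y\<close>.
\<close>

lemma conditional_second_moment:
  fixes p b :: "nat \<Rightarrow> real"
  assumes p: "\<And>i. i < m \<Longrightarrow> 0 \<le> p i" "(\<Sum>i<m. p i) = 1" and b: "\<And>i. i < m \<Longrightarrow> \<bar>b i\<bar> \<le> B"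
  shows "(\<Sum>i<m. p i * (y + b i)\<^sup>2) \<le> (y + (\<Sum>i<m. p i * b i))\<^sup>2 + B\<^sup>2"
proof -
  have b2: "(b i)\<^sup>2 \<le> B\<^sup>2" if "i < m" for i
    using power_mono[OF b[OF that], of 2] by simp
  have "(\<Sum>i<m. p i * (y + b i)\<^sup>2) = y\<^sup>2 * (\<Sum>i<m. p i) + 2 * y * (\<Sum>i<m. p i * b i) + (\<Sum>i<m. p i * (b i)\<^sup>2)"
    by (simp add: power2_sum algebra_simps sum.distrib sum_distrib_left sum_distrib_right)
  also have "(\<Sum>i<m. p i * (b i)\<^sup>2) \<le> (\<Sum>i<m. p i * B\<^sup>2)"
    using p b2 by (intro sum_mono mult_left_mono) auto
  also have "(\<Sum>i<m. p i * B\<^sup>2) = B\<^sup>2" using p by (simp add: sum_distrib_right[symmetric])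
  also have "y\<^sup>2 * (\<Sum>i<m. p i) + 2 * y * (\<Sum>i<m. p i * b i) + B\<^sup>2
      \<le> (y + (\<Sum>i<m. p i * b i))\<^sup>2 + B\<^sup>2"
    using p by (simp add: power2_sum)
  finally show ?thesis by simp
qed

lemma iexp_taylor2: "cmod (iexp x - (1 + \<i> * complex_of_real x - (complex_of_real x)\<^sup>2 / 2)) \<le> \<bar>x\<bar> ^ 3 / 6"
proof -
  have "(\<Sum>k\<le>2. (\<i> * complex_of_real x) ^ k / fact k) = 1 + \<i> * complex_of_real x - (complex_of_real x)\<^sup>2 / 2"
  proof -
    have "{..2 :: nat} = {0, 1, 2}" by auto
    then show ?thesis by (simp add: power_mult_distrib)
  qed
  then show ?thesis using iexp_approx1[of x 2] by (simp add: numeral_3_eq_3 fact_numeral numeral_2_eq_2)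
qed

lemma exp_neg_taylor1:
  assumes "0 \<le> (u::real)"
  shows "\<bar>exp (- u) - (1 - u)\<bar> \<le> u\<^sup>2 / 2"
proof -
  have "1 - u \<le> exp (- u)" using exp_ge_add_one_self[of "- u"] by simp
  moreover have "exp (- u) \<le> 1 - u + u\<^sup>2 / 2"
  proof -
    let ?f = "\<lambda>u. 1 - u + u\<^sup>2 / 2 - exp (- u :: real)"
    have "?f 0 \<le> ?f u"
    proof (rule DERIV_nonneg_imp_nondecreasing[OF assms], intro exI conjI)
      fix y :: real
      show "(?f has_real_derivative (- 1 + y + exp (- y))) (at y)"
        by (auto intro!: derivative_eq_intros)
      show "0 \<le> - 1 + y + exp (- y)" using exp_ge_add_one_self[of "- y"] by simp
    qed
    then show ?thesis by simp
  qed
  ultimately show ?thesis by (simp add: abs_le_iff)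
qed

text \<open>
  One step of the martingale central limit theorem. Given the past, the increment takes the value
  \<open>b i - \<beta>\<close> with probability \<open>p i\<close>. Its characteristic function is \<open>1 - s\<^sup>2 V / 2\<close> up to the third
  moment, and the variance \<open>V\<close> differs from the variance \<open>\<tau>\<close> under the limit probabilities \<open>q\<close> by a
  multiple of the distance between \<open>p\<close> and \<open>q\<close>. Comparing with the deterministic \<open>\<tau>\<close>, not with \<open>V\<close>,
  is what allows the Gaussian factors to be taken out of the expectation.
\<close>

lemma conditional_char_bound:
  fixes p b q :: "nat \<Rightarrow> real" and s \<tau> B :: real
  assumes p: "\<And>i. i < m \<Longrightarrow> 0 \<le> p i" "(\<Sum>i<m. p i) = 1"
    and q: "\<And>i. i < m \<Longrightarrow> 0 \<le> q i" "(\<Sum>i<m. q i) = 1"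
    and b: "\<And>i. i < m \<Longrightarrow> \<bar>b i\<bar> \<le> B" and qb: "(\<Sum>i<m. q i * b i) = 0"
  defines "\<beta> \<equiv> (\<Sum>i<m. p i * b i)" and "\<tau> \<equiv> (\<Sum>i<m. q i * (b i)\<^sup>2)"
  shows "cmod ((\<Sum>i<m. p i * iexp (s * (b i - \<beta>))) - exp (- (s\<^sup>2 * \<tau> / 2)))
     \<le> 2 * \<bar>s\<bar> ^ 3 * B ^ 3 + s\<^sup>2 * B\<^sup>2 * (\<Sum>i<m. \<bar>p i - q i\<bar>) + s ^ 4 * B ^ 4"
proof -
  have m0: "0 < m" using p(2) by (cases m) auto
  then have B: "0 \<le> B" using b[of 0] by linarith
  have b2: "(b i)\<^sup>2 \<le> B\<^sup>2" if "i < m" for i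
    using b[OF that] B by (metis abs_le_square_iff abs_of_nonneg)
  have \<beta>B: "\<bar>\<beta>\<bar> \<le> B"
  proof -
    have "\<bar>\<beta>\<bar> \<le> (\<Sum>i<m. \<bar>p i * b i\<bar>)" unfolding \<beta>_def by (rule sum_abs)
    also have "\<dots> \<le> (\<Sum>i<m. p i * B)"
      using p b by (intro sum_mono) (auto simp: abs_mult intro!: mult_left_mono)
    finally show ?thesis using p by (simp add: sum_distrib_right[symmetric])
  qed
  define D where "D = (\<Sum>i<m. \<bar>p i - q i\<bar>)"
  have \<tau>0: "0 \<le> \<tau>" unfolding \<tau>_def using q by (intro sum_nonneg) auto
  have \<tau>B: "\<tau> \<le> B\<^sup>2"
  proof -
    have "\<tau> \<le> (\<Sum>i<m. q i * B\<^sup>2)" unfolding \<tau>_def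
      using q b2 by (intro sum_mono mult_left_mono) auto
    then show ?thesis using q by (simp add: sum_distrib_right[symmetric])
  qed
  have \<beta>D: "\<bar>\<beta>\<bar> \<le> B * D"
  proof -
    have "\<beta> = (\<Sum>i<m. (p i - q i) * b i)" unfolding \<beta>_def using qb by (simp add: algebra_simps sum_subtractf)
    then have "\<bar>\<beta>\<bar> \<le> (\<Sum>i<m. \<bar>(p i - q i) * b i\<bar>)" by simp
    also have "\<dots> \<le> (\<Sum>i<m. B * \<bar>p i - q i\<bar>)"
      using b by (intro sum_mono) (auto simp: abs_mult mult.commute intro!: mult_right_mono)
    finally show ?thesis by (simp add: D_def sum_distrib_left)
  qed
  define V where "V = (\<Sum>i<m. p i * (b i)\<^sup>2) - \<beta>\<^sup>2"
  have V\<tau>: "\<bar>V - \<tau>\<bar> \<le> 2 * B\<^sup>2 * D"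
  proof -
    have "\<bar>(\<Sum>i<m. p i * (b i)\<^sup>2) - \<tau>\<bar> = \<bar>\<Sum>i<m. (p i - q i) * (b i)\<^sup>2\<bar>"
      by (simp add: \<tau>_def algebra_simps sum_subtractf)
    also have "\<dots> \<le> (\<Sum>i<m. \<bar>(p i - q i) * (b i)\<^sup>2\<bar>)" by (rule sum_abs)
    also have "\<dots> \<le> (\<Sum>i<m. \<bar>p i - q i\<bar> * B\<^sup>2)"
      using b2 by (intro sum_mono) (auto simp: abs_mult intro!: mult_left_mono)
    also have "\<dots> = B\<^sup>2 * D" unfolding D_def sum_distrib_right[symmetric] by (rule mult.commute)
    finally have 1: "\<bar>(\<Sum>i<m. p i * (b i)\<^sup>2) - \<tau>\<bar> \<le> B\<^sup>2 * D" .
    have "\<beta>\<^sup>2 = \<bar>\<beta>\<bar> * \<bar>\<beta>\<bar>" by (simp add: power2_eq_square)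
    also have "\<dots> \<le> B * (B * D)" using \<beta>B \<beta>D B by (intro mult_mono) auto
    finally have 2: "\<beta>\<^sup>2 \<le> B\<^sup>2 * D" by (simp add: power2_eq_square mult_ac)
    have "\<bar>V - \<tau>\<bar> \<le> \<bar>(\<Sum>i<m. p i * (b i)\<^sup>2) - \<tau>\<bar> + \<bar>\<beta>\<^sup>2\<bar>"
      unfolding V_def by linarith
    then show ?thesis using 1 2 by simp
  qed
  define \<epsilon> where "\<epsilon> i = iexp (s * (b i - \<beta>)) - (1 + \<i> * complex_of_real (s * (b i - \<beta>)) - (complex_of_real (s * (b i - \<beta>)))\<^sup>2 / 2)" for i
  have centre: "(\<Sum>i<m. p i * (b i - \<beta>)) = 0"
    using p by (simp add: \<beta>_def right_diff_distrib sum_subtractf sum_distrib_right[symmetric])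
  have var: "(\<Sum>i<m. p i * (b i - \<beta>)\<^sup>2) = V"
  proof -
    have "(\<Sum>i<m. p i * (b i - \<beta>)\<^sup>2)
        = (\<Sum>i<m. p i * (b i)\<^sup>2) - 2 * \<beta> * (\<Sum>i<m. p i * b i) + \<beta>\<^sup>2 * (\<Sum>i<m. p i)"
      by (simp add: power2_diff algebra_simps sum.distrib sum_subtractf sum_distrib_left sum_distrib_right)
    then show ?thesis using p by (simp add: V_def \<beta>_def[symmetric] power2_eq_square)
  qed
  \<comment> \<open>The Taylor expansion of each term, written so that it sums to mean, variance and remainder.\<close>
  have expand: "P * E = P + \<i> * S * (P * Z) - S\<^sup>2 / 2 * (P * Z\<^sup>2) + P * (E - (1 + \<i> * (S * Z) - (S * Z)\<^sup>2 / 2))"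
    for P E S Z :: complex by (simp add: field_simps power2_eq_square)
  have "p i * iexp (s * (b i - \<beta>)) = complex_of_real (p i) + \<i> * s * of_real (p i * (b i - \<beta>))
        - of_real (s\<^sup>2 / 2 * (p i * (b i - \<beta>)\<^sup>2)) + p i * \<epsilon> i" for i
    using expand[of "p i" "iexp (s * (b i - \<beta>))" s "of_real (b i - \<beta>)"]
    by (simp only: \<epsilon>_def of_real_mult of_real_divide of_real_power of_real_numeral)
  then have "(\<Sum>i<m. p i * iexp (s * (b i - \<beta>)))
      = (\<Sum>i<m. complex_of_real (p i) + \<i> * s * of_real (p i * (b i - \<beta>))
        - of_real (s\<^sup>2 / 2 * (p i * (b i - \<beta>)\<^sup>2)) + p i * \<epsilon> i)" by (simp only: )
  also have "\<dots> = (\<Sum>i<m. complex_of_real (p i)) + \<i> * s * of_real (\<Sum>i<m. p i * (b i - \<beta>))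
        - of_real (s\<^sup>2 / 2 * (\<Sum>i<m. p i * (b i - \<beta>)\<^sup>2)) + (\<Sum>i<m. p i * \<epsilon> i)"
    by (simp only: sum.distrib sum_subtractf sum_distrib_left of_real_sum)
  also have "(\<Sum>i<m. complex_of_real (p i)) = 1" using p(2) by (simp flip: of_real_sum)
  finally have eq: "(\<Sum>i<m. p i * iexp (s * (b i - \<beta>))) = 1 - of_real (s\<^sup>2 / 2 * V) + (\<Sum>i<m. p i * \<epsilon> i)"
    by (simp add: centre var)
  have r: "cmod (\<Sum>i<m. p i * \<epsilon> i) \<le> 2 * \<bar>s\<bar> ^ 3 * B ^ 3"
  proof -
    have "cmod (\<Sum>i<m. p i * \<epsilon> i) \<le> (\<Sum>i<m. cmod (p i * \<epsilon> i))" by (rule norm_sum)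
    also have "\<dots> \<le> (\<Sum>i<m. p i * (2 * \<bar>s\<bar> ^ 3 * B ^ 3))"
    proof (intro sum_mono)
      fix i assume "i \<in> {..<m}"
      then have i: "i < m" by simp
      have "\<bar>b i - \<beta>\<bar> \<le> 2 * B" using b[OF i] \<beta>B by linarith
      then have "\<bar>s * (b i - \<beta>)\<bar> ^ 3 \<le> (\<bar>s\<bar> * (2 * B)) ^ 3"
        by (intro power_mono) (auto simp: abs_mult intro!: mult_left_mono)
      also have "\<dots> = 8 * (\<bar>s\<bar> ^ 3 * B ^ 3)" by (simp add: power_mult_distrib)
      finally have 1: "\<bar>s * (b i - \<beta>)\<bar> ^ 3 / 6 \<le> 8 / 6 * (\<bar>s\<bar> ^ 3 * B ^ 3)" by simp
      have "cmod (\<epsilon> i) \<le> \<bar>s * (b i - \<beta>)\<bar> ^ 3 / 6"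
        using iexp_taylor2[of "s * (b i - \<beta>)"] by (simp only: \<epsilon>_def)
      also note 1
      also have "8 / 6 * (\<bar>s\<bar> ^ 3 * B ^ 3) \<le> 2 * (\<bar>s\<bar> ^ 3 * B ^ 3)"
        using B by (intro mult_right_mono) auto
      finally have "cmod (\<epsilon> i) \<le> 2 * \<bar>s\<bar> ^ 3 * B ^ 3" by simp
      then show "cmod (p i * \<epsilon> i) \<le> p i * (2 * \<bar>s\<bar> ^ 3 * B ^ 3)"
        using p(1)[OF i] by (simp add: norm_mult mult_left_mono)
    qed
    also have "\<dots> = 2 * \<bar>s\<bar> ^ 3 * B ^ 3" using p by (simp add: sum_distrib_right[symmetric])
    finally show ?thesis .
  qed
  define u where "u = s\<^sup>2 * \<tau> / 2"
  have u0: "0 \<le> u" using \<tau>0 by (simp add: u_def)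
  have "u \<le> s\<^sup>2 * B\<^sup>2 / 2" using \<tau>B by (simp add: u_def mult_left_mono)
  then have "u\<^sup>2 \<le> (s\<^sup>2 * B\<^sup>2 / 2)\<^sup>2" using u0 by (intro power_mono)
  also have "\<dots> = s ^ 4 * B ^ 4 / 4"
    by (simp add: power_divide power_mult_distrib power2_eq_square power4_eq_xxxx)
  also have "\<dots> \<le> s ^ 4 * B ^ 4" using B by simp
  finally have u2: "u\<^sup>2 / 2 \<le> s ^ 4 * B ^ 4"
    using zero_le_power2[of u] by linarith
  define R where "R = (\<Sum>i<m. p i * \<epsilon> i)"
  have "(\<Sum>i<m. p i * iexp (s * (b i - \<beta>))) - exp (- (s\<^sup>2 * \<tau> / 2)) = R - of_real (s\<^sup>2 / 2 * (V - \<tau>)) - of_real (exp (- u) - (1 - u))"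
    unfolding eq R_def[symmetric] by (simp add: u_def field_simps exp_of_real[symmetric])
  also have "cmod \<dots> \<le> cmod R + \<bar>s\<^sup>2 / 2 * (V - \<tau>)\<bar> + \<bar>exp (- u) - (1 - u)\<bar>"
    by (intro order_trans[OF norm_triangle_ineq4] add_mono) (simp_all only: norm_of_real order_refl)
  also have "\<bar>s\<^sup>2 / 2 * (V - \<tau>)\<bar> \<le> s\<^sup>2 * B\<^sup>2 * D"
  proof -
    have "\<bar>s\<^sup>2 / 2 * (V - \<tau>)\<bar> = s\<^sup>2 / 2 * \<bar>V - \<tau>\<bar>" by (simp add: abs_mult)
    also have "\<dots> \<le> s\<^sup>2 / 2 * (2 * B\<^sup>2 * D)" using V\<tau> by (intro mult_left_mono) auto
    finally show ?thesis by (simp add: mult_ac)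
  qed
  also have "\<bar>exp (- u) - (1 - u)\<bar> \<le> u\<^sup>2 / 2" by (rule exp_neg_taylor1[OF u0])
  finally show ?thesis using r u2 unfolding D_def[symmetric] R_def[symmetric] by linarith
qed

section \<open>Moments of the small urn\<close>

lemma sum_powr_neg_le:
  assumes g: "0 \<le> \<gamma>" "\<gamma> < (1::real)"
  shows "(\<Sum>k<n. real (k + 1) powr - \<gamma>) \<le> real n powr (1 - \<gamma>) / (1 - \<gamma>)"
proof (induction n)
  case (Suc n)
  have step: "real (n + 1) powr - \<gamma> \<le> (real (n + 1) powr (1 - \<gamma>) - real n powr (1 - \<gamma>)) / (1 - \<gamma>)"
  proof (cases "n = 0")
    case True
    then show ?thesis using g by simp
  next
    case False
    have "\<exists>z>real n. z < real (n + 1) \<and> real (n + 1) powr (1 - \<gamma>) - real n powr (1 - \<gamma>)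
        = (real (n + 1) - real n) * ((1 - \<gamma>) * z powr (1 - \<gamma> - 1))"
    proof (rule MVT2)
      fix x assume "real n \<le> x" "x \<le> real (n + 1)"
      then have "0 < x" using False by linarith
      then show "((\<lambda>x. x powr (1 - \<gamma>)) has_real_derivative (1 - \<gamma>) * x powr (1 - \<gamma> - 1)) (at x)"
        by (rule has_real_derivative_powr)
    qed simp
    then obtain z where z: "real n < z" "z < real (n + 1)"
      "real (n + 1) powr (1 - \<gamma>) - real n powr (1 - \<gamma>) = (1 - \<gamma>) * z powr - \<gamma>" by auto
    have "real (n + 1) powr - \<gamma> \<le> z powr - \<gamma>"
      using z g by (intro powr_mono2') auto
    then have "(1 - \<gamma>) * real (n + 1) powr - \<gamma> \<le> (1 - \<gamma>) * z powr - \<gamma>"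
      using g by (intro mult_left_mono) auto
    then show ?thesis using g unfolding z(3) by (simp add: pos_le_divide_eq mult.commute)
  qed
  have "(\<Sum>k<Suc n. real (k + 1) powr - \<gamma>)
      \<le> real n powr (1 - \<gamma>) / (1 - \<gamma>) + real (n + 1) powr - \<gamma>" using Suc by simp
  also note step
  finally show ?case by (simp add: diff_divide_distrib)
qed simp

text \<open>
  Errors of the single steps add up because the later factors are bounded by 1.
\<close>

lemma norm_diff_prod_telescope:
  fixes \<phi> :: "nat \<Rightarrow> complex" and e :: "nat \<Rightarrow> real"
  assumes "\<And>k. k < n \<Longrightarrow> cmod (\<phi> (Suc k) - \<phi> k * e k) \<le> r k"
    and "\<And>k. k < n \<Longrightarrow> 0 \<le> e k \<and> e k \<le> 1"
  shows "cmod (\<phi> n - \<phi> 0 * (\<Prod>k<n. e k)) \<le> (\<Sum>k<n. r k)"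
  using assms
proof (induction n)
  case (Suc n)
  have "\<phi> (Suc n) - \<phi> 0 * (\<Prod>k<Suc n. e k)
      = (\<phi> (Suc n) - \<phi> n * e n) + (\<phi> n - \<phi> 0 * (\<Prod>k<n. e k)) * e n"
    by (simp add: algebra_simps)
  also have "cmod \<dots> \<le> cmod (\<phi> (Suc n) - \<phi> n * e n) + cmod (\<phi> n - \<phi> 0 * (\<Prod>k<n. e k)) * e n"
    using Suc.prems(2)[of n] by (intro order_trans[OF norm_triangle_ineq]) (simp add: norm_mult)
  also have "\<dots> \<le> r n + (\<Sum>k<n. r k) * 1"
  proof (intro add_mono mult_mono sum_nonneg)
    show "0 \<le> r k" if "k \<in> {..<n}" for k
      using that by (intro order_trans[OF norm_ge_zero Suc.prems(1)[of k]]) simp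
  qed (use Suc in auto)
  finally show ?case by simp
qed simp

text \<open>
  What the central limit theorem needs from linear algebra: a steady state \<open>v\<close> (the right eigenvector
  for eigenvalue 1) and growth of order less than \<open>sqrt (n / k)\<close> of the functionals orthogonal to it.
\<close>

locale small_urn =
  fixes m :: nat and v :: "nat \<Rightarrow> real" and \<rho> :: real
  assumes m: "3 \<le> m" and \<rho>: "0 \<le> \<rho>" "\<rho> < 1 / 2"
    and v_nonneg: "\<And>i. i \<le> m \<Longrightarrow> 0 \<le> v i"
    and v_activity: "(\<Sum>i<m. real (i + 1) * v i) = 1"
    and v_eigen: "\<And>r. r \<le> m \<Longrightarrow> (\<Sum>i<m. real (i + 1) * v i * jump m i r) = v r"
    and growth: "\<And>w. dotp m w v = 0 \<Longrightarrow>
      \<exists>C\<ge>0. \<forall>n k r. 0 < n \<longrightarrow> k \<le> n \<longrightarrow> r \<le> m \<longrightarrow> \<bar>pullback m w n k r\<bar> \<le> C * (real n / real (k + 1)) powr \<rho>"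
begin

definition draw_prob :: "nat \<Rightarrow> nat \<Rightarrow> (nat \<Rightarrow> real) \<Rightarrow> real" where
  "draw_prob k i x = real (i + 1) * x i / real (k + 1)"

lemma draw_prob_distribution:
  assumes "urn_state m k x"
  shows "0 \<le> draw_prob k i x" "(\<Sum>i<m. draw_prob k i x) = 1"
  using assms by (auto simp: draw_prob_def urn_state_def sum_divide_distrib[symmetric])

lemma perm_avg_step:
  fixes F :: "(nat \<Rightarrow> real) \<Rightarrow> 'b::real_vector"
  shows "perm_avg m (Suc k) F = perm_avg m k (\<lambda>x. \<Sum>i<m. draw_prob k i x *\<^sub>R F (\<lambda>r. x r + jump m i r))"
  unfolding perm_avg_Suc[OF m] draw_prob_def ..

lemma steady_under_jumps: "(\<Sum>i<m. real (i + 1) * v i * dotp m w (jump m i)) = dotp m w v"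
proof -
  have "(\<Sum>i<m. real (i + 1) * v i * dotp m w (jump m i))
      = (\<Sum>r\<le>m. w r * (\<Sum>i<m. real (i + 1) * v i * jump m i r))"
    by (simp add: dotp_def sum_distrib_left mult_ac) (rule sum.swap)
  then show ?thesis using v_eigen by (simp add: dotp_def)
qed

lemma pullback_perp:
  assumes "dotp m w v = 0"
  shows "dotp m (pullback m w n k) v = 0"
proof (induction "n - k" arbitrary: k)
  case 0
  then show ?case using assms by (simp add: pullback.simps)
next
  case (Suc d)
  then have "k < n" "dotp m (pullback m w n (Suc k)) v = 0" by auto
  moreover have "(\<Sum>i<m. real (i + 1) * v i / real l * dotp m w' (jump m i)) = dotp m w' v / real l" for l w'
    using steady_under_jumps[of w'] by (simp add: sum_divide_distrib[symmetric])
  ultimately show ?case by (simp add: pullback_step dotp_pull del: of_nat_Suc)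
qed

lemma growth_increments:
  assumes "dotp m w v = 0"
  obtains C where "0 \<le> C"
    "\<And>n k i. k < n \<Longrightarrow> i < m \<Longrightarrow> \<bar>dotp m (pullback m w n (Suc k)) (jump m i)\<bar> \<le> C * (real n / real (k + 1)) powr \<rho>"
    "\<And>n. 0 < n \<Longrightarrow> \<bar>pullback m w n 0 0\<bar> \<le> C * real n powr \<rho>"
proof -
  obtain C where C: "0 \<le> C" "\<And>n k r. 0 < n \<Longrightarrow> k \<le> n \<Longrightarrow> r \<le> m \<Longrightarrow> \<bar>pullback m w n k r\<bar> \<le> C * (real n / real (k + 1)) powr \<rho>"
    using growth[OF assms] by blast
  define K where "K = 1 + (\<Sum>i<m. \<Sum>r\<le>m. \<bar>jump m i r\<bar>)"
  have K0: "1 \<le> K" unfolding K_def by (simp add: sum_nonneg)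
  show ?thesis
  proof (rule that[of "C * K"])
    show "0 \<le> C * K" using C K0 by simp
    show "\<bar>dotp m (pullback m w n (Suc k)) (jump m i)\<bar> \<le> C * K * (real n / real (k + 1)) powr \<rho>"
      if "k < n" "i < m" for n k i
    proof -
      let ?g = "(real n / real (k + 1)) powr \<rho>"
      have "\<bar>dotp m (pullback m w n (Suc k)) (jump m i)\<bar> \<le> (\<Sum>r\<le>m. \<bar>pullback m w n (Suc k) r * jump m i r\<bar>)"
        unfolding dotp_def by (rule sum_abs)
      also have "\<dots> \<le> (\<Sum>r\<le>m. C * ?g * \<bar>jump m i r\<bar>)"
      proof (intro sum_mono)
        fix r assume "r \<in> {..m}"
        then have "\<bar>pullback m w n (Suc k) r\<bar> \<le> C * (real n / real (Suc k + 1)) powr \<rho>"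
          using that by (intro C) auto
        also have "\<dots> \<le> C * ?g"
          using C(1) \<rho> by (intro mult_left_mono powr_mono2) (auto intro!: divide_left_mono)
        finally show "\<bar>pullback m w n (Suc k) r * jump m i r\<bar> \<le> C * ?g * \<bar>jump m i r\<bar>"
          by (simp add: abs_mult mult_right_mono)
      qed
      also have "\<dots> = C * ?g * (\<Sum>r\<le>m. \<bar>jump m i r\<bar>)" by (simp add: sum_distrib_left)
      also have "\<dots> \<le> C * ?g * K"
      proof (intro mult_left_mono)
        have "(\<Sum>r\<le>m. \<bar>jump m i r\<bar>) \<le> (\<Sum>i<m. \<Sum>r\<le>m. \<bar>jump m i r\<bar>)"
          using that by (intro member_le_sum[of i]) (auto intro: sum_nonneg)
        then show "(\<Sum>r\<le>m. \<bar>jump m i r\<bar>) \<le> K" by (simp add: K_def)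
      qed (use C in auto)
      finally show ?thesis by (simp add: mult_ac)
    qed
    show "\<bar>pullback m w n 0 0\<bar> \<le> C * K * real n powr \<rho>" if "0 < n" for n
    proof -
      have "\<bar>pullback m w n 0 0\<bar> \<le> C * real n powr \<rho>" using C(2)[of n 0 0] that by simp
      also have "\<dots> \<le> C * real n powr \<rho> * K" using C(1) K0 by (intro mult_right_mono[of 1 K, simplified] order_trans[OF _ mult_left_mono[OF K0]]) auto
      finally show ?thesis by (simp add: mult_ac)
    qed
  qed
qed

text \<open>
  The place where \<open>\<rho> < 1 / 2\<close> is decisive: the sum is of order \<open>n\<close>.
\<close>

lemma sum_growth_sq:
  "(\<Sum>k<n. ((real n / real (k + 1)) powr \<rho>)\<^sup>2) \<le> real n / (1 - 2 * \<rho>)"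
proof (cases "n = 0")
  case False
  have "((real n / real (k + 1)) powr \<rho>)\<^sup>2 = real n powr (2 * \<rho>) * real (k + 1) powr - (2 * \<rho>)" for k
    by (simp add: powr_divide powr_minus power2_eq_square field_simps flip: powr_add)
  then have "(\<Sum>k<n. ((real n / real (k + 1)) powr \<rho>)\<^sup>2)
      = real n powr (2 * \<rho>) * (\<Sum>k<n. real (k + 1) powr - (2 * \<rho>))"
    by (simp only: sum_distrib_left)
  also have "\<dots> \<le> real n powr (2 * \<rho>) * (real n powr (1 - 2 * \<rho>) / (1 - 2 * \<rho>))"
    using \<rho> by (intro mult_left_mono sum_powr_neg_le) auto
  also have "\<dots> = real n / (1 - 2 * \<rho>)"
    using False by (simp flip: powr_add)
  finally show ?thesis .
qed simp

text \<open>
  Orthogonality of the martingale increments; each contributes at most the square of the weight.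
\<close>

lemma second_moment:
  assumes w: "dotp m w v = 0"
  obtains C where "0 \<le> C" "\<And>n. 0 < n \<Longrightarrow> perm_avg m n (\<lambda>x. (dotp m w x)\<^sup>2) \<le> C * real n"
proof -
  obtain C where C: "0 \<le> C"
    "\<And>n k i. k < n \<Longrightarrow> i < m \<Longrightarrow> \<bar>dotp m (pullback m w n (Suc k)) (jump m i)\<bar> \<le> C * (real n / real (k + 1)) powr \<rho>"
    "\<And>n. 0 < n \<Longrightarrow> \<bar>pullback m w n 0 0\<bar> \<le> C * real n powr \<rho>"
    using growth_increments[OF w] by blast
  show ?thesis
  proof (rule that[of "C\<^sup>2 + C\<^sup>2 / (1 - 2 * \<rho>)"])
    show "0 \<le> C\<^sup>2 + C\<^sup>2 / (1 - 2 * \<rho>)" using \<rho> by simp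
    fix n :: nat assume n: "0 < n"
    let ?W = "pullback m w n" and ?g = "\<lambda>k. C * (real n / real (k + 1)) powr \<rho>"
    define V where "V k = perm_avg m k (\<lambda>x. (dotp m (?W k) x)\<^sup>2)" for k
    have step: "V (Suc k) \<le> V k + (?g k)\<^sup>2" if k: "k < n" for k
    proof -
      have "V (Suc k) = perm_avg m k (\<lambda>x. \<Sum>i<m. draw_prob k i x * (dotp m (?W (Suc k)) x + dotp m (?W (Suc k)) (jump m i))\<^sup>2)"
        by (simp add: V_def perm_avg_step dotp_add_right)
      also have "\<dots> \<le> perm_avg m k (\<lambda>x. (dotp m (?W k) x)\<^sup>2 + (?g k)\<^sup>2)"
      proof (rule perm_avg_mono[OF m])
        fix x assume x: "urn_state m k x"
        have "(\<Sum>i<m. draw_prob k i x * (dotp m (?W (Suc k)) x + dotp m (?W (Suc k)) (jump m i))\<^sup>2)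
            \<le> (dotp m (?W (Suc k)) x + (\<Sum>i<m. draw_prob k i x * dotp m (?W (Suc k)) (jump m i)))\<^sup>2 + (?g k)\<^sup>2"
          using draw_prob_distribution[OF x] C(2)[OF k] by (intro conditional_second_moment) auto
        also have "dotp m (?W (Suc k)) x + (\<Sum>i<m. draw_prob k i x * dotp m (?W (Suc k)) (jump m i)) = dotp m (?W k) x"
          by (simp only: pullback_step[OF k] dotp_pull draw_prob_def Suc_eq_plus1)
        finally show "(\<Sum>i<m. draw_prob k i x * (dotp m (?W (Suc k)) x + dotp m (?W (Suc k)) (jump m i))\<^sup>2)
            \<le> (dotp m (?W k) x)\<^sup>2 + (?g k)\<^sup>2" .
      qed
      finally show ?thesis by (simp only: perm_avg_add perm_avg_const V_def)
    qed
    have "V j \<le> V 0 + (\<Sum>k<j. (?g k)\<^sup>2)" if "j \<le> n" for j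
      using that
    proof (induction j)
      case (Suc j)
      then show ?case using step[of j] by simp
    qed simp
    from this[of n] have "perm_avg m n (\<lambda>x. (dotp m w x)\<^sup>2) \<le> V 0 + (\<Sum>k<n. (?g k)\<^sup>2)"
      by (simp add: V_def)
    also have "V 0 \<le> C\<^sup>2 * real n"
    proof -
      have "V 0 = \<bar>?W 0 0\<bar>\<^sup>2" by (simp add: V_def perm_avg_0 dotp_unit_fun)
      also have "\<dots> \<le> (C * real n powr \<rho>)\<^sup>2" by (intro power_mono C n) simp
      also have "\<dots> = C\<^sup>2 * real n powr (2 * \<rho>)"
        by (simp add: power_mult_distrib power2_eq_square flip: powr_add)
      also have "\<dots> \<le> C\<^sup>2 * real n powr 1" using \<rho> n by (intro mult_left_mono powr_mono) auto
      finally show ?thesis using n by simp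
    qed
    also have "(\<Sum>k<n. (?g k)\<^sup>2) = C\<^sup>2 * (\<Sum>k<n. ((real n / real (k + 1)) powr \<rho>)\<^sup>2)"
      by (simp only: power_mult_distrib sum_distrib_left)
    also have "\<dots> \<le> C\<^sup>2 * (real n / (1 - 2 * \<rho>))" by (intro mult_left_mono sum_growth_sq) simp
    finally show "perm_avg m n (\<lambda>x. (dotp m w x)\<^sup>2) \<le> (C\<^sup>2 + C\<^sup>2 / (1 - 2 * \<rho>)) * real n"
      by (simp add: algebra_simps)
  qed
qed

lemma first_moment:
  assumes w: "dotp m w v = 0"
  obtains C where "0 \<le> C" "\<And>n. 0 < n \<Longrightarrow> perm_avg m n (\<lambda>x. \<bar>dotp m w x\<bar>) \<le> C * sqrt (real n)"
proof -
  obtain C where C: "0 \<le> C" "\<And>n. 0 < n \<Longrightarrow> perm_avg m n (\<lambda>x. (dotp m w x)\<^sup>2) \<le> C * real n"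
    using second_moment[OF w] by blast
  show ?thesis
  proof (rule that[of "1 + C"])
    fix n :: nat assume n: "0 < n"
    define c where "c = sqrt (real n)"
    have c: "0 < c" "c\<^sup>2 = real n" using n by (auto simp: c_def)
    \<comment> \<open>The inequality of arithmetic and geometric means, balanced at the expected size \<open>c\<close>.\<close>
    have "perm_avg m n (\<lambda>x. \<bar>dotp m w x\<bar>) \<le> perm_avg m n (\<lambda>x. c + (1 / c) * (dotp m w x)\<^sup>2)"
    proof (rule perm_avg_mono[OF m])
      fix x
      let ?y = "dotp m w x"
      have "0 \<le> (c - \<bar>?y\<bar>)\<^sup>2 + c * \<bar>?y\<bar>" using c by simp
      then have "c * \<bar>?y\<bar> \<le> c\<^sup>2 + ?y\<^sup>2" by (simp add: power2_diff)
      then show "\<bar>?y\<bar> \<le> c + (1 / c) * ?y\<^sup>2" using c by (simp add: field_simps power2_eq_square)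
    qed
    also have "\<dots> = c + (1 / c) * perm_avg m n (\<lambda>x. (dotp m w x)\<^sup>2)"
      by (simp only: perm_avg_add perm_avg_const perm_avg_cmult)
    also have "\<dots> \<le> c + (1 / c) * (C * c\<^sup>2)"
      unfolding c(2) using C(2)[OF n] c(1) by (intro add_left_mono mult_left_mono) auto
    also have "\<dots> = (1 + C) * c" using c(1) by (simp add: field_simps power2_eq_square)
    finally show "perm_avg m n (\<lambda>x. \<bar>dotp m w x\<bar>) \<le> (1 + C) * sqrt (real n)" by (simp add: c_def)
  qed (use C in auto)
qed

text \<open>
  Distance between the law of the next draw and its limit.
\<close>

definition deviation :: "nat \<Rightarrow> (nat \<Rightarrow> real) \<Rightarrow> real" where
  "deviation k x = (\<Sum>i<m. \<bar>draw_prob k i x - real (i + 1) * v i\<bar>)"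

lemma dotp_act: "dotp m (act m) x = (\<Sum>i<m. real (i + 1) * x i)"
  by (simp add: dotp_def sum_act)

text \<open>
  The law of large numbers for the composition. The difference between a coordinate and its limit is
  a functional orthogonal to \<open>v\<close>, obtained by subtracting a multiple of the total activity, and its
  first moment is of order \<open>sqrt k\<close> against the normalisation \<open>k + 1\<close>.
\<close>

lemma mean_deviation:
  obtains D where "0 \<le> D" "\<And>k. perm_avg m k (deviation k) \<le> D * real (k + 1) powr (- (1 / 2))"
proof -
  \<comment> \<open>On compositions with \<open>k\<close> keys this functional is \<open>x i - v i (k + 1)\<close>.\<close>
  define z where "z i = (\<lambda>r. unit_fun i r - v i * act m r)" for i
  have z: "dotp m (z i) v = 0" if "i < m" for i
    using that v_activity by (simp add: z_def dotp_diff_left dotp_unit_fun dotp_act)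
  have "\<forall>i. \<exists>C. i < m \<longrightarrow> 0 \<le> C \<and> (\<forall>n>0. perm_avg m n (\<lambda>x. \<bar>dotp m (z i) x\<bar>) \<le> C * sqrt (real n))"
    using first_moment[OF z] by metis
  then obtain C where C: "\<And>i. i < m \<Longrightarrow> 0 \<le> C i"
    "\<And>i n. i < m \<Longrightarrow> 0 < n \<Longrightarrow> perm_avg m n (\<lambda>x. \<bar>dotp m (z i) x\<bar>) \<le> C i * sqrt (real n)"
    by metis
  define D where "D = 2 + (\<Sum>i<m. real (i + 1) * C i)"
  have D0: "0 \<le> (\<Sum>i<m. real (i + 1) * C i)" using C(1) by (intro sum_nonneg) auto
  show ?thesis
  proof (rule that[of D])
    show "0 \<le> D" using D0 by (simp add: D_def)
    fix k :: nat
    show "perm_avg m k (deviation k) \<le> D * real (k + 1) powr (- (1 / 2))"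
    \<comment> \<open>The moment bounds start at one key; initially any two probability vectors have distance at most 2.\<close>
    proof (cases "k = 0")
      case True
      have "perm_avg m k (deviation k) \<le> perm_avg m k (\<lambda>x. 2)"
      proof (rule perm_avg_mono[OF m])
        fix x assume x: "urn_state m k x"
        have "deviation k x \<le> (\<Sum>i<m. draw_prob k i x + real (i + 1) * v i)"
          unfolding deviation_def
        proof (intro sum_mono)
          fix i assume "i \<in> {..<m}"
          then have "0 \<le> real (i + 1) * v i" using v_nonneg[of i] by simp
          then show "\<bar>draw_prob k i x - real (i + 1) * v i\<bar> \<le> draw_prob k i x + real (i + 1) * v i"
            using draw_prob_distribution(1)[OF x, of i] by linarith
        qed
        also have "\<dots> = 2" using draw_prob_distribution(2)[OF x] v_activity by (simp add: sum.distrib)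
        finally show "deviation k x \<le> 2" .
      qed
      also have "\<dots> = 2" by (rule perm_avg_const)
      also have "\<dots> \<le> D" using D0 by (simp add: D_def)
      finally show ?thesis using True by simp
    next
      case False
      then have k: "0 < k" by simp
      have "perm_avg m k (deviation k)
          \<le> perm_avg m k (\<lambda>x. \<Sum>i<m. (real (i + 1) / real (k + 1)) * \<bar>dotp m (z i) x\<bar>)"
      proof (rule perm_avg_mono[OF m])
        fix x assume x: "urn_state m k x"
        have "\<bar>draw_prob k i x - real (i + 1) * v i\<bar> = (real (i + 1) / real (k + 1)) * \<bar>dotp m (z i) x\<bar>"
          if "i < m" for i
        proof -
          have "dotp m (z i) x = x i - v i * real (k + 1)"
            using that x by (simp add: z_def dotp_diff_left dotp_unit_fun dotp_act urn_state_def)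
          moreover have "draw_prob k i x - real (i + 1) * v i
              = (real (i + 1) / real (k + 1)) * (x i - v i * real (k + 1))"
            by (simp add: draw_prob_def field_simps)
          ultimately show ?thesis by (simp only: abs_mult) simp
        qed
        then show "deviation k x \<le> (\<Sum>i<m. (real (i + 1) / real (k + 1)) * \<bar>dotp m (z i) x\<bar>)"
          by (simp add: deviation_def)
      qed
      also have "\<dots> = (\<Sum>i<m. (real (i + 1) / real (k + 1)) * perm_avg m k (\<lambda>x. \<bar>dotp m (z i) x\<bar>))"
        by (simp only: perm_avg_sum perm_avg_cmult)
      also have "\<dots> \<le> (\<Sum>i<m. (real (i + 1) / real (k + 1)) * (C i * sqrt (real k)))"
        using C(2)[OF _ k] by (intro sum_mono mult_left_mono) auto
      also have "\<dots> = (\<Sum>i<m. real (i + 1) * C i) * (sqrt (real k) / real (k + 1))"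
        unfolding sum_distrib_right by (intro sum.cong) (simp_all add: mult_ac)
      also have "\<dots> \<le> D * real (k + 1) powr (- (1 / 2))"
      proof (intro mult_mono)
        have "sqrt (real k) / real (k + 1) \<le> sqrt (real (k + 1)) / real (k + 1)"
          by (intro divide_right_mono) auto
        also have "\<dots> = real (k + 1) powr (- (1 / 2))"
          by (simp add: powr_minus powr_half_sqrt field_simps)
        finally show "sqrt (real k) / real (k + 1) \<le> real (k + 1) powr (- (1 / 2))" .
      qed (use D0 in \<open>auto simp: D_def\<close>)
      finally show ?thesis .
    qed
  qed
qed

end

section \<open>Central limit theorem for the small urn\<close>

context small_urn
begin

text \<open>
  The conditional variance of the increment of \<open>w\<close> if the composition is proportional to \<open>v\<close>; no
  square of a mean is subtracted because \<open>w\<close> will be orthogonal to \<open>v\<close>.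
\<close>

definition steady_var :: "(nat \<Rightarrow> real) \<Rightarrow> real" where
  "steady_var w = (\<Sum>i<m. real (i + 1) * v i * (dotp m w (jump m i))\<^sup>2)"

lemma steady_var_nonneg: "0 \<le> steady_var w"
  unfolding steady_var_def using v_nonneg by (intro sum_nonneg) auto

lemma char_fun_step:
  fixes s :: real
  assumes w: "dotp m w v = 0" and k: "k < n"
    and g: "\<And>i. i < m \<Longrightarrow> \<bar>dotp m (pullback m w n (Suc k)) (jump m i)\<bar> \<le> g"
  shows "cmod (perm_avg m (Suc k) (\<lambda>x. iexp (s * dotp m (pullback m w n (Suc k)) x))
      - perm_avg m k (\<lambda>x. iexp (s * dotp m (pullback m w n k) x)) * of_real (exp (- (s\<^sup>2 * steady_var (pullback m w n (Suc k)) / 2))))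
     \<le> 2 * \<bar>s\<bar> ^ 3 * g ^ 3 + s\<^sup>2 * g\<^sup>2 * perm_avg m k (deviation k) + s ^ 4 * g ^ 4"
proof -
  define W' where "W' = pullback m w n (Suc k)"
  define b where "b i = dotp m W' (jump m i)" for i
  define e where "e = exp (- (s\<^sup>2 * steady_var W' / 2))"
  define Y where "Y x = dotp m (pullback m w n k) x" for x
  define G where "G x = (\<Sum>i<m. draw_prob k i x *\<^sub>R iexp (s * dotp m W' (\<lambda>r. x r + jump m i r)))" for x
  have "cmod (G x - iexp (s * Y x) * of_real e)
      \<le> 2 * \<bar>s\<bar> ^ 3 * g ^ 3 + s\<^sup>2 * g\<^sup>2 * deviation k x + s ^ 4 * g ^ 4" if x: "urn_state m k x" for x
  proof -
    define \<beta> where "\<beta> = (\<Sum>i<m. draw_prob k i x * b i)"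
    have Y: "Y x = dotp m W' x + \<beta>"
      by (simp only: Y_def pullback_step[OF k] dotp_pull \<beta>_def b_def W'_def draw_prob_def Suc_eq_plus1)
    have "draw_prob k i x *\<^sub>R iexp (s * dotp m W' (\<lambda>r. x r + jump m i r))
        = iexp (s * Y x) * (draw_prob k i x * iexp (s * (b i - \<beta>)))" for i
    proof -
      have "s * dotp m W' (\<lambda>r. x r + jump m i r) = s * Y x + s * (b i - \<beta>)"
        by (simp add: dotp_add_right Y b_def algebra_simps)
      then have "iexp (s * dotp m W' (\<lambda>r. x r + jump m i r)) = iexp (s * Y x) * iexp (s * (b i - \<beta>))"
        by (simp only: of_real_add distrib_left exp_add)
      then show ?thesis by (simp only: scaleR_conv_of_real mult_ac)
    qed
    then have "G x = iexp (s * Y x) * (\<Sum>i<m. draw_prob k i x * iexp (s * (b i - \<beta>)))"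
      by (simp only: G_def sum_distrib_left)
    then have "G x - iexp (s * Y x) * of_real e
        = iexp (s * Y x) * ((\<Sum>i<m. draw_prob k i x * iexp (s * (b i - \<beta>))) - of_real e)"
      by (simp only: right_diff_distrib)
    then have "cmod (G x - iexp (s * Y x) * of_real e)
        = cmod ((\<Sum>i<m. draw_prob k i x * iexp (s * (b i - \<beta>))) - of_real e)"
      by (simp only: norm_mult norm_exp_i_times mult_1_left)
    also have "\<dots> = cmod ((\<Sum>i<m. draw_prob k i x * iexp (s * (b i - (\<Sum>i<m. draw_prob k i x * b i))))
        - exp (- (s\<^sup>2 * (\<Sum>i<m. (real (i + 1) * v i) * (b i)\<^sup>2) / 2)))"
      by (simp only: \<beta>_def e_def steady_var_def b_def[symmetric])
    also have "\<dots> \<le> 2 * \<bar>s\<bar> ^ 3 * g ^ 3 + s\<^sup>2 * g\<^sup>2 * (\<Sum>i<m. \<bar>draw_prob k i x - real (i + 1) * v i\<bar>) + s ^ 4 * g ^ 4"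
    proof (rule conditional_char_bound)
      show "0 \<le> draw_prob k i x" for i by (rule draw_prob_distribution[OF x])
      show "(\<Sum>i<m. draw_prob k i x) = 1" by (rule draw_prob_distribution[OF x])
      show "0 \<le> real (i + 1) * v i" if "i < m" for i using v_nonneg[of i] that by simp
      show "(\<Sum>i<m. real (i + 1) * v i) = 1" by (rule v_activity)
      show "\<bar>b i\<bar> \<le> g" if "i < m" for i unfolding b_def W'_def by (rule g[OF that])
      show "(\<Sum>i<m. real (i + 1) * v i * b i) = 0"
        unfolding b_def steady_under_jumps W'_def by (rule pullback_perp[OF w])
    qed
    finally show ?thesis by (simp only: deviation_def)
  qed
  note pointwise = this
  have "perm_avg m (Suc k) (\<lambda>x. iexp (s * dotp m W' x)) - perm_avg m k (\<lambda>x. iexp (s * Y x)) * of_real e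
      = perm_avg m k (\<lambda>x. G x - iexp (s * Y x) * of_real e)"
    by (simp only: perm_avg_diff perm_avg_mult_right G_def perm_avg_step)
  also have "cmod \<dots> \<le> perm_avg m k (\<lambda>x. cmod (G x - iexp (s * Y x) * of_real e))"
    by (rule norm_perm_avg_le)
  also have "\<dots> \<le> perm_avg m k (\<lambda>x. 2 * \<bar>s\<bar> ^ 3 * g ^ 3 + s\<^sup>2 * g\<^sup>2 * deviation k x + s ^ 4 * g ^ 4)"
    by (rule perm_avg_mono[OF m pointwise])
  also have "\<dots> = 2 * \<bar>s\<bar> ^ 3 * g ^ 3 + s\<^sup>2 * g\<^sup>2 * perm_avg m k (deviation k) + s ^ 4 * g ^ 4"
    by (simp only: perm_avg_add perm_avg_const perm_avg_cmult)
  finally show ?thesis by (simp only: W'_def Y_def e_def)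
qed

text \<open>
  The total of the one-step errors for \<open>s = t / sqrt n\<close>. Cubic and quartic terms are controlled by the
  largest weight, which is \<open>o(sqrt n)\<close>, times the sum of squares; in the middle term the
  exponent of \<open>k + 1\<close> is weakened to \<open>- (\<rho> + 1 / 2)\<close>, whose sum is of order \<open>n powr (1 / 2 - \<rho>)\<close>.
\<close>

lemma error_sum:
  fixes s t C D :: real
  assumes n: "0 < n" and s: "s = t / sqrt (real n)" and C: "0 \<le> C" and D: "0 \<le> D"
  defines "g \<equiv> \<lambda>k. C * (real n / real (k + 1)) powr \<rho>"
    and "h \<equiv> real n powr (\<rho> - 1 / 2)" and "K \<equiv> C\<^sup>2 / (1 - 2 * \<rho>)"
  shows "(\<Sum>k<n. 2 * \<bar>s\<bar> ^ 3 * g k ^ 3 + s\<^sup>2 * (g k)\<^sup>2 * (D * real (k + 1) powr (- (1 / 2))) + s ^ 4 * g k ^ 4)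
    \<le> 2 * (\<bar>t\<bar> * C * h) * (t\<^sup>2 * K) + t\<^sup>2 * D * C\<^sup>2 / (1 / 2 - \<rho>) * h + (\<bar>t\<bar> * C * h)\<^sup>2 * (t\<^sup>2 * K)"
proof -
  define Q where "Q = \<bar>t\<bar> * C * h"
  have s2: "s\<^sup>2 = t\<^sup>2 / real n" using n by (simp add: s power_divide)
  have g0: "0 \<le> g k" for k using C by (simp add: g_def)
  have gQ: "\<bar>s\<bar> * g k \<le> Q" for k
  proof -
    have "g k \<le> C * real n powr \<rho>"
      unfolding g_def using C \<rho> by (intro mult_left_mono powr_mono2) (auto simp: field_simps)
    then have "\<bar>s\<bar> * g k \<le> \<bar>s\<bar> * (C * real n powr \<rho>)" by (rule mult_left_mono) simp
    also have "\<dots> = \<bar>t\<bar> * C * (real n powr \<rho> / real n powr (1 / 2))"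
      by (simp add: s powr_half_sqrt abs_mult mult_ac)
    also have "\<dots> = Q" by (simp add: Q_def h_def powr_diff)
    finally show ?thesis .
  qed
  have sumg: "(\<Sum>k<n. s\<^sup>2 * (g k)\<^sup>2) \<le> t\<^sup>2 * K"
  proof -
    have "(\<Sum>k<n. s\<^sup>2 * (g k)\<^sup>2) = s\<^sup>2 * C\<^sup>2 * (\<Sum>k<n. ((real n / real (k + 1)) powr \<rho>)\<^sup>2)"
      by (simp only: g_def power_mult_distrib sum_distrib_left mult.assoc)
    also have "\<dots> \<le> s\<^sup>2 * C\<^sup>2 * (real n / (1 - 2 * \<rho>))"
      by (intro mult_left_mono sum_growth_sq) simp
    also have "\<dots> = t\<^sup>2 * K" using n by (simp add: s2 K_def)
    finally show ?thesis .
  qed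
  have "(\<Sum>k<n. 2 * \<bar>s\<bar> ^ 3 * g k ^ 3) \<le> (\<Sum>k<n. 2 * Q * (s\<^sup>2 * (g k)\<^sup>2))"
  proof (intro sum_mono)
    fix k
    have "2 * \<bar>s\<bar> ^ 3 * g k ^ 3 = 2 * (\<bar>s\<bar> * g k) * (s\<^sup>2 * (g k)\<^sup>2)"
      by (simp add: power2_eq_square power3_eq_cube mult_ac flip: power2_abs[of s])
    also have "\<dots> \<le> 2 * Q * (s\<^sup>2 * (g k)\<^sup>2)"
      using gQ[of k] by (intro mult_right_mono mult_left_mono) auto
    finally show "2 * \<bar>s\<bar> ^ 3 * g k ^ 3 \<le> 2 * Q * (s\<^sup>2 * (g k)\<^sup>2)" .
  qed
  also have "\<dots> = 2 * Q * (\<Sum>k<n. s\<^sup>2 * (g k)\<^sup>2)" by (simp only: sum_distrib_left)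
  also have "\<dots> \<le> 2 * Q * (t\<^sup>2 * K)"
    using sumg C by (intro mult_left_mono) (auto simp: Q_def h_def)
  finally have 1: "(\<Sum>k<n. 2 * \<bar>s\<bar> ^ 3 * g k ^ 3) \<le> 2 * Q * (t\<^sup>2 * K)" .
  have "(\<Sum>k<n. s ^ 4 * g k ^ 4) \<le> (\<Sum>k<n. Q\<^sup>2 * (s\<^sup>2 * (g k)\<^sup>2))"
  proof (intro sum_mono)
    fix k
    have "s ^ 4 * g k ^ 4 = (\<bar>s\<bar> * g k)\<^sup>2 * (s\<^sup>2 * (g k)\<^sup>2)"
      by (simp add: power2_eq_square power4_eq_xxxx mult_ac flip: power2_abs[of s])
    also have "\<dots> \<le> Q\<^sup>2 * (s\<^sup>2 * (g k)\<^sup>2)"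
      using gQ[of k] g0[of k] by (intro mult_right_mono power_mono) auto
    finally show "s ^ 4 * g k ^ 4 \<le> Q\<^sup>2 * (s\<^sup>2 * (g k)\<^sup>2)" .
  qed
  also have "\<dots> = Q\<^sup>2 * (\<Sum>k<n. s\<^sup>2 * (g k)\<^sup>2)" by (simp only: sum_distrib_left)
  also have "\<dots> \<le> Q\<^sup>2 * (t\<^sup>2 * K)" using sumg by (intro mult_left_mono) auto
  finally have 3: "(\<Sum>k<n. s ^ 4 * g k ^ 4) \<le> Q\<^sup>2 * (t\<^sup>2 * K)" .
  define \<gamma> where "\<gamma> = \<rho> + 1 / 2"
  have "(\<Sum>k<n. s\<^sup>2 * (g k)\<^sup>2 * (D * real (k + 1) powr (- (1 / 2))))
      \<le> (\<Sum>k<n. s\<^sup>2 * C\<^sup>2 * D * real n powr (2 * \<rho>) * real (k + 1) powr - \<gamma>)"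
  proof (intro sum_mono)
    fix k
    have "(g k)\<^sup>2 = C\<^sup>2 * (real n powr (2 * \<rho>) * real (k + 1) powr - (2 * \<rho>))"
      using n by (simp add: g_def power_mult_distrib powr_divide powr_minus power2_eq_square field_simps flip: powr_add)
    then have "s\<^sup>2 * (g k)\<^sup>2 * (D * real (k + 1) powr (- (1 / 2)))
        = s\<^sup>2 * C\<^sup>2 * D * real n powr (2 * \<rho>) * (real (k + 1) powr - (2 * \<rho>) * real (k + 1) powr (- (1 / 2)))"
      by (simp only: mult_ac)
    also have "real (k + 1) powr - (2 * \<rho>) * real (k + 1) powr (- (1 / 2)) = real (k + 1) powr (- (2 * \<rho>) + - (1 / 2))"
      by (simp only: powr_add)
    also have "s\<^sup>2 * C\<^sup>2 * D * real n powr (2 * \<rho>) * \<dots> \<le> s\<^sup>2 * C\<^sup>2 * D * real n powr (2 * \<rho>) * real (k + 1) powr - \<gamma>"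
      using \<rho> D by (intro mult_left_mono powr_mono) (auto simp: \<gamma>_def)
    finally show "s\<^sup>2 * (g k)\<^sup>2 * (D * real (k + 1) powr (- (1 / 2)))
        \<le> s\<^sup>2 * C\<^sup>2 * D * real n powr (2 * \<rho>) * real (k + 1) powr - \<gamma>" .
  qed
  also have "\<dots> = s\<^sup>2 * C\<^sup>2 * D * real n powr (2 * \<rho>) * (\<Sum>k<n. real (k + 1) powr - \<gamma>)"
    by (simp only: sum_distrib_left)
  also have "\<dots> \<le> s\<^sup>2 * C\<^sup>2 * D * real n powr (2 * \<rho>) * (real n powr (1 - \<gamma>) / (1 - \<gamma>))"
    using \<rho> D by (intro mult_left_mono sum_powr_neg_le) (auto simp: \<gamma>_def)
  also have "\<dots> = t\<^sup>2 * D * C\<^sup>2 / (1 / 2 - \<rho>) * (real n powr (2 * \<rho>) * real n powr (1 - \<gamma>) / real n powr 1)"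
    using n by (simp add: s2 \<gamma>_def mult_ac)
  also have "real n powr (2 * \<rho>) * real n powr (1 - \<gamma>) / real n powr 1 = h"
    by (simp only: h_def \<gamma>_def powr_add[symmetric] powr_diff[symmetric]) (simp add: algebra_simps)
  finally have 2: "(\<Sum>k<n. s\<^sup>2 * (g k)\<^sup>2 * (D * real (k + 1) powr (- (1 / 2)))) \<le> t\<^sup>2 * D * C\<^sup>2 / (1 / 2 - \<rho>) * h" .
  show ?thesis unfolding sum.distrib using 1 2 3 unfolding Q_def by linarith
qed

text \<open>
  The characteristic function at time \<open>n\<close> is, up to \<open>E n\<close>, its value at time 0 times the product of the
  Gaussian factors. The value at time 0 tends to 1 because the weight \<open>w\<^sub>n\<^sub>,\<^sub>0\<close> is \<open>o(sqrt n)\<close>.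
\<close>

lemma urn_central_limit:
  fixes t :: real
  assumes w: "dotp m w v = 0"
    and var: "(\<lambda>n. (\<Sum>k<n. steady_var (pullback m w n (Suc k))) / real n) \<longlonglongrightarrow> \<sigma>2"
  shows "(\<lambda>n. perm_avg m n (\<lambda>x. iexp (t / sqrt (real n) * dotp m w x))) \<longlonglongrightarrow> of_real (exp (- (\<sigma>2 * t\<^sup>2 / 2)))"
proof -
  obtain C where C: "0 \<le> C"
    "\<And>n k i. k < n \<Longrightarrow> i < m \<Longrightarrow> \<bar>dotp m (pullback m w n (Suc k)) (jump m i)\<bar> \<le> C * (real n / real (k + 1)) powr \<rho>"
    "\<And>n. 0 < n \<Longrightarrow> \<bar>pullback m w n 0 0\<bar> \<le> C * real n powr \<rho>"
    using growth_increments[OF w] by blast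
  obtain D where D: "0 \<le> D" "\<And>k. perm_avg m k (deviation k) \<le> D * real (k + 1) powr (- (1 / 2))"
    using mean_deviation by blast
  define K where "K = C\<^sup>2 / (1 - 2 * \<rho>)"
  define h where "h n = real n powr (\<rho> - 1 / 2)" for n :: nat
  define E where "E n = 2 * (\<bar>t\<bar> * C * h n) * (t\<^sup>2 * K) + t\<^sup>2 * D * C\<^sup>2 / (1 / 2 - \<rho>) * h n + (\<bar>t\<bar> * C * h n)\<^sup>2 * (t\<^sup>2 * K)" for n
  define s where "s n = t / sqrt (real n)" for n :: nat
  define \<phi> where "\<phi> n k = perm_avg m k (\<lambda>x. iexp (s n * dotp m (pullback m w n k) x))" for n k
  define e where "e n k = exp (- ((s n)\<^sup>2 * steady_var (pullback m w n (Suc k)) / 2))" for n k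
  have h0: "h \<longlonglongrightarrow> 0"
    unfolding h_def using \<rho> by (intro tendsto_neg_powr filterlim_real_sequentially) auto
  have "E \<longlonglongrightarrow> 2 * (\<bar>t\<bar> * C * 0) * (t\<^sup>2 * K) + t\<^sup>2 * D * C\<^sup>2 / (1 / 2 - \<rho>) * 0 + (\<bar>t\<bar> * C * 0)\<^sup>2 * (t\<^sup>2 * K)"
    unfolding E_def by (intro tendsto_intros h0)
  then have E0: "E \<longlonglongrightarrow> 0" by simp
  have close: "cmod (\<phi> n n - \<phi> n 0 * of_real (\<Prod>k<n. e n k)) \<le> E n" if n: "0 < n" for n
  proof -
    let ?g = "\<lambda>k. C * (real n / real (k + 1)) powr \<rho>"
    let ?r = "\<lambda>k. 2 * \<bar>s n\<bar> ^ 3 * ?g k ^ 3 + (s n)\<^sup>2 * (?g k)\<^sup>2 * (D * real (k + 1) powr (- (1 / 2))) + (s n) ^ 4 * ?g k ^ 4"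
    have "cmod (\<phi> n n - \<phi> n 0 * of_real (\<Prod>k<n. e n k)) \<le> (\<Sum>k<n. ?r k)"
    proof (rule norm_diff_prod_telescope)
      fix k assume k: "k < n"
      have "cmod (\<phi> n (Suc k) - \<phi> n k * of_real (e n k))
          \<le> 2 * \<bar>s n\<bar> ^ 3 * ?g k ^ 3 + (s n)\<^sup>2 * (?g k)\<^sup>2 * perm_avg m k (deviation k) + (s n) ^ 4 * ?g k ^ 4"
        unfolding \<phi>_def e_def by (rule char_fun_step[OF w k]) (rule C(2)[OF k])
      also have "\<dots> \<le> ?r k"
        using D(2)[of k] by (intro add_mono mult_left_mono) auto
      finally show "cmod (\<phi> n (Suc k) - \<phi> n k * of_real (e n k)) \<le> ?r k" .
      show "0 \<le> e n k \<and> e n k \<le> 1" using steady_var_nonneg by (simp add: e_def)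
    qed
    also have "\<dots> \<le> E n"
      unfolding E_def h_def K_def by (rule error_sum[OF n _ C(1) D(1)]) (simp add: s_def)
    finally show ?thesis .
  qed
  have "(\<lambda>n. \<phi> n n - \<phi> n 0 * of_real (\<Prod>k<n. e n k)) \<longlonglongrightarrow> 0"
    by (rule Lim_null_comparison[OF _ E0]) (use close in \<open>auto intro: eventually_sequentiallyI[of 1]\<close>)
  moreover have "(\<lambda>n. \<phi> n 0) \<longlonglongrightarrow> 1"
  proof -
    have A: "cmod (\<phi> n 0 - 1) \<le> \<bar>t\<bar> * C * h n" if n: "0 < n" for n
    proof -
      have "cmod (\<phi> n 0 - 1) \<le> \<bar>s n * pullback m w n 0 0\<bar>"
        using iexp_approx1[of "s n * pullback m w n 0 0" 0] by (simp add: \<phi>_def perm_avg_0 dotp_unit_fun)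
      also have "\<dots> \<le> \<bar>s n\<bar> * (C * real n powr \<rho>)"
        unfolding abs_mult by (intro mult_left_mono C n) simp
      also have "\<dots> = \<bar>t\<bar> * C * (real n powr \<rho> / real n powr (1 / 2))"
        by (simp add: s_def powr_half_sqrt abs_mult mult_ac)
      also have "\<dots> = \<bar>t\<bar> * C * h n" by (simp add: h_def powr_diff)
      finally show ?thesis .
    qed
    have B: "(\<lambda>n. \<bar>t\<bar> * C * h n) \<longlonglongrightarrow> 0"
      using tendsto_mult_left[OF h0, of "\<bar>t\<bar> * C"] by simp
    have "(\<lambda>n. \<phi> n 0 - 1) \<longlonglongrightarrow> 0"
      by (rule Lim_null_comparison[OF eventually_sequentiallyI[of 1] B]) (rule A, simp)
    then show ?thesis by (simp only: LIM_zero_iff)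
  qed
  moreover have "(\<lambda>n. complex_of_real (\<Prod>k<n. e n k)) \<longlonglongrightarrow> of_real (exp (- (\<sigma>2 * t\<^sup>2 / 2)))"
  proof (rule tendsto_of_real, rule Lim_transform_eventually)
    show "(\<lambda>n. exp (- ((\<Sum>k<n. steady_var (pullback m w n (Suc k))) / real n * t\<^sup>2 / 2))) \<longlonglongrightarrow> exp (- (\<sigma>2 * t\<^sup>2 / 2))"
      by (intro tendsto_intros var) simp
    have "exp (- ((\<Sum>k<n. steady_var (pullback m w n (Suc k))) / real n * t\<^sup>2 / 2)) = (\<Prod>k<n. e n k)" if "0 < n" for n
    proof -
      have "(\<Prod>k<n. e n k) = exp (\<Sum>k<n. - ((s n)\<^sup>2 * steady_var (pullback m w n (Suc k)) / 2))"
        by (simp add: e_def exp_sum)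
      also have "(\<Sum>k<n. - ((s n)\<^sup>2 * steady_var (pullback m w n (Suc k)) / 2))
          = - ((\<Sum>k<n. steady_var (pullback m w n (Suc k))) * ((s n)\<^sup>2 / 2))"
        unfolding sum_negf sum_distrib_right by (intro arg_cong[where f = uminus] sum.cong refl) simp
      also have "(s n)\<^sup>2 = t\<^sup>2 / real n" using that by (simp add: s_def power_divide)
      finally show ?thesis by (simp add: mult_ac)
    qed
    then show "\<forall>\<^sub>F n in sequentially. exp (- ((\<Sum>k<n. steady_var (pullback m w n (Suc k))) / real n * t\<^sup>2 / 2)) = (\<Prod>k<n. e n k)"
      by (auto intro: eventually_sequentiallyI[of 1])
  qed
  ultimately have "(\<lambda>n. (\<phi> n n - \<phi> n 0 * of_real (\<Prod>k<n. e n k)) + \<phi> n 0 * of_real (\<Prod>k<n. e n k))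
      \<longlonglongrightarrow> 0 + 1 * of_real (exp (- (\<sigma>2 * t\<^sup>2 / 2)))"
    by (intro tendsto_add tendsto_mult)
  then show ?thesis by (simp add: \<phi>_def s_def)
qed

end

section \<open>Products governing a single eigenvalue\<close>

text \<open>
  The factor by which pulling back from \<open>n\<close> to \<open>k\<close> multiplies an eigenvector with eigenvalue \<open>z\<close>.
\<close>

definition gain :: "nat \<Rightarrow> nat \<Rightarrow> complex \<Rightarrow> complex" where
  "gain n k z = (\<Prod>l\<in>{k<..n}. 1 + z / of_nat l)"

lemma gain_self [simp]: "gain n n z = 1"
  by (simp add: gain_def)

lemma gain_Suc_left: "k < n \<Longrightarrow> gain n k z = (1 + z / of_nat (Suc k)) * gain n (Suc k) z"
proof -
  assume "k < n"
  then have "{k<..n} = insert (Suc k) {Suc k<..n}" by auto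
  then show ?thesis by (simp add: gain_def)
qed

lemma gain_Suc_right: "k \<le> n \<Longrightarrow> gain (Suc n) k z = (1 + z / of_nat (Suc n)) * gain n k z"
proof -
  assume "k \<le> n"
  then have "{k<..Suc n} = insert (Suc n) {k<..n}" by auto
  then show ?thesis by (simp add: gain_def)
qed

lemma norm_one_plus_divide_le:
  assumes "0 < l"
  shows "cmod (1 + z / of_nat l) \<le> exp (Re z / real l + (cmod z)\<^sup>2 / 2 / (real l)\<^sup>2)"
proof (rule power2_le_imp_le)
  have "(cmod (1 + z / of_nat l))\<^sup>2 = (1 + Re z / real l)\<^sup>2 + (Im z / real l)\<^sup>2"
    by (simp add: cmod_power2)
  also have "\<dots> = 1 + (2 * Re z / real l + (cmod z)\<^sup>2 / (real l)\<^sup>2)"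
    by (simp add: cmod_power2 power2_sum power_divide add_divide_distrib)
  also have "\<dots> \<le> exp (2 * Re z / real l + (cmod z)\<^sup>2 / (real l)\<^sup>2)"
    by (rule exp_ge_add_one_self)
  also have "\<dots> = (exp (Re z / real l + (cmod z)\<^sup>2 / 2 / (real l)\<^sup>2))\<^sup>2"
    by (simp add: power2_eq_square flip: exp_add)
  finally show "(cmod (1 + z / of_nat l))\<^sup>2 \<le> (exp (Re z / real l + (cmod z)\<^sup>2 / 2 / (real l)\<^sup>2))\<^sup>2" .
qed simp

text \<open>
  Each factor is at most \<open>exp (\<rho> / l + a / l\<^sup>2)\<close>. The first part of the exponents is compared with
  logarithms, \<open>1 / (n + 1) \<le> ln ((n + 1) / n)\<close>. The second one sums to a constant, which is made
  visible to the induction by the extra factor \<open>exp (- a / n)\<close>, since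
  \<open>1 / (n + 1)\<^sup>2 \<le> 1 / n - 1 / (n + 1)\<close>.
\<close>

lemma gain_bound:
  assumes z: "Re z \<le> \<rho>" and \<rho>: "0 \<le> \<rho>" "\<rho> \<le> 1"
  obtains C where "0 \<le> C" "\<And>n k. 0 < n \<Longrightarrow> k \<le> n \<Longrightarrow> cmod (gain n k z) \<le> C * (real n / real (k + 1)) powr \<rho>"
proof -
  define a where "a = (cmod z)\<^sup>2 / 2"
  have a: "0 \<le> a" by (simp add: a_def)
  have factor: "cmod (1 + z / of_nat l) \<le> exp (\<rho> / real l + a / (real l)\<^sup>2)" if "0 < l" for l
  proof -
    have "Re z / real l \<le> \<rho> / real l" using z by (intro divide_right_mono) auto
    then show ?thesis
      using norm_one_plus_divide_le[OF that, of z] unfolding a_def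
      by (intro order_trans[OF norm_one_plus_divide_le[OF that]]) simp
  qed
  have main: "cmod (gain n k z) \<le> exp (\<rho> + 2 * a) * (real n / real (k + 1)) powr \<rho> * exp (- a / real n)"
    if "Suc k \<le> n" for n k
    using that
  proof (induction rule: dec_induct)
    case base
    have "gain (Suc k) k z = 1 + z / of_nat (Suc k)"
      using gain_Suc_left[of k "Suc k" z] by simp
    then have "cmod (gain (Suc k) k z) \<le> exp (\<rho> / real (Suc k) + a / (real (Suc k))\<^sup>2)"
      using factor[of "Suc k"] by (simp only: zero_less_Suc)
    also have "\<dots> \<le> exp (\<rho> + 2 * a + - a / real (Suc k))"
    proof -
      have "\<rho> / real (Suc k) \<le> \<rho> / 1" using \<rho> by (intro divide_left_mono) auto
      moreover have "a / (real (Suc k))\<^sup>2 \<le> a / 1"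
        using a by (intro divide_left_mono) (auto simp del: of_nat_Suc)
      moreover have "a / real (Suc k) \<le> a / 1" using a by (intro divide_left_mono) auto
      ultimately show ?thesis by simp
    qed
    also have "\<dots> = exp (\<rho> + 2 * a) * (real (Suc k) / real (k + 1)) powr \<rho> * exp (- a / real (Suc k))"
      by (simp only: exp_add Suc_eq_plus1) simp
    finally show ?case .
  next
    case (step n)
    then have n: "0 < n" by simp
    have "gain (Suc n) k z = (1 + z / of_nat (Suc n)) * gain n k z"
      using step by (intro gain_Suc_right) simp
    then have "cmod (gain (Suc n) k z) = cmod (1 + z / of_nat (Suc n)) * cmod (gain n k z)"
      by (simp only: norm_mult)
    also have "\<dots> \<le> exp (\<rho> / real (Suc n) + a / (real (Suc n))\<^sup>2)
        * (exp (\<rho> + 2 * a) * (real n / real (k + 1)) powr \<rho> * exp (- a / real n))"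
      by (rule mult_mono[OF factor step.IH]) simp_all
    also have "\<dots> = exp (\<rho> + 2 * a) * (exp (\<rho> / real (Suc n)) * (real n / real (k + 1)) powr \<rho>)
        * exp (a / (real (Suc n))\<^sup>2 + - a / real n)"
      by (simp only: exp_add mult_ac)
    also have "\<dots> \<le> exp (\<rho> + 2 * a) * (real (Suc n) / real (k + 1)) powr \<rho> * exp (- a / real (Suc n))"
    proof (intro mult_mono order_refl)
      have "1 / real (Suc n) \<le> ln (real (Suc n) / real n)"
      proof -
        have "ln (real n / real (Suc n)) \<le> real n / real (Suc n) - 1"
          using n by (intro ln_le_minus_one) auto
        also have "\<dots> = - (1 / real (Suc n))" by (simp add: field_simps)
        finally show ?thesis using n by (simp add: ln_div del: of_nat_Suc)
      qed
      then have "\<rho> * (1 / real (Suc n)) \<le> \<rho> * ln (real (Suc n) / real n)"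
        using \<rho> by (intro mult_left_mono)
      then have "exp (\<rho> / real (Suc n)) \<le> (real (Suc n) / real n) powr \<rho>"
        using n by (simp add: powr_def)
      then have "exp (\<rho> / real (Suc n)) * (real n / real (k + 1)) powr \<rho>
          \<le> (real (Suc n) / real n) powr \<rho> * (real n / real (k + 1)) powr \<rho>"
        by (rule mult_right_mono) simp
      also have "\<dots> = (real (Suc n) / real (k + 1)) powr \<rho>"
        using n by (subst powr_mult[symmetric]) (auto simp del: of_nat_Suc)
      finally show "exp (\<rho> / real (Suc n)) * (real n / real (k + 1)) powr \<rho> \<le> (real (Suc n) / real (k + 1)) powr \<rho>" .
      have "1 / (real (Suc n))\<^sup>2 \<le> 1 / (real n * real (Suc n))"
        unfolding power2_eq_square using n by (intro divide_left_mono mult_right_mono) auto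
      also have "\<dots> = 1 / real n - 1 / real (Suc n)" using n by (simp add: field_simps)
      finally have "1 / (real (Suc n))\<^sup>2 \<le> 1 / real n - 1 / real (Suc n)" .
      then have "a * (1 / (real (Suc n))\<^sup>2) \<le> a * (1 / real n - 1 / real (Suc n))"
        using a by (intro mult_left_mono)
      then show "exp (a / (real (Suc n))\<^sup>2 + - a / real n) \<le> exp (- a / real (Suc n))"
        by (simp add: right_diff_distrib)
    qed auto
    finally show ?case .
  qed
  show ?thesis
  proof (rule that[of "2 * exp (\<rho> + 2 * a)"])
    fix n k :: nat assume nk: "0 < n" "k \<le> n"
    show "cmod (gain n k z) \<le> 2 * exp (\<rho> + 2 * a) * (real n / real (k + 1)) powr \<rho>"
    proof (cases "k = n")
      case True
      have "(1 / 2) powr 1 \<le> (1 / 2 :: real) powr \<rho>" using \<rho> by (intro powr_mono') auto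
      also have "\<dots> \<le> (real n / real (k + 1)) powr \<rho>"
        using \<rho> nk True by (intro powr_mono2) (auto simp: field_simps)
      finally have "1 \<le> 2 * (real n / real (k + 1)) powr \<rho>" by simp
      also have "\<dots> \<le> 2 * (real n / real (k + 1)) powr \<rho> * exp (\<rho> + 2 * a)"
      proof -
        have "1 \<le> exp (\<rho> + 2 * a)" using \<rho> a by simp
        from mult_left_mono[OF this, of "2 * (real n / real (k + 1)) powr \<rho>"] show ?thesis by simp
      qed
      finally show ?thesis using True by (simp add: mult_ac)
    next
      case False
      then have "cmod (gain n k z) \<le> exp (\<rho> + 2 * a) * (real n / real (k + 1)) powr \<rho> * exp (- a / real n)"
        using nk by (intro main) simp
      also have "\<dots> \<le> exp (\<rho> + 2 * a) * (real n / real (k + 1)) powr \<rho> * 2"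
      proof (intro mult_left_mono)
        have "exp (- a / real n) \<le> 1" using a by simp
        then show "exp (- a / real n) \<le> 2" by linarith
      qed auto
      finally show ?thesis by (simp add: mult_ac)
    qed
  qed simp
qed

text \<open>
  The sums \<open>T n\<close> satisfy \<open>T (n + 1) = (1 + \<alpha> / (n + 1)) (1 + \<beta> / (n + 1)) T n + 1\<close>, and \<open>n / \<gamma>\<close> with
  \<open>\<gamma> = 1 - \<alpha> - \<beta>\<close> satisfies this recursion up to an error \<open>\<epsilon>\<close> of order \<open>1 / n\<close>. The difference is the
  convolution of these errors with the gains, hence \<open>o(n)\<close>.
\<close>

lemma gain_product_average:
  fixes \<alpha> \<beta> :: complex
  assumes \<alpha>: "Re \<alpha> < 1 / 2" and \<beta>: "Re \<beta> < 1 / 2"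
  shows "(\<lambda>n. (\<Sum>k<n. gain n (Suc k) \<alpha> * gain n (Suc k) \<beta>) / of_nat n) \<longlonglongrightarrow> 1 / (1 - \<alpha> - \<beta>)"
proof -
  define \<rho> where "\<rho> = max 0 (max (Re \<alpha>) (Re \<beta>))"
  have \<rho>: "0 \<le> \<rho>" "\<rho> < 1 / 2" "\<rho> \<le> 1" "Re \<alpha> \<le> \<rho>" "Re \<beta> \<le> \<rho>" using \<alpha> \<beta> by (auto simp: \<rho>_def)
  obtain C1 where C1: "0 \<le> C1" "\<And>n k. 0 < n \<Longrightarrow> k \<le> n \<Longrightarrow> cmod (gain n k \<alpha>) \<le> C1 * (real n / real (k + 1)) powr \<rho>"
    using gain_bound[OF \<rho>(4,1,3)] by blast
  obtain C2 where C2: "0 \<le> C2" "\<And>n k. 0 < n \<Longrightarrow> k \<le> n \<Longrightarrow> cmod (gain n k \<beta>) \<le> C2 * (real n / real (k + 1)) powr \<rho>"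
    using gain_bound[OF \<rho>(5,1,3)] by blast
  define \<gamma> where "\<gamma> = 1 - \<alpha> - \<beta>"
  have "Re \<gamma> > 0" using \<alpha> \<beta> by (simp add: \<gamma>_def)
  then have \<gamma>: "\<gamma> \<noteq> 0" by auto
  \<comment> \<open>\<open>P n k\<close> propagates a contribution made at time \<open>k\<close> to time \<open>n\<close>.\<close>
  define P where "P n k = gain n k \<alpha> * gain n k \<beta>" for n k
  define T where "T n = (\<Sum>k<n. P n (Suc k))" for n
  define \<epsilon> where "\<epsilon> l = ((\<alpha> * \<beta> - \<alpha> - \<beta>) - \<alpha> * \<beta> / of_nat l) / (\<gamma> * of_nat l)" for l :: nat
  have P_Suc: "P (Suc n) k = (1 + \<alpha> / of_nat (Suc n)) * (1 + \<beta> / of_nat (Suc n)) * P n k" if "k \<le> n" for n k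
    using that by (simp only: P_def gain_Suc_right mult_ac)
  have P_self: "P n n = 1" for n by (simp add: P_def)
  have d: "T n - of_nat n / \<gamma> = (\<Sum>k<n. P n (Suc k) * \<epsilon> (Suc k))" for n
  proof (induction n)
    case 0
    then show ?case by (simp add: T_def)
  next
    case (Suc n)
    define L where "L = (of_nat (Suc n) :: complex)"
    define f where "f = (1 + \<alpha> / L) * (1 + \<beta> / L)"
    have L0: "L \<noteq> 0" unfolding L_def by (simp del: of_nat_Suc)
    have Ln: "of_nat n = L - 1" by (simp add: L_def)
    have "(\<Sum>k<Suc n. P (Suc n) (Suc k) * \<epsilon> (Suc k)) = f * (\<Sum>k<n. P n (Suc k) * \<epsilon> (Suc k)) + \<epsilon> (Suc n)"
      using P_Suc by (simp add: P_self sum_distrib_left f_def L_def mult.assoc del: of_nat_Suc)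
    also have "\<dots> = f * (T n - (L - 1) / \<gamma>) + \<epsilon> (Suc n)"
      using Suc by (simp only: Ln)
    also have "\<epsilon> (Suc n) = ((\<alpha> * \<beta> - \<alpha> - \<beta>) - \<alpha> * \<beta> / L) / (\<gamma> * L)" by (simp only: \<epsilon>_def L_def)
    also have "f * (T n - (L - 1) / \<gamma>) + ((\<alpha> * \<beta> - \<alpha> - \<beta>) - \<alpha> * \<beta> / L) / (\<gamma> * L) = f * T n + 1 - L / \<gamma>"
    proof -
      have "f * ((L - 1) / \<gamma>) - ((\<alpha> * \<beta> - \<alpha> - \<beta>) - \<alpha> * \<beta> / L) / (\<gamma> * L) = L / \<gamma> - 1"
      proof -
        define Y where "Y = (\<alpha> * \<beta> - \<alpha> - \<beta>) - \<alpha> * \<beta> / L"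
        have "f * (L - 1) - Y / L = L - \<gamma>"
          using L0 by (simp add: f_def Y_def \<gamma>_def field_simps power2_eq_square)
        then have "(f * (L - 1) - Y / L) / \<gamma> = (L - \<gamma>) / \<gamma>" by simp
        moreover have "(f * (L - 1) - Y / L) / \<gamma> = f * ((L - 1) / \<gamma>) - Y / (\<gamma> * L)"
          by (simp only: diff_divide_distrib[of "f * (L - 1)"] times_divide_eq_right divide_divide_eq_left mult.commute[of L])
        ultimately show ?thesis using \<gamma> by (simp add: diff_divide_distrib Y_def[symmetric])
      qed
      then have "f * ((L - 1) / \<gamma>) = (L / \<gamma> - 1) + ((\<alpha> * \<beta> - \<alpha> - \<beta>) - \<alpha> * \<beta> / L) / (\<gamma> * L)"
        by (simp only: diff_eq_eq)
      then show ?thesis unfolding right_diff_distrib[of f] by (simp only:) simp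
    qed
    also have "f * T n + 1 = T (Suc n)"
      unfolding T_def using P_Suc by (simp add: P_self sum_distrib_left f_def L_def mult.assoc del: of_nat_Suc)
    finally show ?case by (simp only: L_def)
  qed
  define K where "K = (cmod (\<alpha> * \<beta> - \<alpha> - \<beta>) + cmod (\<alpha> * \<beta>)) / cmod \<gamma>"
  have K: "0 \<le> K" by (simp add: K_def)
  have \<epsilon>: "cmod (\<epsilon> (Suc k)) \<le> K / real (k + 1)" for k
  proof -
    have "cmod (\<epsilon> (Suc k)) = cmod ((\<alpha> * \<beta> - \<alpha> - \<beta>) - \<alpha> * \<beta> / of_nat (Suc k)) / (cmod \<gamma> * real (k + 1))"
      by (simp only: \<epsilon>_def norm_divide norm_mult norm_of_nat Suc_eq_plus1)
    also have "\<dots> \<le> (cmod (\<alpha> * \<beta> - \<alpha> - \<beta>) + cmod (\<alpha> * \<beta>)) / (cmod \<gamma> * real (k + 1))"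
    proof (intro divide_right_mono order_trans[OF norm_triangle_ineq4] add_left_mono)
      have "cmod (\<alpha> * \<beta>) / real (Suc k) \<le> cmod (\<alpha> * \<beta>) / 1" by (intro divide_left_mono) auto
      then show "cmod (\<alpha> * \<beta> / of_nat (Suc k)) \<le> cmod (\<alpha> * \<beta>)" by (simp only: norm_divide norm_of_nat div_by_1)
    qed auto
    finally show ?thesis by (simp add: K_def)
  qed
  have bound: "cmod (T n - of_nat n / \<gamma>) \<le> C1 * C2 * K / (1 / 2 - \<rho>) * real n powr (\<rho> + 1 / 2)" if n: "0 < n" for n
  proof -
    have "cmod (T n - of_nat n / \<gamma>) \<le> (\<Sum>k<n. cmod (P n (Suc k) * \<epsilon> (Suc k)))"
      unfolding d by (rule norm_sum)
    also have "\<dots> \<le> (\<Sum>k<n. C1 * C2 * K * real n powr (2 * \<rho>) * real (k + 1) powr - (\<rho> + 1 / 2))"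
    proof (intro sum_mono)
      fix k assume "k \<in> {..<n}"
      then have k: "Suc k \<le> n" by simp
      let ?h = "(real n / real (k + 1)) powr \<rho>"
      have h: "(real n / real (Suc k + 1)) powr \<rho> \<le> ?h"
        using \<rho> by (intro powr_mono2) (auto intro!: divide_left_mono)
      have 1: "cmod (gain n (Suc k) \<alpha>) \<le> C1 * ?h"
        using C1(2)[OF n k] mult_left_mono[OF h C1(1)] by linarith
      have 2: "cmod (gain n (Suc k) \<beta>) \<le> C2 * ?h"
        using C2(2)[OF n k] mult_left_mono[OF h C2(1)] by linarith
      have "cmod (P n (Suc k) * \<epsilon> (Suc k)) \<le> (C1 * ?h) * (C2 * ?h) * (K / real (k + 1))"
        unfolding P_def norm_mult using 1 2 \<epsilon>[of k] C1(1) C2(1) by (intro mult_mono) auto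
      also have "\<dots> = C1 * C2 * K * (?h * ?h * real (k + 1) powr - 1)"
        by (simp add: powr_minus field_simps)
      also have "?h * ?h * real (k + 1) powr - 1 = real n powr (2 * \<rho>) * (real (k + 1) powr - \<rho> * real (k + 1) powr - \<rho> * real (k + 1) powr - 1)"
        by (simp add: powr_divide powr_minus field_simps flip: powr_add)
      also have "real (k + 1) powr - \<rho> * real (k + 1) powr - \<rho> * real (k + 1) powr - 1 = real (k + 1) powr (- \<rho> + - \<rho> + - 1)"
        by (simp only: powr_add)
      also have "C1 * C2 * K * (real n powr (2 * \<rho>) * real (k + 1) powr (- \<rho> + - \<rho> + - 1))
          \<le> C1 * C2 * K * (real n powr (2 * \<rho>) * real (k + 1) powr - (\<rho> + 1 / 2))"
        using C1(1) C2(1) K \<rho> by (intro mult_left_mono powr_mono) auto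
      finally show "cmod (P n (Suc k) * \<epsilon> (Suc k)) \<le> C1 * C2 * K * real n powr (2 * \<rho>) * real (k + 1) powr - (\<rho> + 1 / 2)"
        by (simp only: mult.assoc)
    qed
    also have "\<dots> = C1 * C2 * K * real n powr (2 * \<rho>) * (\<Sum>k<n. real (k + 1) powr - (\<rho> + 1 / 2))"
      by (simp only: sum_distrib_left)
    also have "\<dots> \<le> C1 * C2 * K * real n powr (2 * \<rho>) * (real n powr (1 - (\<rho> + 1 / 2)) / (1 - (\<rho> + 1 / 2)))"
      using C1(1) C2(1) K \<rho> by (intro mult_left_mono sum_powr_neg_le) auto
    also have "\<dots> = C1 * C2 * K / (1 - (\<rho> + 1 / 2)) * (real n powr (2 * \<rho>) * real n powr (1 - (\<rho> + 1 / 2)))"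
      by simp
    also have "real n powr (2 * \<rho>) * real n powr (1 - (\<rho> + 1 / 2)) = real n powr (\<rho> + 1 / 2)"
      by (simp add: powr_add[symmetric])
    also have "1 - (\<rho> + 1 / 2) = 1 / 2 - \<rho>" by simp
    finally show ?thesis .
  qed
  have "(\<lambda>n. T n / of_nat n - 1 / \<gamma>) \<longlonglongrightarrow> 0"
  proof (rule Lim_null_comparison)
    define B where "B = C1 * C2 * K / (1 / 2 - \<rho>)"
    show "\<forall>\<^sub>F n in sequentially. cmod (T n / of_nat n - 1 / \<gamma>) \<le> B * real n powr (\<rho> - 1 / 2)"
    proof (rule eventually_sequentiallyI[of 1])
      fix n :: nat assume "1 \<le> n"
      then have n: "0 < n" by simp
      have "T n / of_nat n - 1 / \<gamma> = (T n - of_nat n / \<gamma>) / of_nat n"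
        using n by (simp add: diff_divide_distrib)
      then have "cmod (T n / of_nat n - 1 / \<gamma>) = cmod (T n - of_nat n / \<gamma>) / real n"
        by (simp only: norm_divide norm_of_nat)
      also have "\<dots> \<le> B * real n powr (\<rho> + 1 / 2) / real n"
        using bound[OF n] by (intro divide_right_mono) (auto simp: B_def)
      also have "\<dots> = B * (real n powr (\<rho> + 1 / 2) / real n powr 1)" using n by simp
      also have "real n powr (\<rho> + 1 / 2) / real n powr 1 = real n powr (\<rho> - 1 / 2)"
        by (simp only: powr_diff[symmetric]) simp
      finally show "cmod (T n / of_nat n - 1 / \<gamma>) \<le> B * real n powr (\<rho> - 1 / 2)" .
    qed
    have "(\<lambda>n. real n powr (\<rho> - 1 / 2)) \<longlonglongrightarrow> 0"
      using \<rho> by (intro tendsto_neg_powr filterlim_real_sequentially) auto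
    then show "(\<lambda>n. B * real n powr (\<rho> - 1 / 2)) \<longlonglongrightarrow> 0"
      using tendsto_mult_left[of _ 0 _ B] by force
  qed
  then have "(\<lambda>n. T n / of_nat n) \<longlonglongrightarrow> 1 / \<gamma>" by (simp only: LIM_zero_iff)
  then show ?thesis by (simp only: T_def P_def \<gamma>_def)
qed

section \<open>Real parts of the eigenvalues\<close>

lemma arctan_upper:
  assumes "0 \<le> (x::real)"
  shows "arctan x \<le> x - x ^ 3 / 3 + x ^ 5 / 5"
proof -
  let ?f = "\<lambda>x. x - x ^ 3 / 3 + x ^ 5 / 5 - arctan x"
  have "?f 0 \<le> ?f x"
  proof (rule DERIV_nonneg_imp_nondecreasing[OF assms], intro exI conjI)
    fix y :: real
    show "(?f has_real_derivative (1 - y ^ 2 + y ^ 4 - inverse (1 + y ^ 2))) (at y)"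
      by (auto intro!: derivative_eq_intros simp: power2_eq_square)
    have "(1 - y ^ 2 + y ^ 4) * (1 + y ^ 2) = 1 + (y ^ 3) ^ 2"
      by (simp add: algebra_simps power2_eq_square eval_nat_numeral)
    then have "1 \<le> (1 - y ^ 2 + y ^ 4) * (1 + y ^ 2)" by simp
    then show "0 \<le> 1 - y ^ 2 + y ^ 4 - inverse (1 + y ^ 2)"
      using add_pos_nonneg[of 1 "y\<^sup>2"] by (simp add: inverse_eq_divide pos_divide_le_eq)
  qed
  then show ?thesis by simp
qed

lemma arctan_lower:
  assumes "0 \<le> (x::real)"
  shows "x - x ^ 3 / 3 \<le> arctan x"
proof -
  let ?f = "\<lambda>x. arctan x - (x - x ^ 3 / 3)"
  have "?f 0 \<le> ?f x"
  proof (rule DERIV_nonneg_imp_nondecreasing[OF assms], intro exI conjI)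
    fix y :: real
    show "(?f has_real_derivative (inverse (1 + y ^ 2) - (1 - y ^ 2))) (at y)"
      by (auto intro!: derivative_eq_intros simp: power2_eq_square)
    have "(1 - y ^ 2) * (1 + y ^ 2) = 1 - (y ^ 2) ^ 2"
      by (simp add: algebra_simps power2_eq_square)
    then have "(1 - y ^ 2) * (1 + y ^ 2) \<le> 1" by simp
    then show "0 \<le> inverse (1 + y ^ 2) - (1 - y ^ 2)"
      using add_pos_nonneg[of 1 "y\<^sup>2"] by (simp add: inverse_eq_divide pos_le_divide_eq)
  qed
  then show ?thesis by simp
qed

text \<open>
  Reduces the arguments near 1, where the Taylor polynomials are poor, to small ones.
\<close>

lemma arctan_shift:
  assumes "0 < (x::real)"
  shows "arctan x = pi / 4 + arctan ((x - 1) / (x + 1))"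
proof -
  let ?u = "(x - 1) / (x + 1)"
  have "\<bar>1::real\<bar> \<le> 1" "\<bar>?u\<bar> < 1" using assms by (auto simp: field_simps abs_less_iff)
  then have "arctan 1 + arctan ?u = arctan ((1 + ?u) / (1 - 1 * ?u))"
    by (rule arctan_add)
  also have "(1 + ?u) / (1 - 1 * ?u) = x"
    using assms by (simp add: field_simps)
  finally show ?thesis by (simp add: arctan_one)
qed

lemma arctan_upper_shift_neg:
  assumes "0 < (x::real)" "x \<le> 1"
  shows "arctan x \<le> pi / 4 - ((1 - x) / (1 + x) - ((1 - x) / (1 + x)) ^ 3 / 3)"
proof -
  have "(x - 1) / (x + 1) = - ((1 - x) / (1 + x))" by (simp add: field_simps minus_divide_left)
  then have "arctan ((x - 1) / (x + 1)) = - arctan ((1 - x) / (1 + x))"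
    by (simp only: arctan_minus)
  with arctan_shift[OF assms(1)] arctan_lower[of "(1 - x) / (1 + x)"] assms show ?thesis by simp
qed

lemma arctan_upper_shift_pos:
  assumes "1 \<le> (x::real)"
  shows "arctan x \<le> pi / 4 + ((x - 1) / (1 + x) - ((x - 1) / (1 + x)) ^ 3 / 3 + ((x - 1) / (1 + x)) ^ 5 / 5)"
  using arctan_shift[of x] arctan_upper[of "(x - 1) / (1 + x)"] assms by (simp add: add.commute)

text \<open>
  A rational number slightly above the solution of \<open>\<Prod>i=1..25. ((i + 1 / 2)\<^sup>2 + y\<^sup>2) = (26!)\<^sup>2\<close>, which
  is about 2.2034.
\<close>

definition im_cut :: real where "im_cut = 551 / 250"

lemma prod_lessThan_Suc_numeral: "(\<Prod>i<numeral k. f i) = (\<Prod>i<pred_numeral k. f i) * f (pred_numeral k)"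
  for f :: "nat \<Rightarrow> real"
  by (simp add: numeral_eq_Suc)

lemma sum_lessThan_Suc_numeral: "(\<Sum>i<numeral k. f i) = (\<Sum>i<pred_numeral k. f i) + f (pred_numeral k)"
  for f :: "nat \<Rightarrow> real"
  by (simp add: numeral_eq_Suc)

lemma modulus_check: "(fact 26)\<^sup>2 < (\<Prod>i<25. (real i + 3 / 2)\<^sup>2 + im_cut\<^sup>2)"
  unfolding im_cut_def
  by (simp add: prod_lessThan_Suc_numeral fact_numeral power2_eq_square)

text \<open>
  The numerical fact behind the bound 26. The left-hand side is about 6.279, so the estimates must be
  accurate to a few thousandths; the four largest angles are estimated at \<open>pi / 4\<close> plus a small
  correction, all others by the Taylor polynomial of degree 5.
\<close>

lemma angle_check: "(\<Sum>i<25. arctan (im_cut / (real i + 3 / 2))) < 2 * pi"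
proof -
  define a where "a i = arctan (im_cut / (real i + 3 / 2))" for i
  have "a 0 \<le> pi / 4 + 1879 / 10000" unfolding a_def im_cut_def
    by (rule order_trans[OF arctan_upper_shift_pos]) (simp_all add: power_divide)
  moreover have "a 1 \<le> pi / 4 - 628 / 10000" unfolding a_def im_cut_def
    by (rule order_trans[OF arctan_upper_shift_neg]) (simp_all add: power_divide)
  moreover have "a 2 \<le> pi / 4 - 2230 / 10000" unfolding a_def im_cut_def
    by (rule order_trans[OF arctan_upper_shift_neg]) (simp_all add: power_divide)
  moreover have "a 3 \<le> pi / 4 - 3288 / 10000" unfolding a_def im_cut_def
    by (rule order_trans[OF arctan_upper_shift_neg]) (simp_all add: power_divide)
  moreover have "(\<Sum>i<21. a (i + 4)) \<le> (\<Sum>i<21. (im_cut / (real i + 11/2)) - (im_cut / (real i + 11/2)) ^ 3 / 3 + (im_cut / (real i + 11/2)) ^ 5 / 5)"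
    by (intro sum_mono order_trans[OF _ arctan_upper]) (auto simp: a_def im_cut_def add_ac)
  moreover have "(\<Sum>i<21. (im_cut / (real i + 11/2)) - (im_cut / (real i + 11/2)) ^ 3 / 3 + (im_cut / (real i + 11/2)) ^ 5 / 5) \<le> 35662 / 10000"
    unfolding im_cut_def by (simp add: sum_lessThan_Suc_numeral power_divide)
  moreover have "(\<Sum>i<25. a i) = a 0 + a 1 + a 2 + a 3 + (\<Sum>i<21. a (i + 4))"
    by (simp add: sum_lessThan_Suc_numeral)
  moreover have "pi > 31415 / 10000" using pi_approx by simp
  ultimately show ?thesis unfolding a_def by linarith
qed


text \<open>
  The quotient of the two sides, as \<open>m\<close> grows, first increases from its value 1 at \<open>m = 1\<close> and from
  \<open>m = 5\<close> on decreases, because its ratio of consecutive terms is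
  \<open>((m + 1 / 2)\<^sup>2 + im_cut\<^sup>2) / (m + 1)\<^sup>2\<close>. Hence the single comparison at \<open>m = 26\<close> carries over
  downwards to 5, and the values below are checked directly.
\<close>

lemma modulus_bound:
  assumes "2 \<le> m" "m \<le> 26"
  shows "(fact m)\<^sup>2 < (\<Prod>i<m - 1. (real i + 3 / 2)\<^sup>2 + im_cut\<^sup>2)"
proof (cases "5 \<le> m")
  case True
  show ?thesis using assms(2) True
  proof (induction rule: inc_induct)
    case base
    show ?case using modulus_check by simp
  next
    case (step n)
    define P where "P = (\<Prod>i<n - 1. (real i + 3 / 2)\<^sup>2 + im_cut\<^sup>2)"
    have "{..<Suc n - 1} = insert (n - 1) {..<n - 1}" using step by auto
    then have "(\<Prod>i<Suc n - 1. (real i + 3 / 2)\<^sup>2 + im_cut\<^sup>2) = ((real n + 1 / 2)\<^sup>2 + im_cut\<^sup>2) * P"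
      using step by (simp add: P_def of_nat_diff)
    moreover have "(real n + 1 / 2)\<^sup>2 + im_cut\<^sup>2 \<le> (real n + 1)\<^sup>2"
      using step by (simp add: im_cut_def power2_eq_square algebra_simps)
    moreover have "0 \<le> P" unfolding P_def by (intro prod_nonneg) auto
    ultimately have "(\<Prod>i<Suc n - 1. (real i + 3 / 2)\<^sup>2 + im_cut\<^sup>2) \<le> (real n + 1)\<^sup>2 * P"
      by (simp add: mult_right_mono)
    with step have "(fact (Suc n))\<^sup>2 < (real n + 1)\<^sup>2 * P" by simp
    then have "(real n + 1)\<^sup>2 * (fact n)\<^sup>2 < (real n + 1)\<^sup>2 * P"
      by (simp add: power_mult_distrib add.commute)
    then show ?case by (simp add: P_def)
  qed
next
  case False
  then consider "m = 2" | "m = 3" | "m = 4" using assms by linarith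
  then show ?thesis
    by cases (simp_all add: im_cut_def lessThan_Suc numeral_eq_Suc power2_eq_square)
qed

lemma fact_as_prod: "fact (Suc n) = (\<Prod>i<n. real i + 2)"
  by (induction n) (simp_all add: algebra_simps)

text \<open>
  A real solution to the right of \<open>1 / 2\<close> is 1 by monotonicity. For a solution off the real axis, the
  moduli of the factors increase with \<open>Re z\<close> and \<open>Im z\<close>, so \<open>Im z < im_cut\<close>; their arguments decrease
  with \<open>Re z\<close> and increase with \<open>Im z\<close>, so their sum is less than \<open>2 pi\<close>. It is also positive, and
  the product cannot be a positive number.
\<close>

lemma indicial_root_real_part_aux:
  fixes z :: complex
  assumes m: "2 \<le> m" "m \<le> 26" and z: "(\<Prod>i<m - 1. z + of_nat (i + 1)) = fact m"
    and re: "1 / 2 \<le> Re z" and im: "0 \<le> Im z"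
  shows "z = 1"
proof (cases "Im z = 0")
  case True
  define x where "x = Re z"
  have zx: "z = of_real x" using True by (simp add: x_def complex_eq_iff)
  have "complex_of_real (\<Prod>i<m - 1. x + real (i + 1)) = of_real (fact m)"
    using z by (simp add: zx)
  then have eq: "(\<Prod>i<m - 1. x + real (i + 1)) = fact m"
    by (simp only: of_real_eq_iff)
  have fm: "fact m = (\<Prod>i<m - 1. 1 + real (i + 1))"
    using fact_as_prod[of "m - 1"] m by (simp add: add_ac)
  have x0: "1 / 2 \<le> x" using re by (simp add: x_def)
  have ne: "{..<m - 1} \<noteq> {}" using m by (auto simp: lessThan_empty_iff)
  have "\<not> x < 1"
  proof
    assume "x < 1"
    then have "(\<Prod>i<m - 1. x + real (i + 1)) < (\<Prod>i<m - 1. 1 + real (i + 1))"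
      using x0 ne by (intro prod_mono_strict) auto
    then show False using eq fm by simp
  qed
  moreover have "\<not> 1 < x"
  proof
    assume "1 < x"
    then have "(\<Prod>i<m - 1. 1 + real (i + 1)) < (\<Prod>i<m - 1. x + real (i + 1))"
      using x0 ne by (intro prod_mono_strict) auto
    then show False using eq fm by simp
  qed
  ultimately show ?thesis by (simp add: zx)
next
  case False
  define w where "w i = z + of_nat (i + 1)" for i :: nat
  have y: "0 < Im z" using False im by simp
  have wre: "real i + 3 / 2 \<le> Re (w i)" and wim: "Im (w i) = Im z" for i
    using re by (simp_all add: w_def)
  have wpos: "0 < Re (w i)" for i using wre[of i] by linarith
  then have w0: "w i \<noteq> 0" for i by (metis less_irrefl zero_complex.sel(1))
  have ylt: "Im z < im_cut"
  proof (rule ccontr)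
    assume "\<not> Im z < im_cut"
    then have yc: "im_cut \<le> Im z" by simp
    have "(\<Prod>i<m - 1. (real i + 3 / 2)\<^sup>2 + im_cut\<^sup>2) \<le> (\<Prod>i<m - 1. (cmod (w i))\<^sup>2)"
    proof (intro prod_mono conjI)
      fix i
      show "(real i + 3 / 2)\<^sup>2 + im_cut\<^sup>2 \<le> (cmod (w i))\<^sup>2"
        unfolding cmod_power2 wim
        by (intro add_mono power_mono wre yc) (auto simp: im_cut_def)
    qed auto
    also have "\<dots> = (cmod (\<Prod>i<m - 1. w i))\<^sup>2"
      by (simp add: prod_norm[symmetric] prod_power_distrib)
    also have "\<dots> = (fact m)\<^sup>2"
      using z by (simp add: w_def)
    finally show False using modulus_bound[OF m] by simp
  qed
  \<comment> \<open>All factors lie in the right half-plane, so the principal logarithms have imaginary parts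
    given by the arcus tangent, and no multiple of \<open>2 pi\<close> is lost.\<close>
  define S where "S = (\<Sum>i<m - 1. Ln (w i))"
  have expS: "exp S = fact m"
    unfolding S_def using z w0 by (simp add: exp_sum w_def)
  have ImLn: "Im (Ln (w i)) = arctan (Im z / Re (w i))" for i
    using Im_Ln_eq[OF w0[of i]] wpos[of i] wim[of i] by simp
  have "Im S = (\<Sum>i<m - 1. arctan (Im z / Re (w i)))"
    by (simp add: S_def ImLn)
  also have "\<dots> \<le> (\<Sum>i<m - 1. arctan (im_cut / (real i + 3 / 2)))"
  proof (intro sum_mono)
    fix i
    have "Im z / Re (w i) \<le> im_cut / (real i + 3 / 2)"
      using ylt y wre[of i] by (intro frac_le) auto
    then show "arctan (Im z / Re (w i)) \<le> arctan (im_cut / (real i + 3 / 2))"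
      by (simp add: arctan_le_iff)
  qed
  also have "\<dots> \<le> (\<Sum>i<25. arctan (im_cut / (real i + 3 / 2)))"
    using m by (intro sum_mono2) (auto simp: im_cut_def zero_le_arctan_iff)
  also have "\<dots> < 2 * pi" by (rule angle_check)
  finally have upper: "Im S < 2 * pi" .
  have lower: "0 < Im S"
    unfolding S_def Im_sum ImLn using m y wpos
    by (intro sum_pos) (auto simp: lessThan_empty_iff zero_less_arctan_iff)
  have "exp (Re S) * cos (Im S) = fact m" "exp (Re S) * sin (Im S) = 0"
    using expS by (simp_all add: Re_exp[symmetric] Im_exp[symmetric] del: Re_exp Im_exp)
  then have s: "sin (Im S) = 0" and c: "exp (Re S) * cos (Im S) > 0" by simp_all
  then have "cos (Im S) > 0" by (simp add: zero_less_mult_iff)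
  moreover have "(cos (Im S))\<^sup>2 = 1" using s sin_cos_squared_add[of "Im S"] by simp
  ultimately have "cos (Im S) = 1" by (simp add: power2_eq_1_iff)
  then have "sin (Im S / 2) = 0"
    using cos_double_sin[of "Im S / 2"] by simp
  moreover have "0 < sin (Im S / 2)" using lower upper by (intro sin_gt_zero) auto
  ultimately show ?thesis by simp
qed

lemma indicial_root_real_part:
  fixes z :: complex
  assumes m: "2 \<le> m" "m \<le> 26" and z: "(\<Prod>i<m - 1. z + of_nat (i + 1)) = fact m"
    and re: "1 / 2 \<le> Re z"
  shows "z = 1"
proof (cases "0 \<le> Im z")
  case True
  with assms show ?thesis by (intro indicial_root_real_part_aux)
next
  case False
  have "cnj (\<Prod>i<m - 1. z + of_nat (i + 1)) = fact m" unfolding z by simp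
  then have "(\<Prod>i<m - 1. cnj z + of_nat (i + 1)) = fact m" by simp
  then have "cnj z = 1" using m re False by (intro indicial_root_real_part_aux) auto
  then show ?thesis by (simp add: complex_eq_iff)
qed

section \<open>Steady state and left eigenvectors\<close>

lemma sum_unit_fun_mult:
  fixes U :: "nat \<Rightarrow> complex"
  assumes "j \<le> m"
  shows "(\<Sum>r\<le>m. of_real (unit_fun j r) * U r) = U j"
proof -
  have "(\<Sum>r\<le>m. of_real (unit_fun j r) * U r) = (\<Sum>r\<le>m. if r = j then U j else 0)"
    by (intro sum.cong) (auto simp: unit_fun_def)
  then show ?thesis using assms by simp
qed

text \<open>
  A functional applied to the columns of increments.
\<close>

lemma sum_jump_mult:
  fixes U :: "nat \<Rightarrow> complex"
  assumes "3 \<le> m" "i < m"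
  shows "(\<Sum>r\<le>m. of_real (jump m i r) * U r) =
    (if i + 1 < m then U (i + 1) - U i else U 1 + U m + of_nat (m - 1) * U 0 - U (m - 1))"
proof (cases "i + 1 < m")
  case True
  then show ?thesis
    by (simp add: jump_def left_diff_distrib sum_subtractf sum_unit_fun_mult)
next
  case False
  then have "i + 1 = m" using assms by simp
  then have "jump m i = (\<lambda>r. unit_fun 1 r + unit_fun m r + real (m - 1) * unit_fun 0 r - unit_fun (m - 1) r)"
    by (simp add: jump_def)
  then have "(\<Sum>r\<le>m. of_real (jump m i r) * U r)
      = (\<Sum>r\<le>m. of_real (unit_fun 1 r) * U r) + (\<Sum>r\<le>m. of_real (unit_fun m r) * U r)
        + of_nat (m - 1) * (\<Sum>r\<le>m. of_real (unit_fun 0 r) * U r) - (\<Sum>r\<le>m. of_real (unit_fun (m - 1) r) * U r)"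
    by (simp add: distrib_right left_diff_distrib sum_subtractf sum.distrib sum_distrib_left mult.assoc)
  also have "\<dots> = U 1 + U m + of_nat (m - 1) * U 0 - U (m - 1)"
    using assms by (simp add: sum_unit_fun_mult)
  finally show ?thesis using False by simp
qed

text \<open>
  The right eigenvector for eigenvalue 1, normalised to total activity 1. Its entries for leaves are
  proportional to \<open>1 / (i (i + 1))\<close> in the one-based numbering; its last entry is the constant \<open>\<mu>\<close>.
\<close>

definition steady :: "nat \<Rightarrow> nat \<Rightarrow> real" where
  "steady m r = 1 / (harm m - 1) *
     (if r = 0 then (real m - 1) / (2 * (real m + 1))
      else if r < m then 1 / ((real r + 1) * (real r + 2))
      else if r = m then 1 / (real m + 1) else 0)"

lemma harm_gt_1: "2 \<le> m \<Longrightarrow> 1 < (harm m :: real)"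
proof -
  assume "2 \<le> m"
  have "(harm 1 :: real) < harm m"
    unfolding harm_def using \<open>2 \<le> m\<close> by (intro sum_strict_mono2[where b = 2]) auto
  then show ?thesis by (simp add: harm_def)
qed

lemma steady_nonneg: "3 \<le> m \<Longrightarrow> 0 \<le> steady m r"
  using harm_gt_1[of m] by (auto simp: steady_def)

lemma sum_jump_weighted:
  fixes q :: "nat \<Rightarrow> real"
  assumes m: "3 \<le> m" and r: "r \<le> m"
  shows "(\<Sum>i<m. q i * jump m i r) =
    (if r = 0 then real (m - 1) * q (m - 1) - q 0
     else if r = 1 then q 0 - q 1 + q (m - 1)
     else if r < m then q (r - 1) - q r else q (m - 1))"
proof -
  have m1: "{..<m} = insert (m - 1) {..<m - 1}" using m by auto
  have "(\<Sum>i<m - 1. q i * jump m i r) = (\<Sum>i<m - 1. q i * unit_fun (i + 1) r) - (\<Sum>i<m - 1. q i * unit_fun i r)"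
    unfolding sum_subtractf[symmetric] by (intro sum.cong) (auto simp: jump_def right_diff_distrib)
  also have "(\<Sum>i<m - 1. q i * unit_fun i r) = (\<Sum>i<m - 1. if i = r then q r else 0)"
    by (intro sum.cong) (auto simp: unit_fun_def)
  also have "\<dots> = (if r < m - 1 then q r else 0)" by simp
  also have "(\<Sum>i<m - 1. q i * unit_fun (i + 1) r) = (if 1 \<le> r \<and> r < m then q (r - 1) else 0)"
  proof (cases r)
    case 0
    then show ?thesis by (simp add: unit_fun_def)
  next
    case (Suc s)
    have "(\<Sum>i<m - 1. q i * unit_fun (i + 1) r) = (\<Sum>i<m - 1. if i = s then q s else 0)"
      using Suc by (intro sum.cong) (auto simp: unit_fun_def)
    also have "\<dots> = (if s < m - 1 then q s else 0)" by simp
    also have "\<dots> = (if 1 \<le> r \<and> r < m then q (r - 1) else 0)" using Suc by auto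
    finally show ?thesis .
  qed
  finally have low: "(\<Sum>i<m - 1. q i * jump m i r)
      = (if 1 \<le> r \<and> r < m then q (r - 1) else 0) - (if r < m - 1 then q r else 0)" .
  have "jump m (m - 1) r = unit_fun 1 r + unit_fun m r + real (m - 1) * unit_fun 0 r - unit_fun (m - 1) r"
    using m by (simp add: jump_def)
  then have E: "(\<Sum>i<m. q i * jump m i r) = q (m - 1) * (unit_fun 1 r + unit_fun m r + real (m - 1) * unit_fun 0 r - unit_fun (m - 1) r)
      + ((if 1 \<le> r \<and> r < m then q (r - 1) else 0) - (if r < m - 1 then q r else 0))"
    unfolding m1 using low by simp
  have ne: "m - 1 \<noteq> 0" "m - 1 \<noteq> 1" "m - 1 \<noteq> m" "1 < m - 1" "m \<noteq> 0" "m \<noteq> 1" using m by auto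
  consider "r = 0" | "r = 1" | "2 \<le> r" "r < m - 1" | "r = m - 1" | "r = m" using m r by linarith
  then show ?thesis
  proof cases
    case 1
    then show ?thesis unfolding E unit_fun_def using ne by simp
  next
    case 2
    then show ?thesis unfolding E unit_fun_def using ne by simp
  next
    case 3
    then have "r \<noteq> 0" "r \<noteq> 1" "r < m" "r \<noteq> m" "r \<noteq> m - 1" "1 \<le> r" by auto
    then show ?thesis unfolding E unit_fun_def using 3 by simp
  next
    case 4
    then have "r \<noteq> 0" "r \<noteq> 1" "r < m" "r \<noteq> m" "1 \<le> r" "\<not> r < m - 1" using ne by auto
    then show ?thesis unfolding E unit_fun_def using 4 by simp
  next
    case 5
    then have "r \<noteq> 0" "r \<noteq> 1" "\<not> r < m" "r \<noteq> m - 1" "\<not> r < m - 1" using ne by auto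
    then show ?thesis unfolding E unit_fun_def using 5 by simp
  qed
qed

lemma steady_fractions:
  fixes d h :: real
  assumes "d \<noteq> 0"
  shows "(d - 2) * (1 / d) - (d - 2) / (2 * d) = (d - 2) / (2 * d)"
    and "(d - 2) / (2 * d) - 1 / 3 + 1 / d = 1 / 6"
    and "(d - 2) / (2 * d) + (h + 1 / d - 3 / 2) = h - 1"
  using assms by (simp_all add: field_simps)

lemma steady_middle:
  assumes "1 \<le> i" "i < m"
  shows "real (i + 1) * steady m i = 1 / (harm m - 1) * (1 / (real i + 2))"
proof -
  have s: "steady m i = 1 / (harm m - 1) * (1 / ((real i + 1) * (real i + 2)))"
    using assms by (simp add: steady_def)
  have "real (i + 1) * (K * (1 / ((real i + 1) * (real i + 2)))) = K * (1 / (real i + 2))" for K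
  proof -
    have "real (i + 1) * (1 / ((real i + 1) * (real i + 2))) = 1 / (real i + 2)" by (simp add: divide_simps)
    then show ?thesis by (metis mult.left_commute)
  qed
  then show ?thesis unfolding s .
qed

lemma steady_eigen:
  assumes m: "3 \<le> m" and r: "r \<le> m"
  shows "(\<Sum>i<m. real (i + 1) * steady m i * jump m i r) = steady m r"
proof -
  define c where "c = 1 / (harm m - 1 :: real)"
  define M where "M = real m"
  have M: "3 \<le> M" using m by (simp add: M_def)
  define q where "q i = real (i + 1) * steady m i" for i
  have q0: "q 0 = c * ((M - 1) / (2 * (M + 1)))" by (simp add: q_def steady_def c_def M_def)
  have q: "q i = c * (1 / (real i + 2))" if "1 \<le> i" "i < m" for i
    using steady_middle[OF that] by (simp only: q_def c_def)
  have qm: "q (m - 1) = c * (1 / (M + 1))"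
  proof -
    have "real (m - 1) + 2 = M + 1" using m by (simp add: M_def)
    then show ?thesis using q[of "m - 1"] m by simp
  qed
  have q1: "q 1 = c * (1 / 3)" using q[of 1] m by simp
  have M1: "real (m - 1) = M - 1" using m by (simp add: M_def)
  have "(\<Sum>i<m. q i * jump m i r) = steady m r"
  proof -
    consider "r = 0" | "r = 1" | "2 \<le> r" "r < m" | "r = m" using r by linarith
    then show ?thesis
    proof cases
      case 1
      have "real (m - 1) * q (m - 1) - q 0 = c * ((M - 1) * (1 / (M + 1)) - (M - 1) / (2 * (M + 1)))"
        unfolding q0 qm M1 by (simp only: right_diff_distrib mult.left_commute)
      also have "(M - 1) * (1 / (M + 1)) - (M - 1) / (2 * (M + 1)) = (M - 1) / (2 * (M + 1))"
        using M steady_fractions(1)[of "M + 1"] by simp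
      finally show ?thesis using 1 m by (simp add: sum_jump_weighted steady_def c_def M_def)
    next
      case 2
      have "q 0 - q 1 + q (m - 1) = c * ((M - 1) / (2 * (M + 1)) - 1 / 3 + 1 / (M + 1))"
        unfolding q0 qm q1 by (simp only: right_diff_distrib distrib_left)
      also have "(M - 1) / (2 * (M + 1)) - 1 / 3 + 1 / (M + 1) = 1 / 6"
        using M steady_fractions(2)[of "M + 1"] by simp
      finally show ?thesis using 2 m by (simp add: sum_jump_weighted steady_def c_def)
    next
      case 3
      have "q (r - 1) - q r = c * (1 / (real r + 1) - 1 / (real r + 2))"
      proof -
        have "real (r - 1) + 2 = real r + 1" using 3 by (simp add: of_nat_diff)
        then show ?thesis using q[of "r - 1"] q[of r] 3 by (simp add: right_diff_distrib)
      qed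
      also have "1 / (real r + 1) - 1 / (real r + 2) = 1 / ((real r + 1) * (real r + 2))"
        by (simp add: field_simps)
      finally show ?thesis using 3 m by (simp add: sum_jump_weighted steady_def c_def)
    next
      case 4
      then show ?thesis using qm m by (simp add: sum_jump_weighted steady_def c_def M_def)
    qed
  qed
  then show ?thesis by (simp only: q_def)
qed

text \<open>
  The partial sums telescope into harmonic numbers.
\<close>

lemma steady_activity:
  assumes m: "3 \<le> m"
  shows "(\<Sum>i<m. real (i + 1) * steady m i) = 1"
proof -
  define c where "c = 1 / (harm m - 1 :: real)"
  have part: "(\<Sum>i<k. real (i + 1) * steady m i) = c * ((real m - 1) / (2 * (real m + 1)) + (harm (k + 1) - 3 / 2))"
    if "1 \<le> k" "k \<le> m" for k
    using that
  proof (induction k rule: dec_induct)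
    case base
    have h2: "harm (1 + 1) = (3 / 2 :: real)" by (simp add: harm_def)
    show ?case unfolding h2 by (simp add: steady_def c_def)
  next
    case (step k)
    have "real (k + 1) * steady m k = c * (1 / (real k + 2))"
      using step steady_middle[of k m] by (simp only: c_def)
    moreover have "harm (Suc k + 1) = harm (k + 1) + 1 / (real k + 2)"
      by (simp add: harm_Suc field_simps)
    ultimately show ?case using step by (simp add: algebra_simps)
  qed
  have "(\<Sum>i<m. real (i + 1) * steady m i) = c * ((real m - 1) / (2 * (real m + 1)) + (harm (m + 1) - 3 / 2))"
    using part[of m] m by simp
  also have "harm (m + 1) = harm m + 1 / (real m + 1)" by (simp add: harm_Suc field_simps)
  also have "(real m - 1) / (2 * (real m + 1)) + (harm m + 1 / (real m + 1) - 3 / 2) = harm m - 1"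
    using steady_fractions(3)[of "real m + 1" "harm m"] by simp
  also have "c * (harm m - 1) = 1" using harm_gt_1[of m] m by (simp add: c_def)
  finally show ?thesis .
qed

text \<open>
  \<open>U\<close> is an eigenvector of the transpose of the urn matrix, or zero.
\<close>

definition left_eig :: "nat \<Rightarrow> complex \<Rightarrow> (nat \<Rightarrow> complex) \<Rightarrow> bool" where
  "left_eig m z U \<longleftrightarrow>
     (\<forall>i\<le>m. z * U i = of_real (act m i) * (\<Sum>r\<le>m. of_real (jump m i r) * U r))"

text \<open>
  The eigenvector equations as a two-term recursion along the leaf types, closed by one equation for
  the full leaf and one for the one-protected nodes.
\<close>

lemma left_eig_rec:
  assumes m: "3 \<le> m"
  shows "left_eig m z U \<longleftrightarrow>
    (\<forall>i. i + 1 < m \<longrightarrow> of_nat (i + 1) * U (i + 1) = (z + of_nat (i + 1)) * U i) \<and>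
    (z + of_nat m) * U (m - 1) = of_nat m * (of_nat (m - 1) * U 0 + U 1 + U m) \<and> z * U m = 0"
proof -
  have split: "(\<forall>i\<le>m. P i) \<longleftrightarrow> (\<forall>i. i + 1 < m \<longrightarrow> P i) \<and> P (m - 1) \<and> P m" for P
  proof -
    have "i \<le> m \<longleftrightarrow> i + 1 < m \<or> i = m - 1 \<or> i = m" for i using m by auto
    then show ?thesis by auto
  qed
  have "z * U i = of_real (act m i) * (\<Sum>r\<le>m. of_real (jump m i r) * U r)
      \<longleftrightarrow> of_nat (i + 1) * U (i + 1) = (z + of_nat (i + 1)) * U i" if "i + 1 < m" for i
  proof -
    have "of_real (act m i) * (\<Sum>r\<le>m. of_real (jump m i r) * U r) = of_nat (i + 1) * (U (i + 1) - U i)"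
      using that m by (simp add: sum_jump_mult act_def)
    moreover have "z * U i = of_nat (i + 1) * (U (i + 1) - U i)
        \<longleftrightarrow> of_nat (i + 1) * U (i + 1) = (z + of_nat (i + 1)) * U i"
      unfolding distrib_right right_diff_distrib by (metis add_diff_cancel_right' diff_add_cancel)
    ultimately show ?thesis by (simp only:)
  qed
  moreover have "z * U (m - 1) = of_real (act m (m - 1)) * (\<Sum>r\<le>m. of_real (jump m (m - 1) r) * U r)
      \<longleftrightarrow> (z + of_nat m) * U (m - 1) = of_nat m * (of_nat (m - 1) * U 0 + U 1 + U m)"
  proof -
    define X where "X = of_nat (m - 1) * U 0 + U 1 + U m"
    have "(\<Sum>r\<le>m. of_real (jump m (m - 1) r) * U r) = X - U (m - 1)"
      using m by (simp add: sum_jump_mult X_def)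
    moreover have "of_real (act m (m - 1)) = (of_nat m :: complex)"
      using m by (simp add: act_def of_nat_diff)
    moreover have "z * U (m - 1) = of_nat m * (X - U (m - 1)) \<longleftrightarrow> (z + of_nat m) * U (m - 1) = of_nat m * X"
      unfolding distrib_right right_diff_distrib by (metis add_diff_cancel_right' diff_add_cancel)
    ultimately show ?thesis by (simp only: X_def)
  qed
  moreover have "z * U m = of_real (act m m) * (\<Sum>r\<le>m. of_real (jump m m r) * U r) \<longleftrightarrow> z * U m = 0"
    by (simp add: act_def)
  ultimately show ?thesis unfolding left_eig_def split by blast
qed

text \<open>
  The solution \<open>binomial (z + i) i\<close> of the recursion.
\<close>

definition rising_ratio :: "complex \<Rightarrow> nat \<Rightarrow> complex" where
  "rising_ratio z i = (\<Prod>l<i. (z + of_nat (l + 1)) / of_nat (l + 1))"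

lemma rising_ratio_0 [simp]: "rising_ratio z 0 = 1"
  by (simp add: rising_ratio_def)

lemma rising_ratio_Suc: "of_nat (i + 1) * rising_ratio z (i + 1) = (z + of_nat (i + 1)) * rising_ratio z i"
  by (simp add: rising_ratio_def del: of_nat_Suc)

lemma rising_ratio_fact: "fact i * rising_ratio z i = (\<Prod>l<i. z + of_nat (l + 1))"
proof (induction i)
  case (Suc i)
  have "fact (Suc i) * rising_ratio z (Suc i) = fact i * (of_nat (i + 1) * rising_ratio z (i + 1))"
    by (simp add: mult_ac)
  also have "\<dots> = (z + of_nat (i + 1)) * (fact i * rising_ratio z i)"
    unfolding rising_ratio_Suc by (simp only: mult_ac)
  finally show ?case using Suc by (simp add: mult_ac)
qed simp

lemma left_eig_shape:
  assumes m: "3 \<le> m" and e: "left_eig m z U" and i: "i < m"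
  shows "U i = U 0 * rising_ratio z i"
  using i
proof (induction i)
  case (Suc i)
  have "of_nat (i + 1) * U (i + 1) = (z + of_nat (i + 1)) * U i"
    using e Suc.prems unfolding left_eig_rec[OF m] by simp
  also have "\<dots> = U 0 * ((z + of_nat (i + 1)) * rising_ratio z i)" using Suc by simp
  also have "\<dots> = of_nat (i + 1) * (U 0 * rising_ratio z (i + 1))"
    unfolding rising_ratio_Suc[symmetric] by (simp only: mult_ac)
  finally show ?case by (simp del: of_nat_Suc)
qed simp

lemma rising_ratio_last:
  assumes m: "3 \<le> m"
  shows "rising_ratio z (m - 1) = of_nat m \<longleftrightarrow> (\<Prod>i<m - 1. z + of_nat (i + 1)) = fact m"
proof -
  have "(fact m :: complex) = fact (m - 1) * of_nat m"
    using m by (simp add: fact_reduce mult.commute)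
  then show ?thesis unfolding rising_ratio_fact[symmetric] by simp
qed

text \<open>
  The recursion determines \<open>U\<close> from \<open>U 0\<close>; the closing equation becomes a factor \<open>z + m\<close> times the
  indicial equation.
\<close>

lemma left_eig_values:
  assumes m: "3 \<le> m" and e: "left_eig m z U" and z: "z \<noteq> 0" and U: "\<exists>r\<le>m. U r \<noteq> 0"
  shows "U m = 0" "U 0 \<noteq> 0" "z = - of_nat m \<or> (\<Prod>i<m - 1. z + of_nat (i + 1)) = fact m"
proof -
  note rec = e[unfolded left_eig_rec[OF m]]
  show Um: "U m = 0" using rec z by simp
  show U0: "U 0 \<noteq> 0"
  proof
    assume "U 0 = 0"
    then have "U r = 0" if "r \<le> m" for r
      using left_eig_shape[OF m e, of r] Um that by (cases "r = m") auto
    then show False using U by auto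
  qed
  have "U 1 = U 0 * rising_ratio z 1" using m by (intro left_eig_shape[OF m e]) simp
  also have "rising_ratio z 1 = z + 1" by (simp add: rising_ratio_def)
  finally have "(z + of_nat m) * (U 0 * rising_ratio z (m - 1)) = of_nat m * (of_nat (m - 1) * U 0 + U 0 * (z + 1))"
    using rec left_eig_shape[OF m e, of "m - 1"] m Um by simp
  also have "of_nat (m - 1) * U 0 + U 0 * (z + 1) = U 0 * (z + of_nat m)"
    using m by (simp add: of_nat_diff algebra_simps)
  finally have "U 0 * ((z + of_nat m) * (rising_ratio z (m - 1) - of_nat m)) = 0"
    by (simp add: algebra_simps)
  then have "z + of_nat m = 0 \<or> rising_ratio z (m - 1) = of_nat m" using U0 by simp
  then show "z = - of_nat m \<or> (\<Prod>i<m - 1. z + of_nat (i + 1)) = fact m"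
    unfolding rising_ratio_last[OF m] by (auto simp: eq_neg_iff_add_eq_0)
qed

lemma left_eig_rising_ratio:
  assumes m: "3 \<le> m" and z: "z = - of_nat m \<or> (\<Prod>i<m - 1. z + of_nat (i + 1)) = fact m"
  shows "left_eig m z (\<lambda>i. if i < m then rising_ratio z i else 0)"
  unfolding left_eig_rec[OF m]
proof (intro conjI allI impI)
  fix i assume "i + 1 < m"
  then show "of_nat (i + 1) * (if i + 1 < m then rising_ratio z (i + 1) else 0)
      = (z + of_nat (i + 1)) * (if i < m then rising_ratio z i else 0)"
    using rising_ratio_Suc[of i z] by simp
next
  have "rising_ratio z 1 = z + 1" by (simp add: rising_ratio_def)
  then have "of_nat (m - 1) * 1 + rising_ratio z 1 = z + of_nat m" using m by (simp add: of_nat_diff)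
  moreover have "(z + of_nat m) * rising_ratio z (m - 1) = of_nat m * (z + of_nat m)"
    using z unfolding rising_ratio_last[OF m, symmetric] by (auto simp: mult.commute)
  ultimately have "(z + of_nat m) * rising_ratio z (m - 1) = of_nat m * (of_nat (m - 1) * 1 + rising_ratio z 1)"
    by (simp only:)
  then show "(z + of_nat m) * (if m - 1 < m then rising_ratio z (m - 1) else 0)
     = of_nat m * (of_nat (m - 1) * (if 0 < m then rising_ratio z 0 else 0)
        + (if 1 < m then rising_ratio z 1 else 0) + (if m < m then rising_ratio z m else 0))"
    using m by simp
qed simp

lemma left_eig_zero:
  assumes m: "3 \<le> m"
  shows "left_eig m 0 (\<lambda>i. if i < m then 1 else - of_nat (m - 1))"
  unfolding left_eig_rec[OF m] using m by (auto simp: of_nat_diff)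

section \<open>Spectral decomposition of the variance\<close>

lemma sum_swap3:
  "(\<Sum>i\<in>A. \<Sum>j\<in>B. \<Sum>l\<in>C. f i j l) = (\<Sum>j\<in>B. \<Sum>l\<in>C. \<Sum>i\<in>A. f i j l)"
proof -
  have "(\<Sum>i\<in>A. \<Sum>j\<in>B. \<Sum>l\<in>C. f i j l) = (\<Sum>j\<in>B. \<Sum>i\<in>A. \<Sum>l\<in>C. f i j l)" by (rule sum.swap)
  also have "\<dots> = (\<Sum>j\<in>B. \<Sum>l\<in>C. \<Sum>i\<in>A. f i j l)" by (intro sum.cong refl sum.swap)
  finally show ?thesis .
qed

text \<open>
  A left inverse of a square matrix is a right inverse.
\<close>

lemma biorthogonal_resolution:
  fixes U V :: "nat \<Rightarrow> nat \<Rightarrow> complex"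
  assumes biorth: "\<And>i j. i \<le> m \<Longrightarrow> j \<le> m \<Longrightarrow> (\<Sum>r\<le>m. U i r * V j r) = (if i = j then 1 else 0)"
    and "r \<le> m" "s \<le> m"
  shows "(\<Sum>j\<le>m. U j r * V j s) = (if r = s then 1 else 0)"
proof -
  let ?n = "Suc m"
  define P where "P = Matrix.mat ?n ?n (\<lambda>(j, r). U j r)"
  define Q where "Q = Matrix.mat ?n ?n (\<lambda>(r, j). V j r)"
  have P: "P \<in> carrier_mat ?n ?n" and Q: "Q \<in> carrier_mat ?n ?n" by (simp_all add: P_def Q_def)
  have "P * Q = 1\<^sub>m ?n"
  proof (rule eq_matI)
    fix i j assume "i < dim_row (1\<^sub>m ?n :: complex Matrix.mat)" "j < dim_col (1\<^sub>m ?n :: complex Matrix.mat)"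
    then have ij: "i < ?n" "j < ?n" by simp_all
    then have "(P * Q) $$ (i, j) = (\<Sum>r = 0..<?n. U i r * V j r)"
      by (simp add: P_def Q_def scalar_prod_def)
    also have "\<dots> = (\<Sum>r\<le>m. U i r * V j r)" by (simp only: atLeast0LessThan lessThan_Suc_atMost)
    also have "\<dots> = (1\<^sub>m ?n :: complex Matrix.mat) $$ (i, j)" using ij biorth[of i j] by simp
    finally show "(P * Q) $$ (i, j) = (1\<^sub>m ?n :: complex Matrix.mat) $$ (i, j)" .
  qed (simp_all add: P_def Q_def)
  then have "Q * P = 1\<^sub>m ?n" by (rule mat_mult_left_right_inverse[OF P Q])
  then have "(Q * P) $$ (s, r) = (1\<^sub>m ?n :: complex Matrix.mat) $$ (s, r)" by simp
  moreover have "(Q * P) $$ (s, r) = (\<Sum>j = 0..<?n. V j s * U j r)"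
    using assms by (simp add: P_def Q_def scalar_prod_def)
  ultimately show ?thesis
    using assms by (simp add: atLeast0LessThan lessThan_Suc_atMost mult.commute eq_commute)
qed

text \<open>
  Dual bases of eigenvectors with all entries written out as functions on \<open>{..m}\<close>.
\<close>

locale eigensystem =
  fixes m :: nat and lam :: "nat \<Rightarrow> complex" and U V :: "nat \<Rightarrow> nat \<Rightarrow> complex"
  assumes m: "3 \<le> m" "m \<le> 26"
    and left: "\<And>j. j \<le> m \<Longrightarrow> left_eig m (lam j) (U j)"
    and right: "\<And>j r. j \<le> m \<Longrightarrow> r \<le> m \<Longrightarrow>
      (\<Sum>i\<le>m. of_real (act m i * jump m i r) * V j i) = lam j * V j r"
    and biorth: "\<And>i j. i \<le> m \<Longrightarrow> j \<le> m \<Longrightarrow> (\<Sum>r\<le>m. U i r * V j r) = (if i = j then 1 else 0)"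
    and lam0: "lam 0 = 1"
    and activity_V0: "(\<Sum>i\<le>m. of_real (act m i) * V 0 i) = 1"
begin

lemmas resolution = biorthogonal_resolution[OF biorth]

lemma U_nonzero: "j \<le> m \<Longrightarrow> \<exists>r\<le>m. U j r \<noteq> 0"
proof (rule ccontr)
  assume j: "j \<le> m" and "\<not> (\<exists>r\<le>m. U j r \<noteq> 0)"
  then have "(\<Sum>r\<le>m. U j r * V j r) = 0" by (intro sum.neutral) auto
  then show False using biorth[OF j j] by simp
qed

text \<open>
  The left eigenspace of 1 is a line, and a second vector in it could not be orthogonal to \<open>V 0\<close>.
\<close>

lemma lam_not_1:
  assumes j: "1 \<le> j" "j \<le> m"
  shows "lam j \<noteq> 1"
proof
  assume l: "lam j = 1"
  have m3: "3 \<le> m" using m by simp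
  have ej: "left_eig m 1 (U j)" using left[of j] j l by simp
  have e0: "left_eig m 1 (U 0)" using left[of 0] lam0 by simp
  have z0: "U 0 0 \<noteq> 0" "U 0 m = 0"
    using left_eig_values[OF m3 e0] U_nonzero[of 0] by auto
  have zj: "U j m = 0" "U j 0 \<noteq> 0" using left_eig_values[OF m3 ej] U_nonzero[of j] j by auto
  define c where "c = U j 0 / U 0 0"
  have c: "U j r = c * U 0 r" if "r \<le> m" for r
  proof (cases "r = m")
    case False
    then show ?thesis
      using left_eig_shape[OF m3 ej, of r] left_eig_shape[OF m3 e0, of r] that z0 by (simp add: c_def)
  qed (use z0 zj in simp)
  have "(\<Sum>r\<le>m. U j r * V 0 r) = (\<Sum>r\<le>m. c * (U 0 r * V 0 r))"
    by (intro sum.cong refl) (simp only: c atMost_iff mult.assoc)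
  also have "\<dots> = c * (\<Sum>r\<le>m. U 0 r * V 0 r)" by (simp only: sum_distrib_left)
  finally have "c = 0" using biorth[of j 0] biorth[of 0 0] j by simp
  then show False using zj z0 by (simp add: c_def)
qed

lemma Re_lam_less_half: "1 \<le> j \<Longrightarrow> j \<le> m \<Longrightarrow> Re (lam j) < 1 / 2"
proof (rule ccontr)
  assume j: "1 \<le> j" "j \<le> m" and "\<not> Re (lam j) < 1 / 2"
  then have re: "1 / 2 \<le> Re (lam j)" by simp
  then have "lam j \<noteq> 0" "lam j \<noteq> - of_nat m" by auto
  then have "(\<Prod>i<m - 1. lam j + of_nat (i + 1)) = fact m"
    using left_eig_values(3)[OF _ left[OF j(2)] _ U_nonzero[OF j(2)]] m by simp
  then have "lam j = 1" using m re by (intro indicial_root_real_part) auto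
  then show False using lam_not_1[OF j] by simp
qed

lemma left_pairing:
  assumes j: "j \<le> m"
  shows "(\<Sum>i\<le>m. of_real (act m i) * (\<Sum>r\<le>m. of_real (jump m i r) * U j r) * y i) = lam j * (\<Sum>i\<le>m. U j i * y i)"
proof -
  have "of_real (act m i) * (\<Sum>r\<le>m. of_real (jump m i r) * U j r) = lam j * U j i" if "i \<le> m" for i
    using left[OF j] that unfolding left_eig_def by simp
  then show ?thesis by (simp add: sum_distrib_left mult.assoc)
qed

text \<open>
  In the expansion of \<open>steady m\<close> all coefficients belonging to eigenvalues other than 1 vanish, and
  both vectors have activity 1.
\<close>

lemma V0_steady: "r \<le> m \<Longrightarrow> V 0 r = of_real (steady m r)"
proof -
  assume r: "r \<le> m"
  have m3: "3 \<le> m" using m by simp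
  define b where "b j = (\<Sum>i\<le>m. U j i * of_real (steady m i))" for j
  have A: "(\<Sum>i\<le>m. of_real (act m i * jump m i s) * of_real (steady m i)) = complex_of_real (steady m s)" if "s \<le> m" for s
  proof -
    have "(\<Sum>i\<le>m. act m i * (jump m i s * steady m i)) = steady m s"
      using steady_eigen[OF m3 that] by (simp only: sum_act) (simp add: mult_ac)
    then show ?thesis by (simp add: mult.assoc flip: of_real_mult of_real_sum)
  qed
  have "lam j * b j = b j" if "j \<le> m" for j
  proof -
    have "lam j * b j = (\<Sum>i\<le>m. of_real (act m i) * (\<Sum>s\<le>m. of_real (jump m i s) * U j s) * of_real (steady m i))"
      unfolding b_def left_pairing[OF that] ..
    also have "\<dots> = (\<Sum>i\<le>m. \<Sum>s\<le>m. U j s * (of_real (act m i * jump m i s) * of_real (steady m i)))"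
      by (simp add: sum_distrib_left sum_distrib_right mult_ac)
    also have "\<dots> = (\<Sum>s\<le>m. U j s * (\<Sum>i\<le>m. of_real (act m i * jump m i s) * of_real (steady m i)))"
      by (subst sum.swap) (simp add: sum_distrib_left)
    also have "\<dots> = b j" using A by (simp add: b_def)
    finally show ?thesis .
  qed
  then have b0: "b j = 0" if "1 \<le> j" "j \<le> m" for j
    using lam_not_1[OF that] that by (metis mult_cancel_right1)
  have exp: "of_real (steady m s) = b 0 * V 0 s" if "s \<le> m" for s
  proof -
    have "(\<Sum>j\<le>m. b j * V j s) = (\<Sum>i\<le>m. of_real (steady m i) * (\<Sum>j\<le>m. U j i * V j s))"
      unfolding b_def sum_distrib_right sum_distrib_left by (subst sum.swap) (simp add: mult_ac)
    also have "\<dots> = (\<Sum>i\<le>m. if i = s then of_real (steady m s) else 0)"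
      using resolution that by (intro sum.cong) auto
    also have "\<dots> = of_real (steady m s)" using that by simp
    finally have "of_real (steady m s) = (\<Sum>j\<le>m. b j * V j s)" by simp
    also have "\<dots> = (\<Sum>j\<le>m. if j = 0 then b 0 * V 0 s else 0)"
      using b0 by (intro sum.cong) auto
    finally show ?thesis by simp
  qed
  have "(\<Sum>i\<le>m. act m i * steady m i) = 1"
    using steady_activity[OF m3] by (simp only: sum_act)
  then have "1 = (\<Sum>i\<le>m. of_real (act m i) * complex_of_real (steady m i))"
    by (simp flip: of_real_mult of_real_sum)
  also have "\<dots> = b 0 * (\<Sum>i\<le>m. of_real (act m i) * V 0 i)"
    using exp by (simp add: sum_distrib_left mult_ac)
  finally have "b 0 = 1" using activity_V0 by simp
  then show ?thesis using exp[OF r] by simp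
qed

text \<open>
  Each draw increases the total activity by 1, so the activity vector is a left eigenvector for 1 and
  annihilates all right eigenvectors for other eigenvalues.
\<close>

lemma activity_V:
  assumes j: "1 \<le> j" "j \<le> m"
  shows "(\<Sum>r\<le>m. of_real (act m r) * V j r) = 0"
proof -
  have m3: "3 \<le> m" using m by simp
  have one: "of_real (act m i) * (\<Sum>r\<le>m. of_real (jump m i r) * of_real (act m r)) = complex_of_real (act m i)" if "i \<le> m" for i
  proof (cases "i < m")
    case True
    have "(\<Sum>r\<le>m. of_real (jump m i r) * complex_of_real (act m r)) = 1"
    proof (cases "i + 1 < m")
      case True
      then show ?thesis using sum_jump_mult[OF m3 \<open>i < m\<close>, of "\<lambda>r. of_real (act m r)"] by (simp add: act_def)
    next
      case False
      then show ?thesis using sum_jump_mult[OF m3 \<open>i < m\<close>, of "\<lambda>r. of_real (act m r)"] m3 by (simp add: act_def of_nat_diff)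
    qed
    then show ?thesis by simp
  qed (use that in \<open>simp add: act_def\<close>)
  have "lam j * (\<Sum>r\<le>m. of_real (act m r) * V j r)
      = (\<Sum>r\<le>m. of_real (act m r) * (\<Sum>i\<le>m. of_real (act m i * jump m i r) * V j i))"
    using right[OF j(2)] by (simp add: sum_distrib_left mult_ac)
  also have "\<dots> = (\<Sum>r\<le>m. \<Sum>i\<le>m. of_real (act m i) * (of_real (jump m i r) * of_real (act m r)) * V j i)"
    by (simp add: sum_distrib_left mult_ac)
  also have "\<dots> = (\<Sum>i\<le>m. of_real (act m i) * (\<Sum>r\<le>m. of_real (jump m i r) * of_real (act m r)) * V j i)"
    by (subst sum.swap) (simp add: sum_distrib_left sum_distrib_right mult_ac)
  also have "\<dots> = (\<Sum>i\<le>m. of_real (act m i) * V j i)"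
    by (intro sum.cong refl) (simp only: one atMost_iff)
  finally show ?thesis using lam_not_1[OF j] by simp
qed

definition coef :: "(nat \<Rightarrow> real) \<Rightarrow> nat \<Rightarrow> complex" where
  "coef w j = (\<Sum>r\<le>m. of_real (w r) * V j r)"

lemma coef_0: "coef w 0 = of_real (dotp m w (steady m))"
  by (simp add: coef_def V0_steady dotp_def)

lemma left_expansion:
  assumes w: "dotp m w (steady m) = 0" and r: "r \<le> m"
  shows "of_real (w r) = (\<Sum>j=1..m. coef w j * U j r)"
proof -
  have "(\<Sum>j\<le>m. coef w j * U j r) = (\<Sum>s\<le>m. of_real (w s) * (\<Sum>j\<le>m. U j r * V j s))"
    unfolding coef_def sum_distrib_right sum_distrib_left by (subst sum.swap) (simp add: mult_ac)
  also have "\<dots> = (\<Sum>s\<le>m. if s = r then of_real (w r) else 0)"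
    using resolution r by (intro sum.cong) auto
  also have "\<dots> = of_real (w r)" using r by simp
  finally have "of_real (w r) = (\<Sum>j\<le>m. coef w j * U j r)" by simp
  also have "{..m} = insert 0 {1..m}" by auto
  finally show ?thesis using coef_0[of w] w by simp
qed

text \<open>
  The component along \<open>U j\<close> is multiplied by \<open>1 + lam j / l\<close> in each step.
\<close>

lemma pullback_expansion:
  assumes w: "dotp m w (steady m) = 0" and k: "k \<le> n" and r: "r \<le> m"
  shows "of_real (pullback m w n k r) = (\<Sum>j=1..m. coef w j * gain n k (lam j) * U j r)"
  using k r
proof (induction "n - k" arbitrary: k r)
  case 0
  then show ?case using left_expansion[OF w] by simp
next
  case (Suc d)
  then have kn: "k < n" by simp
  have IH: "of_real (pullback m w n (Suc k) s) = (\<Sum>j=1..m. coef w j * gain n (Suc k) (lam j) * U j s)" if "s \<le> m" for s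
    using Suc.hyps(1)[of "Suc k" s] Suc.hyps(2) kn that by simp
  have dot: "of_real (dotp m (pullback m w n (Suc k)) (jump m r))
      = (\<Sum>j=1..m. coef w j * gain n (Suc k) (lam j) * (\<Sum>s\<le>m. of_real (jump m r s) * U j s))"
  proof -
    have "of_real (dotp m (pullback m w n (Suc k)) (jump m r))
        = (\<Sum>s\<le>m. (\<Sum>j=1..m. coef w j * gain n (Suc k) (lam j) * U j s) * of_real (jump m r s))"
      using IH by (simp add: dotp_def)
    also have "\<dots> = (\<Sum>j=1..m. coef w j * gain n (Suc k) (lam j) * (\<Sum>s\<le>m. of_real (jump m r s) * U j s))"
      unfolding sum_distrib_left sum_distrib_right by (subst sum.swap) (simp add: mult_ac)
    finally show ?thesis .
  qed
  have "of_real (pullback m w n k r) = complex_of_real (pullback m w n (Suc k) r)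
      + of_real (act m r) * of_real (dotp m (pullback m w n (Suc k)) (jump m r)) / of_nat (Suc k)"
    using pullback_step[OF kn] by (simp add: pull_def del: of_nat_Suc)
  also have "\<dots> = (\<Sum>j=1..m. coef w j * gain n (Suc k) (lam j) * U j r)
      + (\<Sum>j=1..m. coef w j * gain n (Suc k) (lam j) * (of_real (act m r) * (\<Sum>s\<le>m. of_real (jump m r s) * U j s)) / of_nat (Suc k))"
    unfolding dot IH[OF Suc.prems(2)] by (simp add: sum_distrib_left sum_divide_distrib mult_ac del: of_nat_Suc)
  also have "\<dots> = (\<Sum>j=1..m. coef w j * gain n (Suc k) (lam j) * U j r
      + coef w j * gain n (Suc k) (lam j) * (lam j * U j r) / of_nat (Suc k))"
    unfolding sum.distrib[symmetric]
    using left Suc.prems(2) by (intro sum.cong) (auto simp: left_eig_def simp del: of_nat_Suc)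
  also have "\<dots> = (\<Sum>j=1..m. coef w j * gain n k (lam j) * U j r)"
    unfolding gain_Suc_left[OF kn] by (intro sum.cong) (simp_all add: algebra_simps del: of_nat_Suc)
  finally show ?case .
qed

definition spectral_bound :: real where
  "spectral_bound = Max (insert 0 ((\<lambda>j. Re (lam j)) ` {1..m}))"

lemma spectral_bound: "0 \<le> spectral_bound" "spectral_bound < 1 / 2"
    "\<And>j. 1 \<le> j \<Longrightarrow> j \<le> m \<Longrightarrow> Re (lam j) \<le> spectral_bound"
proof -
  let ?S = "insert 0 ((\<lambda>j. Re (lam j)) ` {1..m})"
  have fin: "finite ?S" "?S \<noteq> {}" by auto
  show "0 \<le> spectral_bound" unfolding spectral_bound_def by (rule Max_ge) auto
  show "spectral_bound < 1 / 2"
    unfolding spectral_bound_def Max_less_iff[OF fin] using Re_lam_less_half by auto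
  show "Re (lam j) \<le> spectral_bound" if "1 \<le> j" "j \<le> m" for j
    unfolding spectral_bound_def by (rule Max_ge) (use that in auto)
qed

lemma pullback_growth:
  assumes w: "dotp m w (steady m) = 0"
  shows "\<exists>C\<ge>0. \<forall>n k r. 0 < n \<longrightarrow> k \<le> n \<longrightarrow> r \<le> m \<longrightarrow>
    \<bar>pullback m w n k r\<bar> \<le> C * (real n / real (k + 1)) powr spectral_bound"
proof -
  have "\<exists>C\<ge>0. \<forall>n k. 0 < n \<longrightarrow> k \<le> n \<longrightarrow> cmod (gain n k (lam j)) \<le> C * (real n / real (k + 1)) powr spectral_bound"
    if "j \<in> {1..m}" for j
  proof -
    have "Re (lam j) \<le> spectral_bound" "0 \<le> spectral_bound" "spectral_bound \<le> 1"
      using spectral_bound(1,2) spectral_bound(3)[of j] that by auto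
    then obtain C where "0 \<le> C" "\<And>n k. 0 < n \<Longrightarrow> k \<le> n \<Longrightarrow> cmod (gain n k (lam j)) \<le> C * (real n / real (k + 1)) powr spectral_bound"
      using gain_bound[of "lam j" spectral_bound] by blast
    then show ?thesis by blast
  qed
  then obtain C where C: "\<And>j. j \<in> {1..m} \<Longrightarrow> 0 \<le> C j"
    "\<And>j n k. j \<in> {1..m} \<Longrightarrow> 0 < n \<Longrightarrow> k \<le> n \<Longrightarrow> cmod (gain n k (lam j)) \<le> C j * (real n / real (k + 1)) powr spectral_bound"
    by metis
  define D where "D = (\<Sum>j=1..m. \<Sum>r\<le>m. cmod (coef w j) * C j * cmod (U j r))"
  show ?thesis
  proof (intro exI[of _ D] conjI allI impI)
    show "0 \<le> D" unfolding D_def using C(1) by (intro sum_nonneg mult_nonneg_nonneg) auto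
    fix n k r :: nat assume n: "0 < n" and k: "k \<le> n" and r: "r \<le> m"
    let ?g = "(real n / real (k + 1)) powr spectral_bound"
    have "\<bar>pullback m w n k r\<bar> = cmod (of_real (pullback m w n k r))" by simp
    also have "\<dots> \<le> (\<Sum>j=1..m. cmod (coef w j * gain n k (lam j) * U j r))"
      unfolding pullback_expansion[OF w k r] by (rule norm_sum)
    also have "\<dots> \<le> (\<Sum>j=1..m. (\<Sum>r\<le>m. cmod (coef w j) * C j * cmod (U j r)) * ?g)"
    proof (intro sum_mono)
      fix j assume j: "j \<in> {1..m}"
      have "cmod (coef w j * gain n k (lam j) * U j r) \<le> cmod (coef w j) * (C j * ?g) * cmod (U j r)"
        unfolding norm_mult using C(2)[OF j n k] by (intro mult_right_mono mult_left_mono) auto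
      also have "\<dots> = cmod (coef w j) * C j * cmod (U j r) * ?g" by (simp only: mult_ac)
      also have "\<dots> \<le> (\<Sum>r\<le>m. cmod (coef w j) * C j * cmod (U j r)) * ?g"
        using C(1)[OF j] r by (intro mult_right_mono member_le_sum[of r]) auto
      finally show "cmod (coef w j * gain n k (lam j) * U j r) \<le> (\<Sum>r\<le>m. cmod (coef w j) * C j * cmod (U j r)) * ?g" .
    qed
    also have "\<dots> = D * ?g" by (simp only: D_def sum_distrib_right)
    finally show "\<bar>pullback m w n k r\<bar> \<le> D * ?g" .
  qed
qed

sublocale small_urn m "steady m" spectral_bound
  using m spectral_bound pullback_growth steady_nonneg steady_activity steady_eigen
  by unfold_locales auto

text \<open>
  The bilinear form \<open>u\<^sub>j' B u\<^sub>k\<close>.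
\<close>

definition jump_form :: "nat \<Rightarrow> nat \<Rightarrow> complex" where
  "jump_form j k = (\<Sum>i\<le>m. of_real (act m i) * V 0 i * ((\<Sum>r\<le>m. of_real (jump m i r) * U j r) * (\<Sum>r\<le>m. of_real (jump m i r) * U k r)))"

lemma steady_var_expand:
  assumes w: "dotp m w (steady m) = 0" and k: "k \<le> n"
  shows "of_real (steady_var (pullback m w n k))
    = (\<Sum>j=1..m. \<Sum>l=1..m. coef w j * coef w l * jump_form j l * (gain n k (lam j) * gain n k (lam l)))"
proof -
  define d where "d j i = (\<Sum>r\<le>m. of_real (jump m i r) * U j r)" for j i
  have dot: "of_real (dotp m (pullback m w n k) (jump m i)) = (\<Sum>j=1..m. coef w j * gain n k (lam j) * d j i)" for i
  proof -
    have "of_real (dotp m (pullback m w n k) (jump m i))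
        = (\<Sum>s\<le>m. (\<Sum>j=1..m. coef w j * gain n k (lam j) * U j s) * of_real (jump m i s))"
      using pullback_expansion[OF w k] by (simp add: dotp_def)
    also have "\<dots> = (\<Sum>j=1..m. coef w j * gain n k (lam j) * d j i)"
      unfolding sum_distrib_left sum_distrib_right d_def by (subst sum.swap) (simp add: mult_ac)
    finally show ?thesis .
  qed
  have "steady_var (pullback m w n k) = (\<Sum>i\<le>m. act m i * (steady m i * (dotp m (pullback m w n k) (jump m i))\<^sup>2))"
    by (simp only: steady_var_def sum_act mult.assoc)
  then have "of_real (steady_var (pullback m w n k)) = (\<Sum>i\<le>m. of_real (act m i) * V 0 i * (of_real (dotp m (pullback m w n k) (jump m i)))\<^sup>2)"
    by (simp add: V0_steady mult.assoc)
  also have "\<dots> = (\<Sum>i\<le>m. \<Sum>j=1..m. \<Sum>l=1..m. of_real (act m i) * V 0 i * ((coef w j * gain n k (lam j) * d j i) * (coef w l * gain n k (lam l) * d l i)))"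
    unfolding dot power2_eq_square sum_product by (simp only: sum_distrib_left)
  also have "\<dots> = (\<Sum>j=1..m. \<Sum>l=1..m. \<Sum>i\<le>m. of_real (act m i) * V 0 i * ((coef w j * gain n k (lam j) * d j i) * (coef w l * gain n k (lam l) * d l i)))"
    by (rule sum_swap3)
  also have "\<dots> = (\<Sum>j=1..m. \<Sum>l=1..m. coef w j * coef w l * jump_form j l * (gain n k (lam j) * gain n k (lam l)))"
    unfolding jump_form_def d_def[symmetric] sum_distrib_left sum_distrib_right
    by (intro sum.cong refl) (simp only: mult_ac)
  finally show ?thesis .
qed

lemma variance_limit:
  assumes w: "dotp m w (steady m) = 0"
  shows "(\<lambda>n. of_real ((\<Sum>k<n. steady_var (pullback m w n (Suc k))) / real n))
    \<longlonglongrightarrow> (\<Sum>j=1..m. \<Sum>l=1..m. coef w j * coef w l * jump_form j l * (1 / (1 - lam j - lam l)))"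
proof -
  have "of_real ((\<Sum>k<n. steady_var (pullback m w n (Suc k))) / real n)
    = (\<Sum>j=1..m. \<Sum>l=1..m. coef w j * coef w l * jump_form j l * ((\<Sum>k<n. gain n (Suc k) (lam j) * gain n (Suc k) (lam l)) / of_nat n))" for n
  proof -
    have "of_real (\<Sum>k<n. steady_var (pullback m w n (Suc k)))
      = (\<Sum>k<n. \<Sum>j=1..m. \<Sum>l=1..m. coef w j * coef w l * jump_form j l * (gain n (Suc k) (lam j) * gain n (Suc k) (lam l)))"
      using steady_var_expand[OF w] by (simp add: Suc_le_eq)
    also have "\<dots> = (\<Sum>j=1..m. \<Sum>l=1..m. \<Sum>k<n. coef w j * coef w l * jump_form j l * (gain n (Suc k) (lam j) * gain n (Suc k) (lam l)))"
      by (rule sum_swap3)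
    finally have E: "of_real (\<Sum>k<n. steady_var (pullback m w n (Suc k)))
      = (\<Sum>j=1..m. \<Sum>l=1..m. \<Sum>k<n. coef w j * coef w l * jump_form j l * (gain n (Suc k) (lam j) * gain n (Suc k) (lam l)))" .
    show ?thesis
      unfolding of_real_divide E of_real_of_nat_eq
      by (simp only: sum_divide_distrib sum_distrib_left times_divide_eq_right)
  qed
  moreover have "(\<lambda>n. \<Sum>j=1..m. \<Sum>l=1..m. coef w j * coef w l * jump_form j l * ((\<Sum>k<n. gain n (Suc k) (lam j) * gain n (Suc k) (lam l)) / of_nat n))
    \<longlonglongrightarrow> (\<Sum>j=1..m. \<Sum>l=1..m. coef w j * coef w l * jump_form j l * (1 / (1 - lam j - lam l)))"
    using Re_lam_less_half by (intro tendsto_sum tendsto_mult tendsto_const gain_product_average) auto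
  ultimately show ?thesis by (simp only:)
qed

end

section \<open>Diagonalisability of the urn matrix\<close>

text \<open>
  In the induction, the new factor is at most \<open>N + 1\<close> as long as \<open>y \<le> N + 1\<close>; beyond that point all
  factors grow with \<open>y\<close>, and their values at the right end point multiply to the factorial.
\<close>

lemma prod_abs_diff_le_fact:
  fixes y :: real
  assumes "0 \<le> y" "y \<le> real N + 1"
  shows "(\<Prod>i<N. \<bar>real (i + 1) - y\<bar>) \<le> fact N"
  using assms
proof (induction N)
  case (Suc N)
  show ?case
  proof (cases "y \<le> real N + 1")
    case True
    have "(\<Prod>i<Suc N. \<bar>real (i + 1) - y\<bar>) = (\<Prod>i<N. \<bar>real (i + 1) - y\<bar>) * \<bar>real (N + 1) - y\<bar>" by simp
    also have "\<dots> \<le> fact N * real (N + 1)"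
      using Suc True by (intro mult_mono prod_nonneg) auto
    finally show ?thesis by (simp add: mult.commute)
  next
    case False
    have "(\<Prod>i<Suc N. \<bar>real (i + 1) - y\<bar>) \<le> (\<Prod>i<Suc N. real (Suc N - i))"
      using Suc.prems False by (intro prod_mono) (auto simp: of_nat_diff abs_if)
    also have "\<dots> = (\<Prod>i<Suc N. real (Suc i))"
      by (rule prod.reindex_bij_witness[of _ "\<lambda>i. N - i" "\<lambda>i. N - i"]) auto
    also have "\<dots> = fact (Suc N)"
      by (simp only: fact_prod_Suc of_nat_prod atLeast0LessThan)
    finally show ?thesis .
  qed
qed simp

definition indicial :: "nat \<Rightarrow> complex poly" where
  "indicial m = (\<Prod>i<m - 1. [:of_nat (i + 1), 1:]) - [:fact m:]"

lemma poly_indicial: "poly (indicial m) z = (\<Prod>i<m - 1. z + of_nat (i + 1)) - fact m"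
  by (simp add: indicial_def poly_prod add.commute)

text \<open>
  At a double root \<open>z\<close> the logarithmic derivative \<open>\<Sum> 1 / (z + i)\<close> of the product vanishes. Its imaginary part
  forces \<open>z\<close> to be real, and its real part forces \<open>z\<close> to lie between \<open>- m\<close> and 0, where the product
  is at most \<open>(m - 1)!\<close> in absolute value and so differs from \<open>m!\<close>.
\<close>

lemma indicial_rsquarefree:
  assumes m: "3 \<le> m"
  shows "rsquarefree (indicial m)"
  unfolding rsquarefree_roots
proof (intro allI notI)
  fix z assume "poly (indicial m) z = 0 \<and> poly (pderiv (indicial m)) z = 0"
  then have z: "(\<Prod>i<m - 1. z + of_nat (i + 1)) = fact m" and d: "poly (pderiv (indicial m)) z = 0"
    by (simp_all add: poly_indicial)
  have nz: "z + of_nat (i + 1) \<noteq> 0" if "i < m - 1" for i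
  proof
    assume "z + of_nat (i + 1) = 0"
    then have "\<exists>i\<in>{..<m - 1}. z + of_nat (i + 1) = 0" using that by blast
    then have "(\<Prod>i<m - 1. z + of_nat (i + 1)) = 0" by (rule prod_zero[OF finite_lessThan])
    then show False unfolding z by simp
  qed
  have "poly (pderiv (indicial m)) z = (\<Sum>i<m - 1. \<Prod>j\<in>{..<m - 1} - {i}. z + of_nat (j + 1))"
    by (simp add: indicial_def pderiv_diff pderiv_prod poly_sum poly_prod pderiv_pCons add.commute)
  also have "\<dots> = (\<Sum>i<m - 1. fact m * (1 / (z + of_nat (i + 1))))"
  proof (intro sum.cong refl)
    fix i assume i: "i \<in> {..<m - 1}"
    then have "(\<Prod>j<m - 1. z + of_nat (j + 1)) = (z + of_nat (i + 1)) * (\<Prod>j\<in>{..<m - 1} - {i}. z + of_nat (j + 1))"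
      by (intro prod.remove) auto
    then show "(\<Prod>j\<in>{..<m - 1} - {i}. z + of_nat (j + 1)) = fact m * (1 / (z + of_nat (i + 1)))"
      using z nz[of i] i by (simp add: field_simps del: of_nat_Suc)
  qed
  also have "\<dots> = fact m * (\<Sum>i<m - 1. 1 / (z + of_nat (i + 1)))" by (simp only: sum_distrib_left)
  finally have S: "(\<Sum>i<m - 1. 1 / (z + of_nat (i + 1))) = 0" using d by simp
  have ne: "{..<m - 1} \<noteq> {}" using m by (auto simp: lessThan_empty_iff)
  have inv_im: "Im (1 / (z + of_nat (i + 1))) = - Im z / (cmod (z + of_nat (i + 1)))\<^sup>2"
    and inv_re: "Re (1 / (z + of_nat (i + 1))) = (Re z + real (i + 1)) / (cmod (z + of_nat (i + 1)))\<^sup>2" for i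
    by (simp_all add: Im_divide Re_divide cmod_power2)
  have "Im z = 0"
  proof (rule ccontr)
    assume im: "Im z \<noteq> 0"
    define X where "X = (\<Sum>i<m - 1. 1 / (cmod (z + of_nat (i + 1)))\<^sup>2)"
    have "0 < X" unfolding X_def
      using nz ne by (intro sum_pos) (auto simp del: of_nat_Suc)
    moreover have "Im (\<Sum>i<m - 1. 1 / (z + of_nat (i + 1))) = - Im z * X"
      unfolding Im_sum inv_im sum_distrib_left X_def by simp
    then have "- Im z * X = 0" unfolding S by simp
    ultimately show False using im by simp
  qed
  then have zr: "z = of_real (Re z)" by (simp add: complex_eq_iff)
  have Sre: "(\<Sum>i<m - 1. (Re z + real (i + 1)) / (cmod (z + of_nat (i + 1)))\<^sup>2) = 0"
    using arg_cong[OF S, of Re] unfolding Re_sum inv_re by simp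
  have "Re z < 0"
  proof (rule ccontr)
    assume "\<not> Re z < 0"
    then have "(\<Sum>i<m - 1. (Re z + real (i + 1)) / (cmod (z + of_nat (i + 1)))\<^sup>2) > 0"
      using nz ne by (intro sum_pos divide_pos_pos) (auto simp del: of_nat_Suc)
    then show False using Sre by simp
  qed
  moreover have "- real m < Re z"
  proof (rule ccontr)
    assume neg: "\<not> - real m < Re z"
    have "(\<Sum>i<m - 1. - ((Re z + real (i + 1)) / (cmod (z + of_nat (i + 1)))\<^sup>2)) > 0"
    proof (intro sum_pos ne)
      fix i assume i: "i \<in> {..<m - 1}"
      then have "Re z + real (i + 1) < 0" using neg by auto
      moreover have "0 < (cmod (z + of_nat (i + 1)))\<^sup>2" using nz i by (auto simp del: of_nat_Suc)
      ultimately show "0 < - ((Re z + real (i + 1)) / (cmod (z + of_nat (i + 1)))\<^sup>2)"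
        by (simp only: neg_0_less_iff_less divide_neg_pos)
    qed simp
    then show False using Sre by (simp add: sum_negf)
  qed
  ultimately have "(\<Prod>i<m - 1. \<bar>real (i + 1) - - Re z\<bar>) \<le> fact (m - 1)"
    using m by (intro prod_abs_diff_le_fact) auto
  moreover have "(\<Prod>i<m - 1. \<bar>real (i + 1) - - Re z\<bar>) = cmod (\<Prod>i<m - 1. z + of_nat (i + 1))"
  proof -
    have "cmod (z + of_nat (i + 1)) = \<bar>real (i + 1) - - Re z\<bar>" for i
    proof -
      have "z + of_nat (i + 1) = of_real (real (i + 1) - - Re z)" using zr by (simp add: complex_eq_iff)
      then show ?thesis by (simp only: norm_of_real)
    qed
    then show ?thesis by (simp only: prod_norm[symmetric])
  qed
  ultimately have "fact m \<le> (fact (m - 1) :: real)" unfolding z by simp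
  moreover have "(fact m :: real) = real m * fact (m - 1)" using m by (simp add: fact_reduce)
  moreover have "(1 :: real) * fact (m - 1) < real m * fact (m - 1)" using m by (intro mult_strict_right_mono) auto
  ultimately show False by simp
qed

lemma indicial_degree: "3 \<le> m \<Longrightarrow> degree (indicial m) = m - 1"
proof -
  assume m: "3 \<le> m"
  have d: "degree (\<Prod>i<m - 1. [:of_nat (i + 1), 1 :: complex:]) = m - 1"
    by (subst degree_prod_sum_eq) auto
  then show ?thesis unfolding indicial_def diff_conv_add_uminus using m
    by (subst degree_add_eq_left) auto
qed

lemma card_indicial_roots:
  assumes m: "3 \<le> m"
  shows "finite {z. poly (indicial m) z = 0}" "card {z. poly (indicial m) z = 0} = m - 1"
proof -
  have nz: "indicial m \<noteq> 0" using indicial_degree[OF m] m by auto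
  show "finite {z. poly (indicial m) z = 0}" by (rule poly_roots_finite[OF nz])
  have "degree (indicial m) = degree (Polynomial.smult (lead_coeff (indicial m)) (\<Prod>z|poly (indicial m) z = 0. [:-z, 1:]))"
    by (rule arg_cong[OF complex_poly_decompose_rsquarefree[OF indicial_rsquarefree[OF m], symmetric]])
  also have "\<dots> = degree (\<Prod>z|poly (indicial m) z = 0. [:-z, 1:])" using nz by simp
  also have "\<dots> = card {z. poly (indicial m) z = 0}" by (subst degree_prod_sum_eq) auto
  finally show "card {z. poly (indicial m) z = 0} = m - 1" by (simp only: indicial_degree[OF m])
qed

text \<open>
  For \<open>z = 0\<close> the last coordinate is free and is needed to satisfy the closing equation.
\<close>

definition left_vec :: "nat \<Rightarrow> complex \<Rightarrow> nat \<Rightarrow> complex" where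
  "left_vec m z = (if z = 0 then (\<lambda>i. if i < m then 1 else - of_nat (m - 1))
     else (\<lambda>i. if i < m then rising_ratio z i else 0))"

definition spectrum_set :: "nat \<Rightarrow> complex set" where
  "spectrum_set m = insert 0 (insert (- of_nat m) {z. poly (indicial m) z = 0})"

lemma left_vec_eig: "3 \<le> m \<Longrightarrow> z \<in> spectrum_set m \<Longrightarrow> left_eig m z (left_vec m z)"
  using left_eig_zero[of m] left_eig_rising_ratio[of m z]
  by (auto simp: left_vec_def spectrum_set_def poly_indicial)

lemma left_vec_0: "3 \<le> m \<Longrightarrow> left_vec m z 0 = 1"
  by (simp add: left_vec_def)

text \<open>
  The product takes the values \<open>(m - 1)!\<close> at 0 and \<open>\<plusminus> (m - 1)!\<close> at \<open>- m\<close>, so neither is a root.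
\<close>

lemma card_spectrum_set:
  assumes m: "3 \<le> m"
  shows "finite (spectrum_set m)" "card (spectrum_set m) = m + 1" "1 \<in> spectrum_set m"
proof -
  have fm: "(fact m :: complex) = of_nat m * fact (m - 1)" using m by (simp add: fact_reduce)
  have r0: "poly (indicial m) 0 \<noteq> 0"
  proof -
    have "(\<Prod>i<m - 1. 0 + of_nat (i + 1)) = (fact (m - 1) :: complex)"
      using rising_ratio_fact[of "m - 1" 0] by (simp add: rising_ratio_def del: of_nat_Suc)
    then show ?thesis using m unfolding poly_indicial fm by simp
  qed
  have rm: "poly (indicial m) (- of_nat m) \<noteq> 0"
  proof
    assume "poly (indicial m) (- of_nat m) = 0"
    then have "(\<Prod>i<m - 1. - of_nat m + of_nat (i + 1)) = (fact m :: complex)" by (simp add: poly_indicial)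
    then have "cmod (\<Prod>i<m - 1. - of_nat m + of_nat (i + 1)) = cmod (fact m)" by (rule arg_cong)
    then have n: "(\<Prod>i<m - 1. cmod (- of_nat m + of_nat (i + 1))) = fact m" by (simp add: prod_norm[symmetric])
    have "cmod (- of_nat m + of_nat (i + 1)) = \<bar>real (i + 1) - real m\<bar>" for i
    proof -
      have "- of_nat m + of_nat (i + 1) = complex_of_real (real (i + 1) - real m)" by simp
      then show ?thesis by (simp only: norm_of_real)
    qed
    with n have "(\<Prod>i<m - 1. \<bar>real (i + 1) - real m\<bar>) = fact m" by (simp only:)
    moreover have "(\<Prod>i<m - 1. \<bar>real (i + 1) - real m\<bar>) \<le> fact (m - 1)"
      using m by (intro prod_abs_diff_le_fact) auto
    moreover have "(fact m :: real) = real m * fact (m - 1)" using m by (simp add: fact_reduce)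
    moreover have "(1 :: real) * fact (m - 1) < real m * fact (m - 1)" using m by (intro mult_strict_right_mono) auto
    ultimately show False by simp
  qed
  show "finite (spectrum_set m)" using card_indicial_roots(1)[OF m] by (simp add: spectrum_set_def)
  have "(0 :: complex) \<noteq> - of_nat m" using m by simp
  then show "card (spectrum_set m) = m + 1"
    using card_indicial_roots[OF m] r0 rm m by (simp add: spectrum_set_def)
  have "(\<Prod>i<m - 1. real i + 2) = fact m" using fact_as_prod[of "m - 1"] m by simp
  then have "complex_of_real (\<Prod>i<m - 1. real i + 2) = of_real (fact m)" by simp
  then have "(\<Prod>i<m - 1. 1 + of_nat (i + 1)) = (fact m :: complex)" by (simp add: add.commute)
  then show "1 \<in> spectrum_set m" by (simp add: spectrum_set_def poly_indicial)
qed

text \<open>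
  Applying the product of the operators minus \<open>lam l\<close> for all \<open>l \<noteq> k\<close> to a linear dependence kills all
  terms except the one with index \<open>k\<close>.
\<close>

lemma distinct_left_vectors_independent:
  assumes m: "3 \<le> m"
    and eig: "\<And>j. j \<le> m \<Longrightarrow> left_eig m (lam j) (U j)" and inj: "inj_on lam {..m}"
    and U0: "\<And>j. j \<le> m \<Longrightarrow> U j 0 = 1"
    and dep: "\<And>r. r \<le> m \<Longrightarrow> (\<Sum>j\<le>m. y j * U j r) = 0" and k: "k \<le> m"
  shows "y k = 0"
proof -
  \<comment> \<open>Removing the eigenvalues in \<open>T\<close> one after the other.\<close>
  have filter: "(\<Sum>j\<le>m. y j * (\<Prod>l\<in>T. lam j - lam l) * U j r) = 0" if "finite T" "r \<le> m" for T r
    using that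
  proof (induction T arbitrary: r rule: finite_induct)
    case empty
    then show ?case using dep by simp
  next
    case (insert t T)
    define g where "g j = y j * (\<Prod>l\<in>T. lam j - lam l)" for j
    have z: "(\<Sum>j\<le>m. g j * U j s) = 0" if "s \<le> m" for s using insert.IH[OF that] by (simp add: g_def)
    have "(\<Sum>j\<le>m. g j * (lam j * U j r)) = (\<Sum>j\<le>m. g j * (of_real (act m r) * (\<Sum>s\<le>m. of_real (jump m r s) * U j s)))"
      using eig insert.prems by (intro sum.cong) (auto simp: left_eig_def)
    also have "\<dots> = of_real (act m r) * (\<Sum>s\<le>m. of_real (jump m r s) * (\<Sum>j\<le>m. g j * U j s))"
      unfolding sum_distrib_left by (subst sum.swap) (simp add: mult_ac)
    also have "\<dots> = 0" using z by simp
    finally have "(\<Sum>j\<le>m. g j * (lam j * U j r)) = 0" .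
    then have "(\<Sum>j\<le>m. g j * (lam j * U j r)) - lam t * (\<Sum>j\<le>m. g j * U j r) = 0"
      using z[OF insert.prems] by simp
    also have "(\<Sum>j\<le>m. g j * (lam j * U j r)) - lam t * (\<Sum>j\<le>m. g j * U j r)
        = (\<Sum>j\<le>m. y j * (\<Prod>l\<in>insert t T. lam j - lam l) * U j r)"
      unfolding sum_distrib_left sum_subtractf[symmetric]
      using insert.hyps by (intro sum.cong) (simp_all add: g_def algebra_simps)
    finally show ?case .
  qed
  have "(\<Sum>j\<le>m. y j * (\<Prod>l\<in>{..m} - {k}. lam j - lam l) * U j 0) = 0" by (rule filter) auto
  also have "(\<Sum>j\<le>m. y j * (\<Prod>l\<in>{..m} - {k}. lam j - lam l) * U j 0)
      = (\<Sum>j\<le>m. if j = k then y k * (\<Prod>l\<in>{..m} - {k}. lam k - lam l) else 0)"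
  proof (intro sum.cong refl)
    fix j assume j: "j \<in> {..m}"
    show "y j * (\<Prod>l\<in>{..m} - {k}. lam j - lam l) * U j 0
        = (if j = k then y k * (\<Prod>l\<in>{..m} - {k}. lam k - lam l) else 0)"
    proof (cases "j = k")
      case False
      then have "(\<Prod>l\<in>{..m} - {k}. lam j - lam l) = 0" using j by (intro prod_zero) auto
      then show ?thesis using False by simp
    qed (use U0 k in simp)
  qed
  also have "\<dots> = y k * (\<Prod>l\<in>{..m} - {k}. lam k - lam l)" using k by simp
  finally have "y k * (\<Prod>l\<in>{..m} - {k}. lam k - lam l) = 0" .
  moreover have "(\<Prod>l\<in>{..m} - {k}. lam k - lam l) \<noteq> 0"
    using inj k by (auto simp: inj_on_def)
  ultimately show ?thesis by simp
qed

text \<open>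
  Left eigenvectors for \<open>m + 1\<close> distinct eigenvalues form an invertible matrix, and the columns of the
  inverse are the dual right eigenvectors. The left eigenvector for 1 is the activity vector, which
  yields the normalisation.
\<close>

lemma eigensystem_exists:
  assumes m: "3 \<le> m" "m \<le> 26"
  shows "\<exists>lam U V. eigensystem m lam U V"
proof -
  have "card (spectrum_set m - {1}) = m" "finite (spectrum_set m - {1})"
    using card_spectrum_set[OF m(1)] by auto
  then obtain g where g: "bij_betw g {1..m} (spectrum_set m - {1})"
    using ex_bij_betw_nat_finite_1[of "spectrum_set m - {1}"] by auto
  define lam where "lam j = (if j = 0 then 1 else g j)" for j
  have gm: "g j \<in> spectrum_set m - {1}" if "1 \<le> j" "j \<le> m" for j
    using bij_betwE[OF g] that by auto
  have lam_mem: "lam j \<in> spectrum_set m" if "j \<le> m" for j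
    using gm[of j] card_spectrum_set(3)[OF m(1)] that by (auto simp: lam_def)
  have inj: "inj_on lam {..m}"
  proof (rule inj_onI)
    fix i j assume ij: "i \<in> {..m}" "j \<in> {..m}" "lam i = lam j"
    show "i = j"
    proof (cases "i = 0 \<or> j = 0")
      case True
      then show ?thesis using ij gm[of i] gm[of j] by (auto simp: lam_def split: if_splits)
    next
      case False
      then have "g i = g j" "i \<in> {1..m}" "j \<in> {1..m}" using ij by (auto simp: lam_def)
      then show ?thesis by (rule inj_onD[OF bij_betw_imp_inj_on[OF g]])
    qed
  qed
  define U where "U j = left_vec m (lam j)" for j
  have U_first: "U j 0 = 1" for j unfolding U_def by (rule left_vec_0[OF m(1)])
  have eig: "left_eig m (lam j) (U j)" if "j \<le> m" for j
    unfolding U_def by (rule left_vec_eig[OF m(1) lam_mem[OF that]])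
  let ?n = "Suc m"
  define P where "P = Matrix.mat ?n ?n (\<lambda>(j, r). U j r)"
  have P: "P \<in> carrier_mat ?n ?n" by (simp add: P_def)
  have "det P \<noteq> 0"
  proof
    assume "det P = 0"
    then have "det (transpose_mat P) = 0" using det_transpose[OF P] by simp
    then obtain y where y: "y \<in> carrier_vec ?n" "y \<noteq> 0\<^sub>v ?n" "transpose_mat P *\<^sub>v y = 0\<^sub>v ?n"
      using det_0_iff_vec_prod_zero[of "transpose_mat P" ?n] P by auto
    have dep: "(\<Sum>j\<le>m. y $ j * U j r) = 0" if r: "r \<le> m" for r
    proof -
      have "(transpose_mat P *\<^sub>v y) $ r = (\<Sum>j = 0..<?n. U j r * y $ j)"
        using r y(1) by (simp add: P_def scalar_prod_def)
      also have "\<dots> = (\<Sum>j\<le>m. y $ j * U j r)"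
        by (simp only: atLeast0LessThan lessThan_Suc_atMost mult.commute)
      finally show ?thesis using y(3) r by simp
    qed
    have "y $ k = 0" if "k \<le> m" for k
      by (rule distinct_left_vectors_independent[OF m(1) eig inj U_first dep that])
    then have "y = 0\<^sub>v ?n" using y(1) by (intro eq_vecI) auto
    then show False using y(2) by simp
  qed
  then obtain Q where Q: "Q \<in> carrier_mat ?n ?n" "P * Q = 1\<^sub>m ?n"
    using det_non_zero_imp_unit[OF P, of "()"] by (auto simp: Units_def ring_mat_def)
  define V where "V j r = Q $$ (r, j)" for j r
  have bi: "(\<Sum>r\<le>m. U i r * V j r) = (if i = j then 1 else 0)" if "i \<le> m" "j \<le> m" for i j
  proof -
    have "(P * Q) $$ (i, j) = (\<Sum>r = 0..<?n. U i r * V j r)"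
      using that P Q(1) by (simp add: P_def V_def scalar_prod_def)
    then show ?thesis using Q(2) that by (simp add: atLeast0LessThan lessThan_Suc_atMost)
  qed
  note res = biorthogonal_resolution[of m U V, OF bi]
  have right: "(\<Sum>i\<le>m. of_real (act m i * jump m i r) * V j i) = lam j * V j r" if j: "j \<le> m" and r: "r \<le> m" for j r
  proof -
    define x where "x s = (\<Sum>i\<le>m. of_real (act m i * jump m i s) * V j i)" for s
    have Ux: "(\<Sum>s\<le>m. U k s * x s) = lam k * (if k = j then 1 else 0)" if k: "k \<le> m" for k
    proof -
      have "(\<Sum>s\<le>m. U k s * x s) = (\<Sum>i\<le>m. of_real (act m i) * (\<Sum>s\<le>m. of_real (jump m i s) * U k s) * V j i)"
        unfolding x_def sum_distrib_left sum_distrib_right by (subst sum.swap) (simp add: mult_ac)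
      also have "\<dots> = (\<Sum>i\<le>m. lam k * U k i * V j i)"
        using eig[OF k] by (intro sum.cong) (auto simp: left_eig_def)
      also have "\<dots> = lam k * (\<Sum>i\<le>m. U k i * V j i)" by (simp add: sum_distrib_left mult.assoc)
      finally show ?thesis using bi[OF k j] by simp
    qed
    have "x r = (\<Sum>s\<le>m. x s * (\<Sum>k\<le>m. U k s * V k r))"
    proof -
      have "(\<Sum>s\<le>m. x s * (\<Sum>k\<le>m. U k s * V k r)) = (\<Sum>s\<le>m. if s = r then x r else 0)"
        using res r by (intro sum.cong) auto
      then show ?thesis using r by simp
    qed
    also have "\<dots> = (\<Sum>k\<le>m. (\<Sum>s\<le>m. U k s * x s) * V k r)"
      unfolding sum_distrib_left sum_distrib_right by (subst sum.swap) (simp add: mult_ac)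
    also have "\<dots> = (\<Sum>k\<le>m. if k = j then lam j * V j r else 0)"
      using Ux by (intro sum.cong) auto
    also have "\<dots> = lam j * V j r" using j by simp
    finally show ?thesis by (simp only: x_def)
  qed
  have U0: "U 0 r = of_real (act m r)" if "r \<le> m" for r
  proof (cases "r < m")
    case True
    have "rising_ratio 1 i = of_nat (i + 1)" for i
    proof (induction i)
      case (Suc i)
      have "of_nat (i + 1) * rising_ratio 1 (i + 1) = (1 + of_nat (i + 1)) * of_nat (i + 1)"
        unfolding rising_ratio_Suc Suc ..
      then have "of_nat (i + 1) * (rising_ratio 1 (i + 1) - of_nat (i + 2)) = 0"
        by (simp add: algebra_simps)
      then show ?case by (simp del: of_nat_Suc add: add.commute)
    qed simp
    then show ?thesis using True by (simp add: U_def lam_def left_vec_def act_def)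
  qed (simp add: U_def lam_def left_vec_def act_def)
  have "(\<Sum>i\<le>m. of_real (act m i) * V 0 i) = (\<Sum>i\<le>m. U 0 i * V 0 i)" using U0 by simp
  also have "\<dots> = 1" using bi[of 0 0] by simp
  finally have "eigensystem m lam U V"
    using m eig right bi by unfold_locales (auto simp: lam_def)
  then show ?thesis by blast
qed

section \<open>One-protected nodes\<close>

lemma increment_eq_jump:
  assumes m: "3 \<le> m" and r: "r \<le> m"
  shows "increment m i $ r = of_real (jump m i r)"
  using assms by (auto simp: increment_def jump_def unit_fun_def Let_def of_nat_diff)

lemma activity_eq_act: "i \<le> m \<Longrightarrow> activity m $ i = of_real (act m i)"
  by (simp add: activity_def act_def)

lemma dual_eigenbases_eigensystem:
  assumes m: "3 \<le> m" "m \<le> 26" and d: "dual_eigenbases m lam u v"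
  shows "eigensystem m lam (\<lambda>j r. u j $ r) (\<lambda>j r. v j $ r)"
proof -
  have dimA: "dim_row (urn_A m) = Suc m" "dim_col (urn_A m) = Suc m" by (simp_all add: urn_A_def)
  have u: "u j \<in> carrier_vec (Suc m)" "transpose_mat (urn_A m) *\<^sub>v u j = lam j \<cdot>\<^sub>v u j" if "j \<le> m" for j
    using d that unfolding dual_eigenbases_def eigenvector_def by (auto simp: dimA)
  have v: "v j \<in> carrier_vec (Suc m)" "urn_A m *\<^sub>v v j = lam j \<cdot>\<^sub>v v j" if "j \<le> m" for j
    using d that unfolding dual_eigenbases_def eigenvector_def by (auto simp: dimA)
  show ?thesis
  proof
    show "3 \<le> m" "m \<le> 26" by (rule m)+
    show "left_eig m (lam j) (\<lambda>r. u j $ r)" if j: "j \<le> m" for j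
      unfolding left_eig_def
    proof (intro allI impI)
      fix i assume i: "i \<le> m"
      have "lam j * u j $ i = (transpose_mat (urn_A m) *\<^sub>v u j) $ i"
        using u[OF j] i by simp
      also have "\<dots> = (\<Sum>r = 0..<Suc m. urn_A m $$ (r, i) * u j $ r)"
        using u(1)[OF j] i dimA by (simp add: scalar_prod_def)
      also have "\<dots> = (\<Sum>r\<le>m. (of_real (act m i) * of_real (jump m i r)) * u j $ r)"
        unfolding atLeast0LessThan lessThan_Suc_atMost
        using i increment_eq_jump[OF m(1)] activity_eq_act[of i m]
        by (intro sum.cong) (auto simp: urn_A_def)
      finally show "lam j * u j $ i = of_real (act m i) * (\<Sum>r\<le>m. of_real (jump m i r) * u j $ r)"
        by (simp add: sum_distrib_left mult.assoc)
    qed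
    show "(\<Sum>i\<le>m. of_real (act m i * jump m i r) * v j $ i) = lam j * v j $ r" if j: "j \<le> m" and r: "r \<le> m" for j r
    proof -
      have "lam j * v j $ r = (urn_A m *\<^sub>v v j) $ r"
        using v[OF j] r by simp
      also have "\<dots> = (\<Sum>i = 0..<Suc m. urn_A m $$ (r, i) * v j $ i)"
        using v(1)[OF j] r dimA by (simp add: scalar_prod_def)
      also have "\<dots> = (\<Sum>i\<le>m. of_real (act m i * jump m i r) * v j $ i)"
        unfolding atLeast0LessThan lessThan_Suc_atMost
        using r increment_eq_jump[OF m(1) r] activity_eq_act[of _ m]
        by (intro sum.cong) (auto simp: urn_A_def)
      finally show ?thesis ..
    qed
    show "(\<Sum>r\<le>m. u i $ r * v j $ r) = (if i = j then 1 else 0)" if "i \<le> m" "j \<le> m" for i j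
    proof -
      have "u i \<bullet> v j = (\<Sum>r\<le>m. u i $ r * v j $ r)"
        using v(1)[OF that(2)] by (simp add: scalar_prod_def atLeast0LessThan lessThan_Suc_atMost)
      then show ?thesis using d that unfolding dual_eigenbases_def by metis
    qed
    show "lam 0 = 1" using d by (simp add: dual_eigenbases_def)
    have "activity m \<bullet> v 0 = (\<Sum>i\<le>m. of_real (act m i) * v 0 $ i)"
      using v(1)[of 0] activity_eq_act[of _ m]
      by (simp add: scalar_prod_def atLeast0LessThan lessThan_Suc_atMost)
    then show "(\<Sum>i\<le>m. of_real (act m i) * v 0 $ i) = 1"
      using d by (simp add: dual_eigenbases_def)
  qed
qed

text \<open>
  The coefficient of \<open>w\<close> along \<open>u\<^sub>j\<close> is \<open>w \<cdot> v\<^sub>j\<close>, and the activity vector contributes nothing to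
  it, so it is the last coordinate of \<open>v\<^sub>j\<close>.
\<close>

lemma urn_Sigma_eq:
  assumes m: "3 \<le> m" "m \<le> 26" and d: "dual_eigenbases m lam u v"
  defines "w \<equiv> \<lambda>r. unit_fun m r - steady m m * act m r"
  defines "U \<equiv> \<lambda>j r. u j $ r" and "V \<equiv> \<lambda>j r. v j $ r"
  shows "urn_Sigma m lam u v $$ (m, m) = (\<Sum>j=1..m. \<Sum>l=1..m.
     eigensystem.coef m V w j * eigensystem.coef m V w l * eigensystem.jump_form m U V j l * (1 / (1 - lam j - lam l)))"
proof -
  interpret eigensystem m lam U V unfolding U_def V_def by (rule dual_eigenbases_eigensystem[OF m d])
  have dimv: "u j \<in> carrier_vec (Suc m)" if "j \<le> m" for j
    using d that unfolding dual_eigenbases_def eigenvector_def by (auto simp: urn_A_def)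
  have coef: "coef w j = v j $ m" if j: "j \<in> {1..m}" for j
  proof -
    have "coef w j = (\<Sum>r\<le>m. of_real (unit_fun m r) * V j r) - of_real (steady m m) * (\<Sum>r\<le>m. of_real (act m r) * V j r)"
      by (simp add: coef_def w_def left_diff_distrib sum_subtractf sum_distrib_left mult.assoc)
    then show ?thesis using activity_V[of j] j by (simp add: sum_unit_fun_mult V_def)
  qed
  have form_eq: "u j \<bullet> (urn_B m (v 0) *\<^sub>v u l) = jump_form j l" if j: "j \<le> m" and l: "l \<le> m" for j l
  proof -
    have B: "urn_B m (v 0) $$ (r, s) = (\<Sum>i\<le>m. of_real (act m i) * V 0 i * (of_real (jump m i r) * of_real (jump m i s)))"
      if "r \<le> m" "s \<le> m" for r s
      using that increment_eq_jump[OF m(1)] activity_eq_act[of _ m]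
      by (simp add: urn_B_def V_def mult_ac)
    have "u j \<bullet> (urn_B m (v 0) *\<^sub>v u l) = (\<Sum>r\<le>m. U j r * (\<Sum>s\<le>m. urn_B m (v 0) $$ (r, s) * U l s))"
      using dimv[OF l] unfolding scalar_prod_def
      by (intro sum.cong) (auto simp: urn_B_def scalar_prod_def U_def atLeast0LessThan lessThan_Suc_atMost)
    also have "\<dots> = (\<Sum>r\<le>m. \<Sum>s\<le>m. \<Sum>i\<le>m. of_real (act m i) * V 0 i * ((of_real (jump m i r) * U j r) * (of_real (jump m i s) * U l s)))"
      unfolding sum_distrib_left
      by (intro sum.cong refl) (simp add: B sum_distrib_left sum_distrib_right mult_ac)
    also have "\<dots> = (\<Sum>i\<le>m. \<Sum>r\<le>m. \<Sum>s\<le>m. of_real (act m i) * V 0 i * ((of_real (jump m i r) * U j r) * (of_real (jump m i s) * U l s)))"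
      by (rule sum_swap3[symmetric])
    also have "\<dots> = jump_form j l"
      unfolding jump_form_def sum_product by (simp only: sum_distrib_left)
    finally show ?thesis .
  qed
  have "urn_Sigma m lam u v $$ (m, m) = (\<Sum>j = 1..m. \<Sum>k = 1..m.
       (u j \<bullet> (urn_B m (v 0) *\<^sub>v u k)) / (lam 0 - lam j - lam k) * (v j $ m * v k $ m))"
    by (simp add: urn_Sigma_def)
  also have "\<dots> = (\<Sum>j=1..m. \<Sum>l=1..m. coef w j * coef w l * jump_form j l * (1 / (1 - lam j - lam l)))"
  proof (intro sum.cong refl)
    fix j l assume jl: "j \<in> {1..m}" "l \<in> {1..m}"
    then have "u j \<bullet> (urn_B m (v 0) *\<^sub>v u l) = jump_form j l" by (intro form_eq) auto
    then show "(u j \<bullet> (urn_B m (v 0) *\<^sub>v u l)) / (lam 0 - lam j - lam l) * (v j $ m * v l $ m)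
        = coef w j * coef w l * jump_form j l * (1 / (1 - lam j - lam l))"
      unfolding coef[OF jl(1)] coef[OF jl(2)] lam0 by (simp add: mult_ac)
  qed
  finally show ?thesis .
qed

lemma char_normal_law:
  assumes "0 \<le> \<sigma>2"
  shows "char (normal_law 0 \<sigma>2) t = of_real (exp (- (\<sigma>2 * t\<^sup>2 / 2)))"
proof -
  have "char (normal_law 0 \<sigma>2) t = char std_normal_distribution (sqrt \<sigma>2 * t)"
    unfolding char_def normal_law_def
    by (subst integral_distr) (auto intro!: Bochner_Integration.integral_cong simp: mult_ac)
  also have "\<dots> = of_real (exp (- (\<sigma>2 * t\<^sup>2 / 2)))"
  proof -
    have "(sqrt \<sigma>2 * t)\<^sup>2 = \<sigma>2 * t\<^sup>2" using assms by (simp add: power_mult_distrib)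
    then show ?thesis by (simp only: char_std_normal_distribution minus_divide_left)
  qed
  finally show ?thesis .
qed

lemma real_distribution_normal_law: "real_distribution (normal_law 0 \<sigma>2)"
proof -
  interpret prob_space std_normal_distribution
    using prob_space_normal_density[of 1 0] by simp
  show ?thesis unfolding normal_law_def
    by (rule real_distribution_distr) simp
qed

text \<open>
  The averaged variances \<open>s n\<close> are defined without eigenvectors. One eigensystem shows that they
  converge; any other one then yields the same limit.
\<close>

lemma urn_variance_exists:
  assumes m: "3 \<le> m" "m \<le> 26"
  defines "w \<equiv> \<lambda>r. unit_fun m r - steady m m * act m r"
  obtains \<sigma>2 where "0 \<le> \<sigma>2"
    "\<And>lam u v. dual_eigenbases m lam u v \<Longrightarrow> of_real \<sigma>2 = urn_Sigma m lam u v $$ (m, m)"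
    "\<And>t. (\<lambda>n. perm_avg m n (\<lambda>x. iexp (t / sqrt (real n) * dotp m w x))) \<longlonglongrightarrow> of_real (exp (- (\<sigma>2 * t\<^sup>2 / 2)))"
proof -
  obtain lam U V where e: "eigensystem m lam U V" using eigensystem_exists[OF m] by blast
  interpret eigensystem m lam U V by (rule e)
  have w: "dotp m w (steady m) = 0"
    using steady_activity[OF m(1)] by (simp add: w_def dotp_diff_left dotp_unit_fun dotp_act)
  define s where "s n = (\<Sum>k<n. steady_var (pullback m w n (Suc k))) / real n" for n
  define \<Sigma> where "\<Sigma> = (\<Sum>j=1..m. \<Sum>l=1..m. coef w j * coef w l * jump_form j l * (1 / (1 - lam j - lam l)))"
  have "(\<lambda>n. complex_of_real (s n)) \<longlonglongrightarrow> \<Sigma>" unfolding s_def \<Sigma>_def by (rule variance_limit[OF w])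
  then have lim: "s \<longlonglongrightarrow> Re \<Sigma>" using tendsto_Re by fastforce
  show ?thesis
  proof (rule that[of "Re \<Sigma>"])
    have "0 \<le> s n" for n unfolding s_def using steady_var_nonneg by (intro divide_nonneg_nonneg sum_nonneg) auto
    then show "0 \<le> Re \<Sigma>" by (intro LIMSEQ_le_const[OF lim]) auto
    show "(\<lambda>n. perm_avg m n (\<lambda>x. iexp (t / sqrt (real n) * dotp m w x))) \<longlonglongrightarrow> of_real (exp (- (Re \<Sigma> * t\<^sup>2 / 2)))" for t
      by (rule urn_central_limit[OF w lim[unfolded s_def]])
    fix lam' u v assume d: "dual_eigenbases m lam' u v"
    define U' where "U' = (\<lambda>j r. u j $ r)"
    define V' where "V' = (\<lambda>j r. v j $ r)"
    interpret E: eigensystem m lam' U' V' unfolding U'_def V'_def by (rule dual_eigenbases_eigensystem[OF m d])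
    have "urn_Sigma m lam' u v $$ (m, m)
        = (\<Sum>j=1..m. \<Sum>l=1..m. E.coef w j * E.coef w l * E.jump_form j l * (1 / (1 - lam' j - lam' l)))"
      unfolding w_def U'_def V'_def by (rule urn_Sigma_eq[OF m d])
    then have "(\<lambda>n. complex_of_real (s n)) \<longlonglongrightarrow> urn_Sigma m lam' u v $$ (m, m)"
      using E.variance_limit[OF w] by (simp only: s_def)
    moreover have "(\<lambda>n. complex_of_real (s n)) \<longlonglongrightarrow> of_real (Re \<Sigma>)" using lim by (rule tendsto_of_real)
    ultimately show "of_real (Re \<Sigma>) = urn_Sigma m lam' u v $$ (m, m)" by (rule LIMSEQ_unique[rotated])
  qed
qed

context iid_uniform
begin

text \<open>
  Holds even when there are ties, as equal keys have equal ranks; so the number of one-protected nodes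
  is a measurable function on the whole space.
\<close>

lemma one_protected_rank_list:
  "one_protected (search_tree m (map (\<lambda>i. X i \<omega>) [0..<n]))
   = one_protected (search_tree m (ranks n \<omega>))"
proof -
  let ?xs = "map (\<lambda>i. X i \<omega>) [0..<n]"
  define h where "h y = card {j \<in> {..<n}. X j \<omega> < y}" for y
  have "strict_mono_on (set ?xs) h"
  proof (rule strict_mono_onI)
    fix a b assume "a \<in> set ?xs" "b \<in> set ?xs" and ab: "a < b"
    then obtain i where i: "i < n" "X i \<omega> = a" by fastforce
    have "{j \<in> {..<n}. X j \<omega> < a} \<subseteq> {j \<in> {..<n}. X j \<omega> < b}" using ab by fastforce
    moreover have "i \<in> {j \<in> {..<n}. X j \<omega> < b}" "i \<notin> {j \<in> {..<n}. X j \<omega> < a}" using i ab by simp_all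
    ultimately have "{j \<in> {..<n}. X j \<omega> < a} \<subset> {j \<in> {..<n}. X j \<omega> < b}" by blast
    then show "h a < h b" unfolding h_def by (intro psubset_card_mono) simp_all
  qed
  then have "search_tree m (map h ?xs) = map_mtree h (search_tree m ?xs)" by (rule search_tree_map)
  moreover have "map h ?xs = ranks n \<omega>" by (simp add: rank_list_def h_def comp_def)
  ultimately show ?thesis by (metis one_protected_map_mtree)
qed

lemma char_one_protected:
  assumes m: "3 \<le> m" and n: "0 < n"
  shows "char (distr M borel (\<lambda>\<omega>. (real (one_protected (search_tree m (map (\<lambda>i. X i \<omega>) [0..<n]))) - \<mu> * real n) / sqrt (real n))) t
    = perm_avg m n (\<lambda>x. iexp (t / sqrt (real n) * (x m - \<mu> * real n)))"
proof -
  let ?g = "\<lambda>\<rho>. (real (one_protected (search_tree m \<rho>)) - \<mu> * real n) / sqrt (real n)"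
  have "char (distr M borel (\<lambda>\<omega>. ?g (ranks n \<omega>))) t
      = integral\<^sup>L M (\<lambda>\<omega>. iexp (t * ?g (ranks n \<omega>)))"
    unfolding char_def by (subst integral_distr) (auto intro: rank_list_fun_measurable)
  also have "\<dots> = (1 / fact n) *\<^sub>R (\<Sum>\<rho>\<in>perms n. iexp (t * ?g \<rho>))"
    by (rule expectation_rank_list[OF n])
  also have "\<dots> = perm_avg m n (\<lambda>x. iexp (t / sqrt (real n) * (x m - \<mu> * real n)))"
    unfolding perm_avg_def
    by (intro arg_cong2[where f = scaleR] sum.cong refl) (simp add: one_protected_perm[OF m])
  finally show ?thesis by (simp only: one_protected_rank_list)
qed

end

theorem theorem5p4:
  fixes m :: nat and M :: "'a measure" and X :: "nat \<Rightarrow> 'a \<Rightarrow> real"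
    and Q :: "nat \<Rightarrow> 'a \<Rightarrow> nat" and \<mu> :: real
  assumes "3 \<le> m" and "m \<le> 26"
    and "prob_space M"
    and "prob_space.indep_vars M (\<lambda>_. borel) X UNIV"
    and "\<And>i. distr M borel (X i) = uniform_measure lborel {0..1}"
  defines "Q \<equiv> \<lambda>n \<omega>. one_protected (search_tree m (map (\<lambda>i. X i \<omega>) [0..<n]))"
    and "\<mu> \<equiv> 1 / (harm m - 1) * (1 / (real m + 1))"
  shows "\<exists>\<sigma>2 \<ge> 0.
      weak_conv_m (\<lambda>n. distr M borel (\<lambda>\<omega>. (real (Q n \<omega>) - \<mu> * real n) / sqrt (real n)))
        (normal_law 0 \<sigma>2) \<and>
      (\<forall>lam u v. dual_eigenbases m lam u v \<longrightarrow> complex_of_real \<sigma>2 = urn_Sigma m lam u v $$ (m, m))"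
proof -
  interpret iid_uniform M X
    using assms(3-5) by (simp add: iid_uniform_def iid_uniform_axioms_def)
  have \<mu>: "steady m m = \<mu>" using assms(1) by (simp add: steady_def \<mu>_def)
  define w where "w = (\<lambda>r. unit_fun m r - steady m m * act m r)"
  obtain \<sigma>2 where \<sigma>2: "0 \<le> \<sigma>2"
    "\<And>lam u v. dual_eigenbases m lam u v \<Longrightarrow> complex_of_real \<sigma>2 = urn_Sigma m lam u v $$ (m, m)"
    "\<And>t. (\<lambda>n. perm_avg m n (\<lambda>x. iexp (t / sqrt (real n) * dotp m w x))) \<longlonglongrightarrow> of_real (exp (- (\<sigma>2 * t\<^sup>2 / 2)))"
    using urn_variance_exists[OF assms(1,2)] unfolding w_def by blast
  have "weak_conv_m (\<lambda>n. distr M borel (\<lambda>\<omega>. (real (Q n \<omega>) - \<mu> * real n) / sqrt (real n))) (normal_law 0 \<sigma>2)"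
  proof (rule levy_continuity)
    show "real_distribution (distr M borel (\<lambda>\<omega>. (real (Q n \<omega>) - \<mu> * real n) / sqrt (real n)))" for n
      unfolding Q_def one_protected_rank_list
      by (intro real_distribution_distr rank_list_fun_measurable)
    show "real_distribution (normal_law 0 \<sigma>2)" by (rule real_distribution_normal_law)
    fix t
    have eq: "char (distr M borel (\<lambda>\<omega>. (real (Q n \<omega>) - \<mu> * real n) / sqrt (real n))) t
        = perm_avg m n (\<lambda>x. iexp (t / sqrt (real n) * dotp m w x)) * iexp (\<mu> * t / sqrt (real n))" if n: "0 < n" for n
    proof -
      have "char (distr M borel (\<lambda>\<omega>. (real (Q n \<omega>) - \<mu> * real n) / sqrt (real n))) t
          = perm_avg m n (\<lambda>x. iexp (t / sqrt (real n) * (x m - \<mu> * real n)))"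
        unfolding Q_def by (rule char_one_protected[OF assms(1) n])
      also have "\<dots> = perm_avg m n (\<lambda>x. iexp (t / sqrt (real n) * dotp m w x) * iexp (\<mu> * t / sqrt (real n)))"
      proof (rule perm_avg_cong[OF assms(1)])
        fix x assume x: "urn_state m n x"
        have "dotp m w x = x m - \<mu> * real (n + 1)"
          using x unfolding w_def dotp_diff_left \<mu>
          by (simp add: dotp_unit_fun urn_state_def dotp_def[of m "act m"] sum_act)
        then have "x m - \<mu> * real n = dotp m w x + \<mu>" by (simp add: algebra_simps)
        then have "t / sqrt (real n) * (x m - \<mu> * real n) = t / sqrt (real n) * (dotp m w x + \<mu>)"
          by (simp only:)
        also have "\<dots> = t / sqrt (real n) * dotp m w x + \<mu> * t / sqrt (real n)"
          by (simp only: distrib_left times_divide_eq_left times_divide_eq_right mult.commute)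
        finally have "t / sqrt (real n) * (x m - \<mu> * real n) = t / sqrt (real n) * dotp m w x + \<mu> * t / sqrt (real n)" .
        then show "iexp (t / sqrt (real n) * (x m - \<mu> * real n)) = iexp (t / sqrt (real n) * dotp m w x) * iexp (\<mu> * t / sqrt (real n))"
          by (simp only: of_real_add distrib_left exp_add)
      qed
      finally show ?thesis by (simp only: perm_avg_mult_right)
    qed
    have "(\<lambda>n. iexp (\<mu> * t / sqrt (real n))) \<longlonglongrightarrow> iexp 0"
    proof -
      have "(\<lambda>n. \<mu> * t / sqrt (real n)) \<longlonglongrightarrow> 0"
        by (intro real_tendsto_divide_at_top[OF tendsto_const] filterlim_compose[OF sqrt_at_top filterlim_real_sequentially])
      then show ?thesis by (intro tendsto_intros)
    qed
    then have "(\<lambda>n. perm_avg m n (\<lambda>x. iexp (t / sqrt (real n) * dotp m w x)) * iexp (\<mu> * t / sqrt (real n)))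
        \<longlonglongrightarrow> of_real (exp (- (\<sigma>2 * t\<^sup>2 / 2))) * iexp 0"
      by (intro tendsto_mult \<sigma>2(3))
    then have "(\<lambda>n. perm_avg m n (\<lambda>x. iexp (t / sqrt (real n) * dotp m w x)) * iexp (\<mu> * t / sqrt (real n)))
        \<longlonglongrightarrow> char (normal_law 0 \<sigma>2) t"
      by (simp add: char_normal_law[OF \<sigma>2(1)])
    then show "(\<lambda>n. char (distr M borel (\<lambda>\<omega>. (real (Q n \<omega>) - \<mu> * real n) / sqrt (real n))) t) \<longlonglongrightarrow> char (normal_law 0 \<sigma>2) t"
      by (rule Lim_transform_eventually) (auto intro!: eventually_sequentiallyI[of 1] simp: eq)
  qed
  with \<sigma>2(1,2) show ?thesis by blast
qed

end
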